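(* Let $\Omega\subset\mathbb{R}^2$ be an open, bounded, simply connected domain with smooth boundary, let $p\ge \tfrac32$ and $f\in L^p(\Omega)$. Then for every $\theta<\tfrac13$ the set of $C^{1,\theta}(\bar\Omega)$ very weak solutions of $$\mathcal{D}\mathrm{et}\, D^2 v = f \quad\text{in }\Omega$$ is dense in $C^0(\bar\Omega)$. More precisely, for every $\underline v\in C^0(\bar\Omega)$ and every $\epsilon>0$ there exists $\overline v\in C^{1,\theta}(\bar\Omega)$ which is a distributional solution of $\mathcal{D}\mathrm{et}\, D^2 \overline v = f$ in $\Omega$ and satisfies $\sup_{\bar\Omega}|\underline v-\overline v|<\epsilon$.
   Context: For $v\in W^{1,2}_{loc}(\Omega)$ the very weak Hessian is the distribution $$\mathcal{D}\mathrm{et}\, D^2 v := \partial^2_{12}(\partial_1 v\,\partial_2 v) - \tfrac12\partial^2_{22}\big((\partial_1 v)^2\big) - \tfrac12 \partial^2_{11}\big((\partial_2 v)^2\big) = -\tfrac12\,\mathrm{curl}\,\mathrm{curl}(\nabla v\otimes\nabla v),$$ where for a $2\times2$ matrix field $A$, $\mathrm{curl}\,\mathrm{curl}\,A=\partial_{22}A_{11}-\partial_{12}A_{12}-\partial_{12}A_{21}+\partial_{11}A_{22}$. A very weak (distributional) solution of $\mathcal{D}\mathrm{et}\, D^2 v=f$ is a $v$ for which this distribution equals $f$. *)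

theory Defs
  imports "HOL-Analysis.Analysis"
begin

definition pd1 :: "(real \<times> real \<Rightarrow> real) \<Rightarrow> real \<times> real \<Rightarrow> real" where
  "pd1 u = (\<lambda>(x, y). deriv (\<lambda>t. u (t, y)) x)"

definition pd2 :: "(real \<times> real \<Rightarrow> real) \<Rightarrow> real \<times> real \<Rightarrow> real" where
  "pd2 u = (\<lambda>(x, y). deriv (\<lambda>t. u (x, t)) y)"

fun Ck :: "nat \<Rightarrow> (real \<times> real) set \<Rightarrow> (real \<times> real \<Rightarrow> real) \<Rightarrow> bool" where
  "Ck 0 U u = continuous_on U u"
| "Ck (Suc k) U u = ((\<forall>x\<in>U. u differentiable (at x)) \<and> Ck k U (pd1 u) \<and> Ck k U (pd2 u))"

definition smooth :: "(real \<times> real \<Rightarrow> real) \<Rightarrow> bool" where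
  "smooth u \<longleftrightarrow> (\<forall>k. Ck k UNIV u)"

definition smooth_boundary :: "(real \<times> real) set \<Rightarrow> bool" where
  "smooth_boundary \<Omega> \<longleftrightarrow> (\<exists>\<rho>. smooth \<rho> \<and> \<Omega> = {x. \<rho> x < 0} \<and>
      (\<forall>x. \<rho> x = 0 \<longrightarrow> (pd1 \<rho> x, pd2 \<rho> x) \<noteq> (0, 0)))"

definition Lp_on :: "real \<Rightarrow> (real \<times> real) set \<Rightarrow> (real \<times> real \<Rightarrow> real) \<Rightarrow> bool" where
  "Lp_on p \<Omega> f \<longleftrightarrow> f \<in> borel_measurable (lebesgue_on \<Omega>) \<and>
      integrable (lebesgue_on \<Omega>) (\<lambda>x. \<bar>f x\<bar> powr p)"

definition test_fun :: "(real \<times> real) set \<Rightarrow> (real \<times> real \<Rightarrow> real) \<Rightarrow> bool" where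
  "test_fun \<Omega> \<phi> \<longleftrightarrow> smooth \<phi> \<and> compact (closure {x. \<phi> x \<noteq> 0}) \<and> closure {x. \<phi> x \<noteq> 0} \<subseteq> \<Omega>"

definition holder_on :: "real \<Rightarrow> (real \<times> real) set \<Rightarrow> (real \<times> real \<Rightarrow> real) \<Rightarrow> bool" where
  "holder_on \<theta> S g \<longleftrightarrow> (\<exists>C. \<forall>x\<in>S. \<forall>y\<in>S. \<bar>g x - g y\<bar> \<le> C * dist x y powr \<theta>)"

text \<open>C^{1,\<theta>}(closure \<Omega>): continuous on the closure, differentiable in \<Omega>, gradient
  uniformly \<theta>-Hoelder on \<Omega> (hence extends Hoelder-continuously to the closure).\<close>
definition C1_holder :: "real \<Rightarrow> (real \<times> real) set \<Rightarrow> (real \<times> real \<Rightarrow> real) \<Rightarrow> bool" where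
  "C1_holder \<theta> \<Omega> v \<longleftrightarrow> continuous_on (closure \<Omega>) v \<and> (\<forall>x\<in>\<Omega>. v differentiable (at x)) \<and>
      holder_on \<theta> \<Omega> (pd1 v) \<and> holder_on \<theta> \<Omega> (pd2 v)"

definition very_weak_hessian_sol ::
    "(real \<times> real) set \<Rightarrow> (real \<times> real \<Rightarrow> real) \<Rightarrow> (real \<times> real \<Rightarrow> real) \<Rightarrow> bool" where
  "very_weak_hessian_sol \<Omega> f v \<longleftrightarrow> (\<forall>\<phi>. test_fun \<Omega> \<phi> \<longrightarrow>
      (LINT x:\<Omega>|lebesgue. pd1 v x * pd2 v x * pd1 (pd2 \<phi>) x
          - (1/2) * (pd1 v x)\<^sup>2 * pd2 (pd2 \<phi>) x
          - (1/2) * (pd2 v x)\<^sup>2 * pd1 (pd1 \<phi>) x)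
      = (LINT x:\<Omega>|lebesgue. f x * \<phi> x))"

end

theory Submission
  imports Defs
begin

text \<open>
  Convex integration with one corrugation per step, carried out entirely inside the algebra of
  trigonometric polynomials with absolutely summed coefficients. Write the defect of an approximate
  solution v as det D^2 v - Laplacian g = d_jj P + d_ii R for a pair of coordinate directions i, j, where
  g is a truncated Fourier series with Laplacian g close to f. Adding (a/nu) cos(nu x_i) with a^2/4
  equal to P plus a constant removes P. The error consists of a zero-order low-frequency part
  det D^2 a / (2 nu^2) and of terms whose frequencies are almost parallel to the i-axis; the latter
  are of the form d_ii u with u gaining nu^-2, so they fall on R alone and the next
  step only has to corrugate in the direction j. This single corrugation per step is what gives
  every Hoelder exponent below 1/3. Since all functions are band limited there is no loss of
  derivatives and nothing has to be mollified. The square root needed for a is replaced by a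
  polynomial, which leaves an error of high order in P.

  The hypothesis on f enters through the tail bound sum_{|k| > N} |f^(k)| / |k|^2 <= C N^(-2/3), which
  follows from Young's inequality applied to f against trigonometric polynomials with unimodular
  coefficients.
\<close>


section \<open>Partial derivatives and trigonometric polynomials\<close>

text \<open>Absolute summation of coefficients is the norm of choice because it is
  submultiplicative, turns a bound on frequencies into a bound on derivatives, and is not increased
  by d_i d_j composed with the inverse Laplacian, which is unbounded on continuous functions. The
  potentials P and R trade places after every step. R waits for one step and must by then obey the
  bound for the next P, so the error of a step is measured two amplitudes ahead. With frequency x
  followed by x^b and gradient amplitude x^(-t), the main error has exponent 1 - b - t - t b and the
  allowance is -2 t b^2. Both are -2 t at b = 1; comparing the derivatives -(1 + t) and -4 t leaves
  room for b slightly above 1 exactly when t < 1/3. The same threshold meets f: among about N^2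
  frequencies of size N the coefficients sum to O((N^2)^(2/3)), division by N^2 gives N^(-2/3), and
  this beats x^(-2t) for t < 1/3. The constant added to P costs nothing since second derivatives
  kill it, and it keeps the quantity under the square root near a positive constant.\<close>

definition co :: "bool \<Rightarrow> real \<times> real \<Rightarrow> real" where
  "co i x = (if i then fst x else snd x)"

definition pd :: "bool \<Rightarrow> (real \<times> real \<Rightarrow> real) \<Rightarrow> real \<times> real \<Rightarrow> real" where
  "pd i = (if i then pd1 else pd2)"

lemma co_simps [simp]:
  "co i (x + y) = co i x + co i y" "co i (x - y) = co i x - co i y" "co i (- x) = - co i x"
  "co True (a, b) = a" "co False (a, b) = b" "co i 0 = 0" "co i (c *\<^sub>R x) = c * co i x"
  by (auto simp: co_def)

lemma abs_co_le: "\<bar>co i x\<bar> \<le> norm x"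
  using norm_fst_le[of "fst x" "snd x"] norm_snd_le[of "snd x" "fst x"] by (auto simp: co_def)

lemma has_derivative_imp_pd:
  assumes "(u has_derivative (\<lambda>h. a * fst h + b * snd h)) (at x)"
  shows "pd True u x = a" "pd False u x = b"
proof -
  obtain p q where x: "x = (p, q)" by (cases x)
  have "((\<lambda>t. u (t, q)) has_derivative (\<lambda>h. a * fst (h, 0::real) + b * snd (h, 0::real))) (at p)"
    by (rule has_derivative_compose[where f="\<lambda>t. (t, q)" and g=u])
       (use assms x in \<open>auto intro!: derivative_eq_intros\<close>)
  then have "((\<lambda>t. u (t, q)) has_field_derivative a) (at p)"
    by (simp add: has_field_derivative_def)
  then show "pd True u x = a" by (simp add: pd_def pd1_def x DERIV_imp_deriv)
  have "((\<lambda>t. u (p, t)) has_derivative (\<lambda>h. a * fst (0::real, h) + b * snd (0::real, h))) (at q)"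
    by (rule has_derivative_compose[where f="\<lambda>t. (p, t)" and g=u])
       (use assms x in \<open>auto intro!: derivative_eq_intros\<close>)
  then have "((\<lambda>t. u (p, t)) has_field_derivative b) (at q)"
    by (simp add: has_field_derivative_def)
  then show "pd False u x = b" by (simp add: pd_def pd2_def x DERIV_imp_deriv)
qed

lemma differentiable_has_pd:
  assumes "u differentiable (at x)"
  shows "(u has_derivative (\<lambda>h. pd True u x * fst h + pd False u x * snd h)) (at x)"
proof -
  obtain D where D: "(u has_derivative D) (at x)"
    using assms by (auto simp: differentiable_def)
  then interpret D: bounded_linear D by (rule has_derivative_bounded_linear)
  have "D h = D (1, 0) * fst h + D (0, 1) * snd h" for h
  proof -
    have "h = fst h *\<^sub>R (1, 0) + snd h *\<^sub>R (0, 1)" by (cases h) simp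
    then have "D h = D (fst h *\<^sub>R (1, 0) + snd h *\<^sub>R (0, 1))" by simp
    also have "\<dots> = D (1, 0) * fst h + D (0, 1) * snd h"
      by (simp only: D.add D.scaleR) simp
    finally show ?thesis .
  qed
  then have "D = (\<lambda>h. D (1, 0) * fst h + D (0, 1) * snd h)" by blast
  with D have "(u has_derivative (\<lambda>h. D (1, 0) * fst h + D (0, 1) * snd h)) (at x)" by simp
  with has_derivative_imp_pd[OF this] show ?thesis by simp
qed

lemma pd_unique:
  assumes "(u has_derivative (\<lambda>h. D True * fst h + D False * snd h)) (at x)"
  shows "pd i u x = D i"
  using has_derivative_imp_pd[OF assms] by (cases i) auto

lemma pd_add:
  assumes "u differentiable (at x)" "v differentiable (at x)"
  shows "pd i (\<lambda>x. u x + v x) x = pd i u x + pd i v x"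
  by (rule pd_unique[where D="\<lambda>i. pd i u x + pd i v x"])
     (use has_derivative_add[OF assms[THEN differentiable_has_pd]] in \<open>simp add: algebra_simps\<close>)

lemma pd_diff:
  assumes "u differentiable (at x)" "v differentiable (at x)"
  shows "pd i (\<lambda>x. u x - v x) x = pd i u x - pd i v x"
  by (rule pd_unique[where D="\<lambda>i. pd i u x - pd i v x"])
     (use has_derivative_diff[OF assms[THEN differentiable_has_pd]] in \<open>simp add: algebra_simps\<close>)

lemma pd_mult:
  assumes "u differentiable (at x)" "v differentiable (at x)"
  shows "pd i (\<lambda>x. u x * v x) x = pd i u x * v x + u x * pd i v x"
  by (rule pd_unique[where D="\<lambda>i. pd i u x * v x + u x * pd i v x"])
     (use has_derivative_mult[OF assms[THEN differentiable_has_pd]] in \<open>simp add: algebra_simps\<close>)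

lemma pd_const [simp]: "pd i (\<lambda>x. c) = (\<lambda>x. 0)"
  by (rule ext, rule pd_unique[where D="\<lambda>i. 0"]) (auto intro!: derivative_eq_intros)

lemma pd_cmult:
  assumes "u differentiable (at x)"
  shows "pd i (\<lambda>x. c * u x) x = c * pd i u x"
  using pd_mult[of "\<lambda>x. c" x u i] assms by simp

text \<open>A certificate rather than a norm: it records one representation as a finite sum of
  cosine waves with frequencies in \<open>F\<close>, and \<open>K\<close> only bounds the sum of the
  absolute amplitudes. Frequencies may repeat and need not lie on a lattice, so the corrugation
  frequencies can be chosen freely. Real waves with a phase avoid complex exponentials; the price is
  that products produce both sums and differences of frequencies.\<close>

inductive wiener :: "(real \<times> real) set \<Rightarrow> real \<Rightarrow> (real \<times> real \<Rightarrow> real) \<Rightarrow> bool" for F where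
  wiener_0: "0 \<le> K \<Longrightarrow> wiener F K (\<lambda>_. 0)"
| wiener_step: "\<xi> \<in> F \<Longrightarrow> wiener F K u \<Longrightarrow> wiener F (K + \<bar>r\<bar>) (\<lambda>x. r * cos (\<xi> \<bullet> x + \<phi>) + u x)"

lemma wiener_nonneg: "wiener F K u \<Longrightarrow> 0 \<le> K"
  by (induction rule: wiener.induct) auto

lemma wiener_mono:
  assumes "wiener F K u" "F \<subseteq> G" "K \<le> L"
  shows "wiener G L u"
  using assms(1,3)
proof (induction arbitrary: L rule: wiener.induct)
  case (wiener_0 K)
  then show ?case by (auto intro: wiener.wiener_0)
next
  case (wiener_step \<xi> K u r \<phi>)
  have "wiener G (L - \<bar>r\<bar>) u" using wiener_step by auto
  from wiener.wiener_step[OF _ this, of \<xi> r \<phi>] wiener_step(1) assms(2)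
  show ?case by auto
qed

lemma wiener_wave: "\<xi> \<in> F \<Longrightarrow> wiener F \<bar>r\<bar> (\<lambda>x. r * cos (\<xi> \<bullet> x + \<phi>))"
  using wiener_step[OF _ wiener_0[of 0], of \<xi> F r \<phi>] by simp

lemma wiener_const: "0 \<in> F \<Longrightarrow> wiener F \<bar>c\<bar> (\<lambda>x. c)"
  using wiener_wave[of 0 F c 0] by simp

lemma wiener_add:
  assumes "wiener F K u" "wiener F L v"
  shows "wiener F (K + L) (\<lambda>x. u x + v x)"
  using assms(1)
proof (induction rule: wiener.induct)
  case (wiener_0 K)
  then show ?case using assms(2) wiener_mono[OF assms(2) order_refl, of "K + L"] by simp
next
  case (wiener_step \<xi> K u r \<phi>)
  from wiener.wiener_step[OF wiener_step(1,3), of r \<phi>]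
  show ?case by (simp add: algebra_simps)
qed

lemma wiener_cmult:
  assumes "wiener F K u"
  shows "wiener F (\<bar>c\<bar> * K) (\<lambda>x. c * u x)"
  using assms
proof (induction rule: wiener.induct)
  case (wiener_0 K)
  then show ?case using wiener.wiener_0[of "\<bar>c\<bar> * K" F] by simp
next
  case (wiener_step \<xi> K u r \<phi>)
  from wiener.wiener_step[OF wiener_step(1,3), of "c * r" \<phi>]
  show ?case by (simp add: algebra_simps abs_mult)
qed

lemma wiener_minus: "wiener F K u \<Longrightarrow> wiener F K (\<lambda>x. - u x)"
  using wiener_cmult[of F K u "-1"] by simp

lemma wiener_diff:
  "wiener F K u \<Longrightarrow> wiener F L v \<Longrightarrow> wiener F (K + L) (\<lambda>x. u x - v x)"
  using wiener_add[OF _ wiener_minus, of F K u L v] by simp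

lemma wiener_sum:
  assumes "finite A" "\<And>a. a \<in> A \<Longrightarrow> wiener F (K a) (u a)"
  shows "wiener F (\<Sum>a\<in>A. K a) (\<lambda>x. \<Sum>a\<in>A. u a x)"
  using assms by (induction A) (auto intro!: wiener_0 wiener_add)

text \<open>The product formula for cosines splits each product of two waves into two waves of half
  the amplitude, at \<xi> + \<eta> and \<xi> - \<eta>. The total amplitude is exactly
  multiplicative, which makes the coefficient bound submultiplicative.\<close>

lemma wiener_mult_wave:
  assumes "wiener F K u" "\<And>\<eta>. \<eta> \<in> F \<Longrightarrow> \<xi> + \<eta> \<in> H \<and> \<xi> - \<eta> \<in> H"
  shows "wiener H (\<bar>r\<bar> * K) (\<lambda>x. r * cos (\<xi> \<bullet> x + \<phi>) * u x)"
  using assms(1)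
proof (induction rule: wiener.induct)
  case (wiener_0 K)
  then show ?case using wiener.wiener_0[of "\<bar>r\<bar> * K" H] by simp
next
  case (wiener_step \<eta> K u s \<psi>)
  from wiener.wiener_step[OF _ wiener.wiener_step[OF _ wiener_step(3)],
     where r="r * s / 2" and r1="r * s / 2" and \<phi>="\<phi> + \<psi>" and \<phi>1="\<phi> - \<psi>" and \<xi>="\<xi> + \<eta>" and \<xi>1="\<xi> - \<eta>"]
  have "wiener H (\<bar>r\<bar> * K + \<bar>r * s / 2\<bar> + \<bar>r * s / 2\<bar>)
     (\<lambda>x. r * s / 2 * cos ((\<xi> + \<eta>) \<bullet> x + (\<phi> + \<psi>)) +
          (r * s / 2 * cos ((\<xi> - \<eta>) \<bullet> x + (\<phi> - \<psi>)) + r * cos (\<xi> \<bullet> x + \<phi>) * u x))"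
    using assms(2)[OF wiener_step(1)] by simp
  moreover have "r * s / 2 * cos ((\<xi> + \<eta>) \<bullet> x + (\<phi> + \<psi>)) +
          (r * s / 2 * cos ((\<xi> - \<eta>) \<bullet> x + (\<phi> - \<psi>)) + r * cos (\<xi> \<bullet> x + \<phi>) * u x)
      = r * cos (\<xi> \<bullet> x + \<phi>) * (s * cos (\<eta> \<bullet> x + \<psi>) + u x)" for x
  proof -
    have 1: "(\<xi> + \<eta>) \<bullet> x + (\<phi> + \<psi>) = (\<xi> \<bullet> x + \<phi>) + (\<eta> \<bullet> x + \<psi>)"
         "(\<xi> - \<eta>) \<bullet> x + (\<phi> - \<psi>) = (\<xi> \<bullet> x + \<phi>) - (\<eta> \<bullet> x + \<psi>)"
      by (auto simp: algebra_simps)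
    show ?thesis unfolding 1 cos_add cos_diff by (simp add: field_simps)
  qed
  ultimately show ?case by (simp add: algebra_simps abs_mult)
qed

lemma wiener_mult:
  assumes "wiener F K u" "wiener G L v"
    "\<And>\<xi> \<eta>. \<xi> \<in> F \<Longrightarrow> \<eta> \<in> G \<Longrightarrow> \<xi> + \<eta> \<in> H \<and> \<xi> - \<eta> \<in> H"
  shows "wiener H (K * L) (\<lambda>x. u x * v x)"
  using assms(1)
proof (induction rule: wiener.induct)
  case (wiener_0 K)
  then show ?case using wiener.wiener_0[of "K * L" H] wiener_nonneg[OF assms(2)] by simp
next
  case (wiener_step \<xi> K u r \<phi>)
  have "wiener H (\<bar>r\<bar> * L) (\<lambda>x. r * cos (\<xi> \<bullet> x + \<phi>) * v x)"
    by (rule wiener_mult_wave[OF assms(2)]) (use assms(3) wiener_step(1) in auto)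
  from wiener_add[OF this wiener_step(3)]
  show ?case by (simp add: algebra_simps)
qed

lemma wiener_bound: "wiener F K u \<Longrightarrow> \<bar>u x\<bar> \<le> K"
proof (induction rule: wiener.induct)
  case (wiener_step \<xi> K u r \<phi>)
  have "\<bar>r * cos (\<xi> \<bullet> x + \<phi>) + u x\<bar> \<le> \<bar>r\<bar> * \<bar>cos (\<xi> \<bullet> x + \<phi>)\<bar> + \<bar>u x\<bar>"
    by (metis abs_mult abs_triangle_ineq)
  also have "\<dots> \<le> \<bar>r\<bar> * 1 + K" using wiener_step by (intro add_mono mult_left_mono) auto
  finally show ?case by simp
qed simp

lemma wave_has_derivative:
  "((\<lambda>x. r * cos (\<xi> \<bullet> x + \<phi>)) has_derivative
     (\<lambda>h. (r * co True \<xi> * cos (\<xi> \<bullet> x + (\<phi> + pi/2))) * fst h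
        + (r * co False \<xi> * cos (\<xi> \<bullet> x + (\<phi> + pi/2))) * snd h)) (at x)"
proof -
  have *: "cos (\<xi> \<bullet> x + (\<phi> + pi/2)) = - sin (\<xi> \<bullet> x + \<phi>)"
    using cos_add[of "\<xi> \<bullet> x + \<phi>" "pi/2"] by (simp add: add.assoc)
  show ?thesis unfolding *
    by (auto intro!: derivative_eq_intros simp: fun_eq_iff inner_prod_def co_def algebra_simps)
qed

lemma differentiable_wave:
  fixes \<xi> :: "real \<times> real"
  shows "(\<lambda>x. r * cos (\<xi> \<bullet> x + \<phi>)) differentiable (at x)"
  unfolding differentiable_def by (rule exI, rule wave_has_derivative)

lemma pd_wave: "pd i (\<lambda>x. r * cos (\<xi> \<bullet> x + \<phi>)) = (\<lambda>x. (r * co i \<xi>) * cos (\<xi> \<bullet> x + (\<phi> + pi/2)))"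
  by (rule ext, rule pd_unique[where D="\<lambda>i. (r * co i \<xi>) * cos (\<xi> \<bullet> _ + (\<phi> + pi/2))"])
     (rule wave_has_derivative)

lemma wiener_differentiable: "wiener F K u \<Longrightarrow> u differentiable (at x)"
proof (induction rule: wiener.induct)
  case (wiener_step \<xi> K u r \<phi>)
  then show ?case by (intro differentiable_add differentiable_wave)
qed simp

text \<open>Bernstein's inequality, here termwise and for a single coordinate direction:
  differentiation multiplies each amplitude by a component of its frequency and shifts the phase by
  a quarter period.\<close>

lemma wiener_pd:
  assumes "wiener F K u" "\<And>\<xi>. \<xi> \<in> F \<Longrightarrow> \<bar>co i \<xi>\<bar> \<le> \<mu>" "0 \<le> \<mu>"
  shows "wiener F (\<mu> * K) (pd i u)"
  using assms(1)
proof (induction rule: wiener.induct)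
  case (wiener_0 K)
  then show ?case using assms(3) wiener.wiener_0[of "\<mu> * K" F] by simp
next
  case (wiener_step \<xi> K u r \<phi>)
  have "pd i (\<lambda>x. r * cos (\<xi> \<bullet> x + \<phi>) + u x) =
      (\<lambda>x. (r * co i \<xi>) * cos (\<xi> \<bullet> x + (\<phi> + pi/2)) + pd i u x)"
    by (auto simp: fun_eq_iff pd_add[OF differentiable_wave wiener_differentiable[OF wiener_step(2)]] pd_wave)
  moreover have "\<mu> * K + \<bar>r * co i \<xi>\<bar> \<le> \<mu> * (K + \<bar>r\<bar>)"
    using mult_left_mono[OF assms(2)[OF wiener_step(1)], of "\<bar>r\<bar>"] by (simp add: algebra_simps abs_mult)
  ultimately show ?case
    using wiener_mono[OF wiener.wiener_step[OF wiener_step(1,3), of "r * co i \<xi>" "\<phi> + pi/2"] order_refl]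
    by metis
qed

lemma wiener_pd_cball:
  "wiener (cball 0 \<mu>) K u \<Longrightarrow> 0 \<le> \<mu> \<Longrightarrow> wiener (cball 0 \<mu>) (\<mu> * K) (pd i u)"
  by (erule wiener_pd) (auto intro: order_trans[OF abs_co_le])

lemma wiener_finite:
  assumes "wiener F K u"
  shows "\<exists>\<mu>\<ge>0. wiener (F \<inter> cball 0 \<mu>) K u"
  using assms
proof (induction rule: wiener.induct)
  case (wiener_0 K)
  then show ?case by (auto intro!: wiener.wiener_0)
next
  case (wiener_step \<xi> K u r \<phi>)
  then obtain \<mu> where "0 \<le> \<mu>" "wiener (F \<inter> cball 0 \<mu>) K u" by blast
  then have "wiener (F \<inter> cball 0 (max \<mu> (norm \<xi>))) (K + \<bar>r\<bar>) (\<lambda>x. r * cos (\<xi> \<bullet> x + \<phi>) + u x)"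
    by (intro wiener.wiener_step) (auto simp: wiener_step(1) intro: wiener_mono)
  with \<open>0 \<le> \<mu>\<close> show ?case by (intro exI[of _ "max \<mu> (norm \<xi>)"]) auto
qed

section \<open>Trigonometric polynomials without a size: a differential algebra for exact
  identities\<close>

definition trig_poly :: "(real \<times> real \<Rightarrow> real) \<Rightarrow> bool" where
  "trig_poly u \<longleftrightarrow> (\<exists>K. wiener UNIV K u)"

lemma wiener_trig_poly: "wiener F K u \<Longrightarrow> trig_poly u"
  unfolding trig_poly_def using wiener_mono[of F K u UNIV K] by blast

lemma trig_poly_cball: "trig_poly u \<Longrightarrow> \<exists>\<mu>\<ge>0. \<exists>K. wiener (cball 0 \<mu>) K u"
  unfolding trig_poly_def using wiener_finite[of UNIV] by (metis inf_top_left)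

lemma trig_poly_intros [simp, intro]:
  "trig_poly (\<lambda>x. c)" "trig_poly u \<Longrightarrow> trig_poly v \<Longrightarrow> trig_poly (\<lambda>x. u x + v x)" "trig_poly u \<Longrightarrow> trig_poly v \<Longrightarrow> trig_poly (\<lambda>x. u x - v x)"
  "trig_poly u \<Longrightarrow> trig_poly v \<Longrightarrow> trig_poly (\<lambda>x. u x * v x)" "trig_poly u \<Longrightarrow> trig_poly (\<lambda>x. - u x)" "trig_poly u \<Longrightarrow> trig_poly (\<lambda>x. u x / c)"
  "trig_poly (\<lambda>x. cos (\<xi> \<bullet> x + \<phi>))"
proof -
  show "trig_poly (\<lambda>x. c)" for c by (auto intro: wiener_trig_poly wiener_const[of UNIV])
  show "trig_poly u \<Longrightarrow> trig_poly v \<Longrightarrow> trig_poly (\<lambda>x. u x + v x)" unfolding trig_poly_def by (blast intro: wiener_add)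
  show "trig_poly u \<Longrightarrow> trig_poly v \<Longrightarrow> trig_poly (\<lambda>x. u x - v x)" unfolding trig_poly_def by (blast intro: wiener_diff)
  show "trig_poly u \<Longrightarrow> trig_poly v \<Longrightarrow> trig_poly (\<lambda>x. u x * v x)" unfolding trig_poly_def by (blast intro: wiener_mult)
  show "trig_poly u \<Longrightarrow> trig_poly (\<lambda>x. - u x)" unfolding trig_poly_def by (blast intro: wiener_minus)
  show "trig_poly u \<Longrightarrow> trig_poly (\<lambda>x. u x / c)"
    unfolding trig_poly_def using wiener_cmult[of UNIV _ u "1/c"] by auto
  show "trig_poly (\<lambda>x. cos (\<xi> \<bullet> x + \<phi>))" using wiener_trig_poly[OF wiener_wave[of \<xi> UNIV 1 \<phi>]] by simp
qed

lemma trig_poly_power [simp, intro]: "trig_poly u \<Longrightarrow> trig_poly (\<lambda>x. u x ^ n)"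
  by (induction n) auto

lemma trig_poly_pd [simp, intro]: "trig_poly u \<Longrightarrow> trig_poly (pd i u)"
  using trig_poly_cball[of u] by (auto intro: wiener_trig_poly wiener_pd_cball)

lemma trig_poly_differentiable: "trig_poly u \<Longrightarrow> u differentiable (at x)"
  unfolding trig_poly_def by (auto intro: wiener_differentiable)

lemma trig_poly_continuous_on: "trig_poly u \<Longrightarrow> continuous_on A u"
  by (meson differentiable_imp_continuous_within continuous_at_imp_continuous_on trig_poly_differentiable)

lemma trig_poly_pd_simps:
  "trig_poly u \<Longrightarrow> trig_poly v \<Longrightarrow> pd i (\<lambda>x. u x + v x) = (\<lambda>x. pd i u x + pd i v x)"
  "trig_poly u \<Longrightarrow> trig_poly v \<Longrightarrow> pd i (\<lambda>x. u x - v x) = (\<lambda>x. pd i u x - pd i v x)"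
  "trig_poly u \<Longrightarrow> trig_poly v \<Longrightarrow> pd i (\<lambda>x. u x * v x) = (\<lambda>x. pd i u x * v x + u x * pd i v x)"
  "trig_poly u \<Longrightarrow> pd i (\<lambda>x. - u x) = (\<lambda>x. - pd i u x)"
  "trig_poly u \<Longrightarrow> pd i (\<lambda>x. u x / c) = (\<lambda>x. pd i u x / c)"
  using pd_cmult[of u _ i "-1"] pd_cmult[of u _ i "1/c"]
  by (auto simp: fun_eq_iff pd_add pd_diff pd_mult trig_poly_differentiable)

lemma trig_poly_pd_commute:
  assumes "trig_poly u"
  shows "pd i (pd j u) = pd j (pd i u)"
proof -
  obtain K where "wiener UNIV K u" using assms by (auto simp: trig_poly_def)
  then show ?thesis
  proof (induction rule: wiener.induct)
    case (wiener_step \<xi> K u r \<phi>)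
    have e: "trig_poly (\<lambda>x. r * cos (\<xi> \<bullet> x + \<phi>))" "trig_poly u" for r \<phi>
      using wiener_step wiener_trig_poly[OF wiener_wave[of \<xi> UNIV r \<phi>]] by (auto simp: trig_poly_def)
    show ?case
      unfolding trig_poly_pd_simps(1)[OF e] pd_wave trig_poly_pd_simps(1)[OF e(1) trig_poly_pd[OF e(2)]] wiener_step.IH
      by (simp add: mult_ac)
  qed simp
qed

text \<open>Each amplitude is divided by minus the square of the i-th component of its frequency.
  The lower bound \<nu> on that component excludes small divisors, so the gain is \<nu>^(-2) and the
  set of frequencies stays the same. This is how oscillating errors are turned into second
  derivatives in the corrugated direction.\<close>

lemma wiener_inverse_pd2:
  assumes "wiener F K u" "\<And>\<xi>. \<xi> \<in> F \<Longrightarrow> \<nu> \<le> \<bar>co i \<xi>\<bar>" "0 < \<nu>"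
  shows "\<exists>w. wiener F (K / \<nu>\<^sup>2) w \<and> pd i (pd i w) = u"
  using assms(1)
proof (induction rule: wiener.induct)
  case (wiener_0 K)
  then show ?case using assms(3) wiener.wiener_0[of "K / \<nu>\<^sup>2" F] by (intro exI[of _ "\<lambda>x. 0"]) simp
next
  case (wiener_step \<xi> K u r \<phi>)
  then obtain w where w: "wiener F (K / \<nu>\<^sup>2) w" "pd i (pd i w) = u" by blast
  have nz: "co i \<xi> \<noteq> 0" using assms(2)[OF wiener_step(1)] assms(3) by auto
  let ?w = "\<lambda>x. - (r / (co i \<xi>)\<^sup>2) * cos (\<xi> \<bullet> x + \<phi>) + w x"
  have e: "trig_poly w" "trig_poly (\<lambda>x. r * cos (\<xi> \<bullet> x + \<phi>))" for r \<phi>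
    using w wiener_trig_poly[OF wiener_wave[of \<xi> UNIV r \<phi>]] by (auto intro: wiener_trig_poly)
  have c: "cos (\<xi> \<bullet> x + (\<phi> + pi / 2 + pi / 2)) = - cos (\<xi> \<bullet> x + \<phi>)" for x
    using cos_add[of "\<xi> \<bullet> x + \<phi>" pi] by (simp add: add.assoc)
  have "pd i (pd i ?w) = (\<lambda>x. r * cos (\<xi> \<bullet> x + \<phi>) + u x)"
    unfolding trig_poly_pd_simps(1)[OF e(2) e(1)] pd_wave trig_poly_pd_simps(1)[OF e(2) trig_poly_pd[OF e(1)]] w(2) c
    using nz by (simp add: power2_eq_square)
  moreover have "wiener F ((K + \<bar>r\<bar>) / \<nu>\<^sup>2) ?w"
  proof (rule wiener_mono[OF wiener.wiener_step[OF wiener_step(1) w(1)] order_refl])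
    have "\<nu>\<^sup>2 \<le> (co i \<xi>)\<^sup>2"
      using assms(2)[OF wiener_step(1)] assms(3) by (metis abs_le_square_iff abs_of_pos)
    then have "\<bar>- (r / (co i \<xi>)\<^sup>2)\<bar> \<le> \<bar>r\<bar> / \<nu>\<^sup>2"
      using assms(3) by (auto simp: abs_divide intro!: divide_left_mono mult_pos_pos)
    then show "K / \<nu>\<^sup>2 + \<bar>- (r / (co i \<xi>)\<^sup>2)\<bar> \<le> (K + \<bar>r\<bar>) / \<nu>\<^sup>2"
      by (simp add: add_divide_distrib)
  qed
  ultimately show ?case by blast
qed

section \<open>The Laplacian and its inverse on second derivatives\<close>

definition lap :: "(real \<times> real \<Rightarrow> real) \<Rightarrow> real \<times> real \<Rightarrow> real" where
  "lap u x = pd True (pd True u) x + pd False (pd False u) x"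

lemma lap_alt: "lap u x = pd i (pd i u) x + pd (\<not> i) (pd (\<not> i) u) x"
  by (cases i) (auto simp: lap_def)

lemma trig_poly_lap [simp, intro]: "trig_poly u \<Longrightarrow> trig_poly (lap u)"
  unfolding lap_def[abs_def] by auto

lemma lap_simps:
  "trig_poly u \<Longrightarrow> trig_poly v \<Longrightarrow> lap (\<lambda>x. u x + v x) = (\<lambda>x. lap u x + lap v x)"
  "trig_poly u \<Longrightarrow> trig_poly v \<Longrightarrow> lap (\<lambda>x. u x - v x) = (\<lambda>x. lap u x - lap v x)"
  "lap (\<lambda>x. 0) = (\<lambda>x. 0)"
  by (auto simp: lap_def trig_poly_pd_simps fun_eq_iff)

lemma lap_wave: "lap (\<lambda>x. r * cos (\<xi> \<bullet> x + \<phi>)) = (\<lambda>x. - (r * (norm \<xi>)\<^sup>2) * cos (\<xi> \<bullet> x + \<phi>))"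
proof -
  have c: "cos (\<xi> \<bullet> x + (\<phi> + pi / 2 + pi / 2)) = - cos (\<xi> \<bullet> x + \<phi>)" for x
    using cos_add[of "\<xi> \<bullet> x + \<phi>" pi] by (simp add: add.assoc)
  have n: "(norm \<xi>)\<^sup>2 = co True \<xi> * co True \<xi> + co False \<xi> * co False \<xi>"
    by (simp add: norm_prod_def co_def power2_eq_square)
  show ?thesis
    unfolding fun_eq_iff lap_def pd_wave c n by (simp add: algebra_simps)
qed

text \<open>The multiplier \<xi>_i \<xi>_j / |\<xi>|^2 is at most 1 in absolute value at every
  frequency. Because amplitudes are summed absolutely, this alone bounds the operator, with constant
  1 and no loss.\<close>

lemma wiener_inverse_lap:
  assumes "wiener F K u"
  shows "\<exists>w. wiener F K w \<and> lap w = pd i (pd j u)"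
  using assms
proof (induction rule: wiener.induct)
  case (wiener_0 K)
  then show ?case using wiener.wiener_0[of K F] by (intro exI[of _ "\<lambda>x. 0"]) (simp add: lap_simps)
next
  case (wiener_step \<xi> K u r \<phi>)
  then obtain w where w: "wiener F K w" "lap w = pd i (pd j u)" by blast
  have e: "trig_poly w" "trig_poly u" "trig_poly (\<lambda>x. r * cos (\<xi> \<bullet> x + \<phi>))" for r \<phi>
    using w wiener_step wiener_trig_poly[OF wiener_wave[of \<xi> UNIV r \<phi>]] by (auto intro: wiener_trig_poly)
  have c: "cos (\<xi> \<bullet> x + (\<phi> + pi / 2 + pi / 2)) = - cos (\<xi> \<bullet> x + \<phi>)" for x
    using cos_add[of "\<xi> \<bullet> x + \<phi>" pi] by (simp add: add.assoc)
  \<comment> \<open>For \<xi> = 0 the quotient is 0 by the convention on division by zero; this is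
    the right value, because a constant has vanishing second derivatives.\<close>
  let ?s = "r * co i \<xi> * co j \<xi> / (norm \<xi>)\<^sup>2"
  let ?w = "\<lambda>x. ?s * cos (\<xi> \<bullet> x + \<phi>) + w x"
  have s: "?s * (norm \<xi>)\<^sup>2 = r * co i \<xi> * co j \<xi>"
    by (cases "\<xi> = 0") auto
  have "lap ?w = pd i (pd j (\<lambda>x. r * cos (\<xi> \<bullet> x + \<phi>) + u x))"
    unfolding lap_simps(1)[OF e(3) e(1)] lap_wave s w(2)
    unfolding trig_poly_pd_simps(1)[OF e(3) e(2)] pd_wave trig_poly_pd_simps(1)[OF e(3) trig_poly_pd[OF e(2)]] c
    by (simp add: algebra_simps)
  moreover have "wiener F (K + \<bar>r\<bar>) ?w"
  proof (rule wiener_mono[OF wiener.wiener_step[OF wiener_step(1) w(1)] order_refl])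
    have "\<bar>co i \<xi> * co j \<xi>\<bar> \<le> (norm \<xi>)\<^sup>2"
      unfolding abs_mult power2_eq_square by (intro mult_mono abs_co_le) auto
    from mult_left_mono[OF this, of "\<bar>r\<bar>"] have "\<bar>?s\<bar> \<le> \<bar>r\<bar>"
      by (cases "\<xi> = 0") (auto simp: abs_mult abs_divide divide_le_eq mult.assoc)
    then show "K + \<bar>?s\<bar> \<le> K + \<bar>r\<bar>" by simp
  qed
  ultimately show ?case by blast
qed

section \<open>A single corrugation\<close>

definition hess :: "(real \<times> real \<Rightarrow> real) \<Rightarrow> real \<times> real \<Rightarrow> real" where
  "hess u x = pd True (pd True u) x * pd False (pd False u) x - (pd True (pd False u) x)\<^sup>2"

lemma hess_alt:
  "trig_poly u \<Longrightarrow> hess u x = pd i (pd i u) x * pd (\<not> i) (pd (\<not> i) u) x - (pd i (pd (\<not> i) u) x)\<^sup>2"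
  using trig_poly_pd_commute[of u True False] by (cases i) (auto simp: hess_def)

definition axis :: "bool \<Rightarrow> real \<times> real" where
  "axis i = (if i then (1, 0) else (0, 1))"

lemma axis_simps [simp]: "axis i \<bullet> x = co i x" "norm (axis i) = 1" "co i (axis i) = 1"
  by (auto simp: axis_def co_def inner_prod_def norm_prod_def)

lemma wiener_cos: "t *\<^sub>R axis i \<in> F \<Longrightarrow> wiener F 1 (\<lambda>x. cos (t * co i x))"
  using wiener_wave[of "t *\<^sub>R axis i" F 1 0] by simp

lemma wiener_sin: "t *\<^sub>R axis i \<in> F \<Longrightarrow> wiener F 1 (\<lambda>x. sin (t * co i x))"
  using wiener_wave[of "t *\<^sub>R axis i" F 1 "-pi/2"] by (simp add: cos_diff)

lemma trig_poly_cos_sin [simp, intro]: "trig_poly (\<lambda>x. cos (t * co i x))" "trig_poly (\<lambda>x. sin (t * co i x))"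
  using wiener_cos[of t i UNIV] wiener_sin[of t i UNIV] by (auto simp: trig_poly_def)

lemma co_axis: "co j (axis i) = (if i = j then 1 else 0)"
  by (auto simp: axis_def co_def)

lemma pd_cos: "pd j (\<lambda>x. cos (t * co i x)) = (\<lambda>x. if i = j then - t * sin (t * co i x) else 0)"
  using pd_wave[of j 1 "t *\<^sub>R axis i" 0] by (auto simp: co_axis cos_add)

lemma pd_sin: "pd j (\<lambda>x. sin (t * co i x)) = (\<lambda>x. if i = j then t * cos (t * co i x) else 0)"
  using pd_wave[of j 1 "t *\<^sub>R axis i" "-pi/2"] by (auto simp: co_axis cos_diff)

text \<open>The classical form of the very weak Hessian identity: after commuting derivatives all
  third and fourth order terms cancel. It serves twice, to gain derivatives when the Laplacian is
  inverted on \<open>hess a\<close>, and to move both derivatives onto the test function.\<close>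

lemma hess_double_divergence:
  assumes "trig_poly a"
  shows "hess a x = pd i (pd (\<not> i) (\<lambda>x. pd i a x * pd (\<not> i) a x)) x
     - pd (\<not> i) (pd (\<not> i) (\<lambda>x. pd i a x * pd i a x / 2)) x
     - pd i (pd i (\<lambda>x. pd (\<not> i) a x * pd (\<not> i) a x / 2)) x"
proof -
  define j where "j = (\<not> i)"
  have c: "pd j (pd i u) = pd i (pd j u)" if "trig_poly u" for u using that by (rule trig_poly_pd_commute)
  show ?thesis
    unfolding hess_alt[OF assms, of x i] j_def[symmetric]
    by (simp add: assms c trig_poly_pd_simps field_simps power2_eq_square)
qed

text \<open>Terms are sorted by their speed of oscillation. In the quadratic part of
  \<open>W\<close> the squares of cosine and sine have mean 1/2, which yields - d_jj (a^2/4) and the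
  slow remainder \<open>hess a / (2 * \<nu>\<^sup>2)\<close>; what is left of it oscillates at
  2\<nu>. The mixed terms with the second derivatives of \<open>v\<close> oscillate at \<nu>. Since
  the phase depends on x_i only, the powers of \<nu> cancel in the leading slow term.\<close>

lemma hess_corrugation:
  fixes i :: bool
  assumes "trig_poly v" "trig_poly a" "0 < \<nu>"
  defines "j \<equiv> (\<not> i)"
  defines "W \<equiv> (\<lambda>x. a x * cos (\<nu> * co i x) / \<nu>)"
  shows "hess (\<lambda>x. v x + W x) x = hess v x
     - pd j (pd j (\<lambda>x. a x * a x / 4)) x + hess a x / (2 * \<nu>\<^sup>2)
     + (pd j (pd j v) x * pd i (pd i W) x + pd i (pd i v) x * pd j (pd j W) x
        - 2 * (pd i (pd j v) x * pd i (pd j W) x))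
     + (cos ((2 * \<nu>) * co i x) * ((pd j a x * pd j a x - a x * pd j (pd j a) x + hess a x / \<nu>\<^sup>2) / 2)
        + sin ((2 * \<nu>) * co i x) * ((pd j a x * pd i (pd j a) x - pd i a x * pd j (pd j a) x) / \<nu>))"
proof -
  have c: "pd j (pd i u) = pd i (pd j u)" if "trig_poly u" for u using that by (rule trig_poly_pd_commute)
  have W: "trig_poly W" using assms(2) by (auto simp: W_def)
  have ij: "(i = j) = False" "(j = i) = False" by (auto simp: j_def)
  let ?c = "cos (\<nu> * co i x)" and ?s = "sin (\<nu> * co i x)"
  have W1: "pd i (pd i W) x = - \<nu> * a x * ?c - 2 * pd i a x * ?s + pd i (pd i a) x * ?c / \<nu>"
    using assms(2,3) by (simp add: W_def trig_poly_pd_simps pd_cos pd_sin field_simps)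
  have W2: "pd j (pd j W) x = pd j (pd j a) x * ?c / \<nu>"
    using assms(2,3) by (simp add: W_def trig_poly_pd_simps pd_cos pd_sin ij)
  have W3: "pd i (pd j W) x = - pd j a x * ?s + pd i (pd j a) x * ?c / \<nu>"
    using assms(2,3) by (simp add: W_def trig_poly_pd_simps pd_cos pd_sin ij field_simps)
  have aa: "pd j (pd j (\<lambda>x. a x * a x / 4)) x = (pd j a x * pd j a x + a x * pd j (pd j a) x) / 2"
    using assms(2) by (simp add: trig_poly_pd_simps field_simps)
  have c2: "cos ((2 * \<nu>) * co i x) = 2 * ?c\<^sup>2 - 1" "sin ((2 * \<nu>) * co i x) = 2 * ?s * ?c"
    using cos_double_cos[of "\<nu> * co i x"] sin_double[of "\<nu> * co i x"] by (simp_all add: mult.assoc)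
  have h: "hess (\<lambda>x. v x + W x) x = (pd i (pd i v) x + pd i (pd i W) x) * (pd j (pd j v) x + pd j (pd j W) x)
     - (pd i (pd j v) x + pd i (pd j W) x)\<^sup>2"
    using assms(1) W by (simp add: hess_alt[of _ x i] j_def trig_poly_pd_simps)
  have hv: "hess v x = pd i (pd i v) x * pd j (pd j v) x - (pd i (pd j v) x)\<^sup>2"
    using assms(1) by (simp add: hess_alt[of _ x i] j_def)
  have ha: "hess a x = pd i (pd i a) x * pd j (pd j a) x - (pd i (pd j a) x)\<^sup>2"
    using assms(2) by (simp add: hess_alt[of _ x i] j_def)
  \<comment> \<open>The values at the point are replaced by real variables, so that the quadratic
    part becomes a rational identity in which only S^2 + C^2 = 1 is used.\<close>
  define a0 a1 a2 a11 a12 a22 where "a0 = a x" "a1 = pd i a x" "a2 = pd j a x"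
    "a11 = pd i (pd i a) x" "a12 = pd i (pd j a) x" "a22 = pd j (pd j a) x"
  note defs = this
  define C S where "C = ?c" "S = ?s"
  note defs = defs this
  have CS: "S^2 = 1 - C^2" unfolding defs by (rule sin_squared_eq)
  have "(- \<nu> * a0 * C - 2 * a1 * S + a11 * C / \<nu>) * (a22 * C / \<nu>) - (- a2 * S + a12 * C / \<nu>)\<^sup>2
     = - a0 * a22 * C\<^sup>2 - 2 * a1 * a22 * S * C / \<nu> + a11 * a22 * C\<^sup>2 / \<nu>\<^sup>2
       - a2\<^sup>2 * S\<^sup>2 + 2 * a2 * a12 * S * C / \<nu> - a12\<^sup>2 * C\<^sup>2 / \<nu>\<^sup>2"
    using assms(3) by (simp add: field_simps power2_eq_square)
  also have "\<dots> = - (a2 * a2 + a0 * a22) / 2 + (a11 * a22 - a12\<^sup>2) / (2 * \<nu>\<^sup>2)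
      + ((2 * C\<^sup>2 - 1) * ((a2 * a2 - a0 * a22 + (a11 * a22 - a12\<^sup>2) / \<nu>\<^sup>2) / 2)
         + 2 * S * C * ((a2 * a12 - a1 * a22) / \<nu>))"
    unfolding CS using assms(3) by (simp add: field_simps power2_eq_square)
  finally have key: "(- \<nu> * a0 * C - 2 * a1 * S + a11 * C / \<nu>) * (a22 * C / \<nu>) - (- a2 * S + a12 * C / \<nu>)\<^sup>2
     = - (a2 * a2 + a0 * a22) / 2 + (a11 * a22 - a12\<^sup>2) / (2 * \<nu>\<^sup>2)
      + ((2 * C\<^sup>2 - 1) * ((a2 * a2 - a0 * a22 + (a11 * a22 - a12\<^sup>2) / \<nu>\<^sup>2) / 2)
         + 2 * S * C * ((a2 * a12 - a1 * a22) / \<nu>))" .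
  have "pd i (pd i W) x * pd j (pd j W) x - (pd i (pd j W) x)\<^sup>2 = - (a2 * a2 + a0 * a22) / 2 + (a11 * a22 - a12\<^sup>2) / (2 * \<nu>\<^sup>2)
      + ((2 * C\<^sup>2 - 1) * ((a2 * a2 - a0 * a22 + (a11 * a22 - a12\<^sup>2) / \<nu>\<^sup>2) / 2)
         + 2 * S * C * ((a2 * a12 - a1 * a22) / \<nu>))"
    using key W1 W2 W3 unfolding defs by simp
  then have ww: "pd i (pd i W) x * pd j (pd j W) x - (pd i (pd j W) x)\<^sup>2
     = - pd j (pd j (\<lambda>x. a x * a x / 4)) x + hess a x / (2 * \<nu>\<^sup>2)
       + ((2 * ?c\<^sup>2 - 1) * ((pd j a x * pd j a x - a x * pd j (pd j a) x + hess a x / \<nu>\<^sup>2) / 2)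
         + 2 * ?s * ?c * ((pd j a x * pd i (pd j a) x - pd i a x * pd j (pd j a) x) / \<nu>))"
    unfolding ha aa minus_divide_left unfolding defs by simp
  \<comment> \<open>Polarization of the determinant of symmetric 2x2 matrices: the determinant of a
    sum is the sum of the determinants plus a bilinear mixed term.\<close>
  have split: "(x11 + w11) * (x22 + w22) - (x12 + w12)\<^sup>2
     = (x11 * x22 - x12\<^sup>2) + (w11 * w22 - w12\<^sup>2) + (x22 * w11 + x11 * w22 - 2 * (x12 * w12))"
    for x11 x12 x22 w11 w12 w22 :: real by (simp add: algebra_simps power2_eq_square)
  show ?thesis
    unfolding h hv split ww c2 by simp
qed

lemma cball_sum_diff:
  fixes x y :: "'a::real_normed_vector"
  assumes "x \<in> cball 0 r" "y \<in> cball 0 s" "r + s \<le> t"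
  shows "x + y \<in> cball 0 t \<and> x - y \<in> cball 0 t"
  using assms norm_triangle_ineq[of x y] norm_triangle_ineq4[of x y] by auto

lemma wiener_mult_cball:
  assumes "wiener (cball 0 r) K u" "wiener (cball 0 s) L v" "r + s \<le> t"
  shows "wiener (cball 0 t) (K * L) (\<lambda>x. u x * v x)"
  using assms(1,2) by (rule wiener_mult) (rule cball_sum_diff[OF _ _ assms(3)])

text \<open>Frequencies that are high in direction i. The lower bound is what permits inverting
  d_ii, and it degrades only by the band limit of any slow factor that is multiplied in.\<close>

definition osc :: "bool \<Rightarrow> real \<Rightarrow> real \<Rightarrow> (real \<times> real) set" where
  "osc i r s = {\<xi>. r \<le> \<bar>co i \<xi>\<bar> \<and> norm \<xi> \<le> s}"

lemma osc_mono: "r' \<le> r \<Longrightarrow> s \<le> s' \<Longrightarrow> osc i r s \<subseteq> osc i r' s'"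
  by (auto simp: osc_def)

lemma osc_bound: "\<xi> \<in> osc i r s \<Longrightarrow> \<bar>co k \<xi>\<bar> \<le> s"
  using abs_co_le[of k \<xi>] by (simp add: osc_def)

lemma wiener_mult_osc:
  assumes "wiener (osc i r s) K u" "wiener (cball 0 t) L v"
  shows "wiener (osc i (r - t) (s + t)) (K * L) (\<lambda>x. u x * v x)"
  using assms
proof (rule wiener_mult)
  fix \<xi> \<eta> :: "real \<times> real" assume "\<xi> \<in> osc i r s" "\<eta> \<in> cball 0 t"
  then show "\<xi> + \<eta> \<in> osc i (r - t) (s + t) \<and> \<xi> - \<eta> \<in> osc i (r - t) (s + t)"
    using abs_co_le[of i \<eta>] norm_triangle_ineq[of \<xi> \<eta>] norm_triangle_ineq4[of \<xi> \<eta>]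
    by (auto simp: osc_def)
qed

lemma wiener_hess:
  assumes "wiener (cball 0 \<rho>) A a" "0 \<le> \<rho>"
  shows "wiener (cball 0 (2 * \<rho>)) (2 * (A\<^sup>2 * \<rho>^4)) (hess a)"
proof -
  have d2: "wiener (cball 0 \<rho>) (\<rho> * (\<rho> * A)) (pd j (pd k a))" for j k
    by (intro wiener_pd_cball assms)
  have m: "wiener (cball 0 (2 * \<rho>)) (A\<^sup>2 * \<rho>^4) (\<lambda>x. pd j (pd k a) x * pd l (pd m a) x)" for j k l m
    using wiener_mult_cball[OF d2 d2, of "2 * \<rho>"] by (simp add: power2_eq_square power4_eq_xxxx mult_ac)
  show ?thesis
    using wiener_diff[OF m m, of True True False False True False True False]
    by (simp add: hess_def[abs_def] power2_eq_square[of "pd True (pd False a) _"])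
qed

text \<open>Estimating \<open>hess a\<close> directly costs \<rho>^4. As a double divergence of
  products of first derivatives it costs only \<rho>^2 once the Laplacian is inverted, since the
  remaining multiplier has constant 1.\<close>

lemma wiener_inverse_lap_hess:
  assumes "wiener (cball 0 \<rho>) A a" "0 \<le> \<rho>"
  shows "\<exists>k. wiener (cball 0 (2 * \<rho>)) (2 * A\<^sup>2 * \<rho>\<^sup>2) k \<and> lap k = hess a"
proof -
  have ea: "trig_poly a" using assms(1) by (rule wiener_trig_poly)
  have m: "wiener (cball 0 (2 * \<rho>)) (A\<^sup>2 * \<rho>\<^sup>2) (\<lambda>x. pd i a x * pd j a x)" for i j
    using wiener_mult_cball[OF wiener_pd_cball[OF assms] wiener_pd_cball[OF assms], of "2 * \<rho>" i j]
    by (simp add: power2_eq_square mult_ac)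
  have m': "wiener (cball 0 (2 * \<rho>)) (A\<^sup>2 * \<rho>\<^sup>2 / 2) (\<lambda>x. pd i a x * pd i a x / 2)" for i
    using wiener_cmult[OF m[of i i], of "1/2"] by simp
  obtain k1 where k1: "wiener (cball 0 (2 * \<rho>)) (A\<^sup>2 * \<rho>\<^sup>2) k1"
    "lap k1 = pd True (pd False (\<lambda>x. pd True a x * pd False a x))"
    using wiener_inverse_lap[OF m] by blast
  obtain k2 where k2: "wiener (cball 0 (2 * \<rho>)) (A\<^sup>2 * \<rho>\<^sup>2 / 2) k2"
    "lap k2 = pd False (pd False (\<lambda>x. pd True a x * pd True a x / 2))"
    using wiener_inverse_lap[OF m'] by blast
  obtain k3 where k3: "wiener (cball 0 (2 * \<rho>)) (A\<^sup>2 * \<rho>\<^sup>2 / 2) k3"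
    "lap k3 = pd True (pd True (\<lambda>x. pd False a x * pd False a x / 2))"
    using wiener_inverse_lap[OF m'] by blast
  note k = k1 k2 k3
  have e: "trig_poly k1" "trig_poly k2" "trig_poly k3" using k by (auto intro: wiener_trig_poly)
  have "lap (\<lambda>x. k1 x - k2 x - k3 x) = hess a"
    using hess_double_divergence[OF ea, of _ True] by (auto simp: lap_simps e k fun_eq_iff)
  moreover have "wiener (cball 0 (2 * \<rho>)) (2 * A\<^sup>2 * \<rho>\<^sup>2) (\<lambda>x. k1 x - k2 x - k3 x)"
    using wiener_diff[OF wiener_diff[OF k(1,3)] k(5)] by (rule wiener_mono) auto
  ultimately show ?thesis by blast
qed

text \<open>The error has two kinds of terms. Those carrying the phase \<nu> or 2\<nu> keep an
  i-component of at least \<nu>/2 after multiplication by slow factors, which is ensured by the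
  factors 8, and are written as d_ii \<open>u\<close>. The slow term in \<open>hess a\<close> cannot
  be divided by \<xi>_i^2 safely; it becomes the Laplacian of \<open>k\<close> and so enters both
  directions, but it already carries \<nu>^(-2).\<close>

lemma corrugation_estimate:
  fixes i :: bool
  assumes v: "trig_poly v" "\<And>k l. wiener (cball 0 \<mu>) D (pd k (pd l v))"
    and a: "wiener (cball 0 \<rho>) A a"
    and pos: "0 < \<nu>" "0 \<le> \<rho>" "0 \<le> \<mu>" "8 * \<rho> \<le> \<nu>" "8 * \<mu> \<le> \<nu>"
  defines "W \<equiv> (\<lambda>x. a x * cos (\<nu> * co i x) / \<nu>)"
  shows "wiener (cball 0 (2 * \<nu>)) (A / \<nu>) W"
    and "\<exists>u k. wiener (cball 0 (4 * \<nu>)) (64 * A * D / \<nu> + 16 * A\<^sup>2 * \<rho>\<^sup>2 / \<nu>\<^sup>2) u \<and>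
      wiener (cball 0 (4 * \<nu>)) (A\<^sup>2 * \<rho>\<^sup>2 / \<nu>\<^sup>2) k \<and>
      (\<forall>x. hess (\<lambda>x. v x + W x) x =
         hess v x - pd (\<not> i) (pd (\<not> i) (\<lambda>x. a x * a x / 4)) x + lap k x + pd i (pd i u) x)"
proof -
  define j where "j = (\<not> i)"
  have A0: "0 \<le> A" and D0: "0 \<le> D" using a v(2)[of i i] by (auto dest: wiener_nonneg)
  have ea: "trig_poly a" using a by (rule wiener_trig_poly)
  have osc_sub: "osc i r s \<subseteq> cball 0 s" for r s by (auto simp: osc_def)
  have "wiener (osc i (\<nu> - \<rho>) (\<nu> + \<rho>)) (1 * A) (\<lambda>x. cos (\<nu> * co i x) * a x)"
    by (rule wiener_mult_osc[OF wiener_cos a]) (use pos in \<open>auto simp: osc_def\<close>)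
  from wiener_cmult[OF this, of "1 / \<nu>"]
  have "wiener (osc i (\<nu> - \<rho>) (\<nu> + \<rho>)) (A / \<nu>) W"
    using pos by (simp add: W_def mult.commute)
  then have W: "wiener (osc i (7/8 * \<nu>) (9/8 * \<nu>)) (A / \<nu>) W"
    by (rule wiener_mono[OF _ osc_mono]) (use pos in auto)
  have W2: "wiener (osc i (7/8 * \<nu>) (9/8 * \<nu>)) (4 * A * \<nu>) (pd k (pd l W))" for k l
  proof -
    have "wiener (osc i (7/8 * \<nu>) (9/8 * \<nu>)) ((9/8*\<nu>) * ((9/8*\<nu>) * (A / \<nu>))) (pd k (pd l W))"
      by (intro wiener_pd W) (use pos in \<open>auto dest: osc_bound\<close>)
    then show ?thesis
      by (rule wiener_mono) (use pos A0 in \<open>auto simp: field_simps\<close>)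
  qed
  show "wiener (cball 0 (2 * \<nu>)) (A / \<nu>) W"
    by (rule wiener_mono[OF W]) (use pos in \<open>auto simp: osc_def\<close>)
  let ?O = "osc i (\<nu> / 2) (4 * \<nu>)"
  have cross: "wiener ?O (4 * A * \<nu> * D) (\<lambda>x. pd k (pd l v) x * pd m (pd n W) x)" for k l m n
  proof -
    have "wiener ?O (4 * A * \<nu> * D) (\<lambda>x. pd m (pd n W) x * pd k (pd l v) x)"
      by (rule wiener_mono[OF wiener_mult_osc[OF W2 v(2)] osc_mono]) (use pos in auto)
    then show ?thesis by (simp add: mult.commute)
  qed
  have a1: "wiener (cball 0 \<rho>) (\<rho> * A) (pd k a)" for k by (rule wiener_pd_cball[OF a pos(2)])
  have a2: "wiener (cball 0 \<rho>) (\<rho> * (\<rho> * A)) (pd k (pd l a))" for k l by (rule wiener_pd_cball[OF a1 pos(2)])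
  have rn: "\<rho> / \<nu> \<le> 1" using pos by simp
  let ?h1 = "\<lambda>x. pd j a x * pd j a x - a x * pd j (pd j a) x + hess a x / \<nu>\<^sup>2"
  let ?h2 = "\<lambda>x. (pd j a x * pd i (pd j a) x - pd i a x * pd j (pd j a) x) / \<nu>"
  have h1: "wiener (cball 0 (2 * \<rho>)) (4 * A\<^sup>2 * \<rho>\<^sup>2) ?h1"
  proof -
    have h: "wiener (cball 0 (2 * \<rho>)) (2 * (A\<^sup>2 * \<rho>^4) / \<nu>\<^sup>2) (\<lambda>x. hess a x / \<nu>\<^sup>2)"
      using wiener_cmult[OF wiener_hess[OF a pos(2)], of "1 / \<nu>\<^sup>2"] by simp
    have "(\<rho> / \<nu>)\<^sup>2 \<le> 1" using rn pos by (intro power_le_one) auto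
    then have "2 * (A\<^sup>2 * \<rho>\<^sup>2) * (\<rho> / \<nu>)\<^sup>2 \<le> 2 * (A\<^sup>2 * \<rho>\<^sup>2) * 1" by (intro mult_left_mono) auto
    then have le: "2 * (A\<^sup>2 * \<rho>^4) / \<nu>\<^sup>2 \<le> 2 * (A\<^sup>2 * \<rho>\<^sup>2)"
      by (simp add: power4_eq_xxxx power2_eq_square field_simps)
    show ?thesis
      by (rule wiener_mono[OF wiener_add[OF wiener_diff[OF wiener_mult_cball[OF a1 a1] wiener_mult_cball[OF a a2]] h] order_refl])
        (use le in \<open>auto simp: power2_eq_square mult_ac\<close>)
  qed
  have h2: "wiener (cball 0 (2 * \<rho>)) (2 * A\<^sup>2 * \<rho>\<^sup>2) ?h2"
  proof -
    have "wiener (cball 0 (2 * \<rho>)) (2 * A\<^sup>2 * \<rho>^3) (\<lambda>x. pd j a x * pd i (pd j a) x - pd i a x * pd j (pd j a) x)"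
      by (rule wiener_mono[OF wiener_diff[OF wiener_mult_cball[OF a1 a2] wiener_mult_cball[OF a1 a2]] order_refl])
        (auto simp: power2_eq_square power3_eq_cube mult_ac)
    from wiener_cmult[OF this, of "1/\<nu>"]
    have "wiener (cball 0 (2 * \<rho>)) (1/\<nu> * (2 * A\<^sup>2 * \<rho>^3)) ?h2"
      using pos by simp
    then show ?thesis
    proof (rule wiener_mono)
      have "2 * (A\<^sup>2 * \<rho>\<^sup>2) * (\<rho> / \<nu>) \<le> 2 * (A\<^sup>2 * \<rho>\<^sup>2) * 1" using rn by (intro mult_left_mono) auto
      then show "1/\<nu> * (2 * A\<^sup>2 * \<rho>^3) \<le> 2 * A\<^sup>2 * \<rho>\<^sup>2"
        by (simp add: power3_eq_cube power2_eq_square field_simps)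
    qed auto
  qed
  have c: "wiener (osc i (2 * \<nu>) (2 * \<nu>)) 1 (\<lambda>x. cos ((2 * \<nu>) * co i x))"
    "wiener (osc i (2 * \<nu>) (2 * \<nu>)) 1 (\<lambda>x. sin ((2 * \<nu>) * co i x))"
    using pos by (auto intro!: wiener_cos wiener_sin simp: osc_def)
  let ?g = "\<lambda>x. (pd j (pd j v) x * pd i (pd i W) x + pd i (pd i v) x * pd j (pd j W) x
        - 2 * (pd i (pd j v) x * pd i (pd j W) x))
     + (cos ((2 * \<nu>) * co i x) * (?h1 x / 2) + sin ((2 * \<nu>) * co i x) * ?h2 x)"
  \<comment> \<open>The mixed term contributes four products, its last product counting twice, each
    of size 4 A \<nu> D; the two terms at frequency 2\<nu> contribute 2 A^2 \<rho>^2 each. Dividing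
    by (\<nu>/2)^2 gives the bound stated for \<open>u\<close>.\<close>
  have g: "wiener ?O (16 * A * \<nu> * D + 4 * A\<^sup>2 * \<rho>\<^sup>2) ?g"
  proof -
    have x: "wiener ?O (16 * A * \<nu> * D) (\<lambda>x. pd j (pd j v) x * pd i (pd i W) x + pd i (pd i v) x * pd j (pd j W) x
        - 2 * (pd i (pd j v) x * pd i (pd j W) x))"
      by (rule wiener_mono[OF wiener_diff[OF wiener_add[OF cross cross] wiener_cmult[OF cross]]]) auto
    have y: "wiener ?O (2 * A\<^sup>2 * \<rho>\<^sup>2) (\<lambda>x. cos ((2 * \<nu>) * co i x) * (?h1 x / 2))"
      by (rule wiener_mono[OF wiener_mult_osc[OF c(1) wiener_cmult[OF h1, of "1/2", simplified]] osc_mono])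
         (use pos in auto)
    have z: "wiener ?O (2 * A\<^sup>2 * \<rho>\<^sup>2) (\<lambda>x. sin ((2 * \<nu>) * co i x) * ?h2 x)"
      by (rule wiener_mono[OF wiener_mult_osc[OF c(2) h2] osc_mono])
         (use pos in auto)
    show ?thesis
      by (rule wiener_mono[OF wiener_add[OF x wiener_add[OF y z]]]) auto
  qed
  obtain u where u: "wiener ?O ((16 * A * \<nu> * D + 4 * A\<^sup>2 * \<rho>\<^sup>2) / (\<nu>/2)\<^sup>2) u" "pd i (pd i u) = ?g"
    using wiener_inverse_pd2[OF g, of "\<nu>/2" i] pos by (auto simp: osc_def)
  obtain k0 where k0: "wiener (cball 0 (2 * \<rho>)) (2 * A\<^sup>2 * \<rho>\<^sup>2) k0" "lap k0 = hess a"
    using wiener_inverse_lap_hess[OF a pos(2)] by blast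
  let ?k = "\<lambda>x. 1 / (2 * \<nu>\<^sup>2) * k0 x"
  have ek0: "trig_poly k0" using k0 by (auto intro: wiener_trig_poly)
  have k: "wiener (cball 0 (4 * \<nu>)) (A\<^sup>2 * \<rho>\<^sup>2 / \<nu>\<^sup>2) ?k"
    by (rule wiener_mono[OF wiener_cmult[OF k0(1)]]) (use pos in auto)
  have lk: "lap ?k x = hess a x / (2 * \<nu>\<^sup>2)" for x
    using ek0 by (simp add: lap_def trig_poly_pd_simps k0(2)[symmetric] add_divide_distrib)
  have "wiener (cball 0 (4 * \<nu>)) (64 * A * D / \<nu> + 16 * A\<^sup>2 * \<rho>\<^sup>2 / \<nu>\<^sup>2) u"
    by (rule wiener_mono[OF u(1) osc_sub]) (use pos in \<open>simp add: field_simps power2_eq_square\<close>)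
  moreover have "hess (\<lambda>x. v x + W x) x =
         hess v x - pd (\<not> i) (pd (\<not> i) (\<lambda>x. a x * a x / 4)) x + lap ?k x + pd i (pd i u) x" for x
    using hess_corrugation[OF v(1) ea pos(1), of i x]
    unfolding u(2) lk j_def W_def by simp
  ultimately show "\<exists>u k. wiener (cball 0 (4 * \<nu>)) (64 * A * D / \<nu> + 16 * A\<^sup>2 * \<rho>\<^sup>2 / \<nu>\<^sup>2) u \<and>
      wiener (cball 0 (4 * \<nu>)) (A\<^sup>2 * \<rho>\<^sup>2 / \<nu>\<^sup>2) k \<and>
      (\<forall>x. hess (\<lambda>x. v x + W x) x =
         hess v x - pd (\<not> i) (pd (\<not> i) (\<lambda>x. a x * a x / 4)) x + lap k x + pd i (pd i u) x)"
    using k by blast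
qed

section \<open>Polynomials of small functions and an approximate square root\<close>

lemma wiener_power:
  assumes "wiener (cball 0 \<mu>) \<kappa> s" "0 \<le> \<mu>"
  shows "wiener (cball 0 (real n * \<mu>)) (\<kappa> ^ n) (\<lambda>x. s x ^ n)"
proof (induction n)
  case 0
  then show ?case using wiener_const[of "cball 0 0" 1] by simp
next
  case (Suc n)
  from wiener_mult_cball[OF assms(1) this, of "real (Suc n) * \<mu>"]
  show ?case by (simp add: algebra_simps)
qed

text \<open>The point is uniformity: the bound and the factor by which the band grows depend on the
  polynomial alone, as long as the argument has absolute coefficient sum at most 1. One constant can
  then serve all stages.\<close>

lemma wiener_poly:
  "\<exists>C\<ge>0. \<exists>d\<ge>0. \<forall>s \<mu> \<kappa>. wiener (cball 0 \<mu>) \<kappa> s \<and> \<kappa> \<le> 1 \<and> 0 \<le> \<mu> \<longrightarrow>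
     wiener (cball 0 (d * \<mu>)) C (\<lambda>x. poly p (s x))"
proof (induction p)
  case 0
  show ?case by (auto intro!: exI[of _ 0] wiener_0)
next
  case (pCons c p)
  then obtain C d where Cd: "C \<ge> 0" "d \<ge> 0"
    "\<And>s \<mu> \<kappa>. wiener (cball 0 \<mu>) \<kappa> s \<Longrightarrow> \<kappa> \<le> 1 \<Longrightarrow> 0 \<le> \<mu> \<Longrightarrow> wiener (cball 0 (d * \<mu>)) C (\<lambda>x. poly p (s x))"
    by blast
  have "wiener (cball 0 ((d + 1) * \<mu>)) (\<bar>c\<bar> + C) (\<lambda>x. poly (pCons c p) (s x))"
    if s: "wiener (cball 0 \<mu>) \<kappa> s" "\<kappa> \<le> 1" "0 \<le> \<mu>" for s \<mu> \<kappa>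
  proof -
    have "wiener (cball 0 ((d + 1) * \<mu>)) (\<kappa> * C) (\<lambda>x. s x * poly p (s x))"
      by (rule wiener_mult_cball[OF s(1) Cd(3)[OF s]]) (simp add: algebra_simps)
    moreover have "\<kappa> * C \<le> C" using s(2) Cd(1) mult_right_mono[of \<kappa> 1 C] by simp
    moreover have "wiener (cball 0 ((d + 1) * \<mu>)) \<bar>c\<bar> (\<lambda>x. c)"
      using Cd(2) s(3) by (intro wiener_const) auto
    ultimately show ?thesis
      using wiener_mono[OF wiener_add[of _ "\<bar>c\<bar>" "\<lambda>x. c" "\<kappa> * C"] order_refl, of _ _ "\<bar>c\<bar> + C"] by simp
  qed
  then show ?case using Cd(1,2) by (intro exI[of _ "\<bar>c\<bar> + C"] exI[of _ "d + 1"] conjI) auto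
qed

text \<open>Newton's method for the square root of 1 + s: subtracting half of the current error from
  \<open>p\<close> cancels it to leading order because \<open>p\<close> is 1 at s = 0. The clause
  \<open>poly p s = 1 + s * poly q s\<close> carries this normalization through the induction and
  supplies the extra factor s of the next error.\<close>

lemma sqrt_poly:
  "\<exists>p q r :: real poly. \<forall>s. (poly p s)\<^sup>2 = 1 + s + s ^ Suc m * poly r s \<and> poly p s = 1 + s * poly q s"
proof (induction m)
  case 0
  show ?case by (intro exI[of _ "[:1:]"] exI[of _ "[:0:]"] exI[of _ "[:-1:]"]) simp
next
  case (Suc m)
  then obtain p q r :: "real poly" where pq: "\<And>s. (poly p s)\<^sup>2 = 1 + s + s ^ Suc m * poly r s"
    "\<And>s. poly p s = 1 + s * poly q s" by blast
  let ?p = "p - smult (1/2) (monom 1 (Suc m) * r)"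
  let ?q = "q - smult (1/2) (monom 1 m * r)"
  let ?r = "smult (1/4) (monom 1 m * r\<^sup>2) - q * r"
  have "(poly ?p s)\<^sup>2 = 1 + s + s ^ Suc (Suc m) * poly ?r s \<and> poly ?p s = 1 + s * poly ?q s" for s
  proof
    have ident: "(P - s * t * R / 2)\<^sup>2 = 1 + s + s * (s * t) * (t * R\<^sup>2 / 4 - Q * R)"
      if "P\<^sup>2 = 1 + s + s * t * R" "P = 1 + s * Q" for P Q R t :: real
    proof -
      have "(P - s * t * R / 2)\<^sup>2 = P\<^sup>2 - P * (s * t * R) + (s * t * R)\<^sup>2 / 4"
        by (simp add: power2_eq_square field_simps)
      also have "\<dots> = (1 + s + s * t * R) - (1 + s * Q) * (s * t * R) + (s * t * R)\<^sup>2 / 4"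
        using that by simp
      also have "\<dots> = 1 + s + s * (s * t) * (t * R\<^sup>2 / 4 - Q * R)"
        by (simp add: power2_eq_square algebra_simps)
      finally show ?thesis .
    qed
    show "(poly ?p s)\<^sup>2 = 1 + s + s ^ Suc (Suc m) * poly ?r s"
      using ident[of "poly p s" "s ^ m" "poly r s" "poly q s"] pq[of s]
      by (simp add: poly_monom mult.assoc)
    show "poly ?p s = 1 + s * poly ?q s" by (simp add: pq(2) poly_monom algebra_simps)
  qed
  then show ?case by blast
qed

section \<open>Exponents and iteration\<close>

text \<open>One corrugation as a property of its constant, so that a single \<open>C\<close>,
  depending only on the order \<open>m\<close> of the square root, works for every stage and both
  directions. \<delta> is the squared amplitude and \<kappa> the size of \<open>P\<close> relative
  to it; the new \<open>P'\<close> is of order \<kappa>^(m+1) while \<open>R'\<close> still contains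
  the old \<open>R\<close>. \<open>F0\<close> stands for the target, later the Laplacian of a
  truncation.\<close>

definition step_const :: "nat \<Rightarrow> real \<Rightarrow> bool" where
  "step_const m C \<longleftrightarrow> 8 \<le> C \<and> (\<forall>i v P R F0 \<delta> \<mu> \<nu> D \<kappa> N. trig_poly v \<longrightarrow>
     (\<forall>k l. wiener (cball 0 \<mu>) D (pd k (pd l v))) \<longrightarrow>
     wiener (cball 0 \<mu>) (\<kappa> * \<delta>) P \<longrightarrow> wiener (cball 0 \<mu>) N R \<longrightarrow>
     0 < \<delta> \<longrightarrow> \<kappa> \<le> 1 \<longrightarrow> 0 \<le> \<mu> \<longrightarrow> 0 < \<nu> \<longrightarrow> C * \<mu> \<le> \<nu> \<longrightarrow>
     (\<forall>x. hess v x - F0 x = pd (\<not> i) (pd (\<not> i) P) x + pd i (pd i R) x) \<longrightarrow>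
     (\<exists>W P' R'. wiener (cball 0 (2 * \<nu>)) (C * sqrt \<delta> / \<nu>) W \<and>
        wiener (cball 0 (4 * \<nu>)) (C * (\<kappa> ^ Suc m * \<delta> + \<delta> * \<mu>\<^sup>2 / \<nu>\<^sup>2)) P' \<and>
        wiener (cball 0 (4 * \<nu>)) (N + C * (sqrt \<delta> * D / \<nu> + \<delta> * \<mu>\<^sup>2 / \<nu>\<^sup>2)) R' \<and>
        (\<forall>x. hess (\<lambda>x. v x + W x) x - F0 x = pd (\<not> i) (pd (\<not> i) P') x + pd i (pd i R') x)))"

lemma step_const_exists: "\<exists>C. step_const m C"
proof -
  obtain p q r :: "real poly" where pr: "\<And>s. (poly p s)\<^sup>2 = 1 + s + s ^ Suc m * poly r s"
    using sqrt_poly[of m] by blast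
  obtain C1 d1 where C1: "C1 \<ge> 0" "d1 \<ge> 0"
    "\<And>s \<mu> \<kappa>. wiener (cball 0 \<mu>) \<kappa> s \<Longrightarrow> \<kappa> \<le> 1 \<Longrightarrow> 0 \<le> \<mu> \<Longrightarrow> wiener (cball 0 (d1 * \<mu>)) C1 (\<lambda>x. poly p (s x))"
    using wiener_poly[of p] by blast
  obtain C2 d2 where C2: "C2 \<ge> 0" "d2 \<ge> 0"
    "\<And>s \<mu> \<kappa>. wiener (cball 0 \<mu>) \<kappa> s \<Longrightarrow> \<kappa> \<le> 1 \<Longrightarrow> 0 \<le> \<mu> \<Longrightarrow> wiener (cball 0 (d2 * \<mu>)) C2 (\<lambda>x. poly r (s x))"
    using wiener_poly[of r] by blast
  \<comment> \<open>The summands make room for the frequency conditions, namely d1 for the band of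
    the amplitude and m + 1 + d2 for that of the square root error, and for the estimates. With A =
    2 sqrt \<delta> C1 one has 128 = 64 * 2, and 68 = 4 * (16 + 1) collects the contributions of
    \<open>u\<close> and \<open>k\<close>.\<close>
  define C where "C = 8 + 8 * d1 + (real (Suc m) + d2) + 128 * C1 + 68 * (C1\<^sup>2 * d1\<^sup>2) + C2"
  have Cge: "8 \<le> C" "8 * d1 \<le> C" "real (Suc m) + d2 \<le> C" "128 * C1 \<le> C" "68 * (C1\<^sup>2 * d1\<^sup>2) \<le> C" "C2 \<le> C"
    unfolding C_def using C1 C2 by (auto simp: add_nonneg_nonneg)
  have main: "\<exists>W P' R'. wiener (cball 0 (2 * \<nu>)) (C * sqrt \<delta> / \<nu>) W \<and>
        wiener (cball 0 (4 * \<nu>)) (C * (\<kappa> ^ Suc m * \<delta> + \<delta> * \<mu>\<^sup>2 / \<nu>\<^sup>2)) P' \<and>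
        wiener (cball 0 (4 * \<nu>)) (N + C * (sqrt \<delta> * D / \<nu> + \<delta> * \<mu>\<^sup>2 / \<nu>\<^sup>2)) R' \<and>
        (\<forall>x. hess (\<lambda>x. v x + W x) x - F0 x = pd (\<not> i) (pd (\<not> i) P') x + pd i (pd i R') x)"
    if v: "trig_poly v" "\<And>k l. wiener (cball 0 \<mu>) D (pd k (pd l v))"
      and PR: "wiener (cball 0 \<mu>) (\<kappa> * \<delta>) P" "wiener (cball 0 \<mu>) N R"
      and pos: "0 < \<delta>" "\<kappa> \<le> 1" "0 \<le> \<mu>" "0 < \<nu>" "C * \<mu> \<le> \<nu>"
      and eq: "\<And>x. hess v x - F0 x = pd (\<not> i) (pd (\<not> i) P) x + pd i (pd i R) x"
    for i v P R F0 \<delta> \<mu> \<nu> D \<kappa> N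
  proof -
    define s where "s = (\<lambda>x. P x / \<delta>)"
    have s: "wiener (cball 0 \<mu>) \<kappa> s"
      using wiener_cmult[OF PR(1), of "1 / \<delta>"] pos by (simp add: s_def)
    have k0: "0 \<le> \<kappa>" using s by (rule wiener_nonneg)
    have D0: "0 \<le> D" using v(2)[of i i] by (rule wiener_nonneg)
    \<comment> \<open>Thus a^2/4 equals \<delta> times p(P/\<delta>)^2, that is \<delta> + P up to
      the error \<open>e\<close> of the polynomial square root.\<close>
    define a where "a = (\<lambda>x. (2 * sqrt \<delta>) * poly p (s x))"
    define A where "A = 2 * sqrt \<delta> * C1"
    have a: "wiener (cball 0 (d1 * \<mu>)) A a"
      using wiener_cmult[OF C1(3)[OF s pos(2,3)], of "2 * sqrt \<delta>"] pos by (simp add: a_def A_def)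
    have A2: "A\<^sup>2 = 4 * \<delta> * C1\<^sup>2" using pos by (simp add: A_def power_mult_distrib)
    have mu: "c * \<mu> \<le> \<nu>" if "c \<le> C" for c
      using mult_right_mono[OF that pos(3)] pos(5) by linarith
    have est: "8 * (d1 * \<mu>) \<le> \<nu>" "8 * \<mu> \<le> \<nu>" "0 \<le> d1 * \<mu>"
      using mu[OF Cge(2)] mu[OF Cge(1)] C1(2) pos by (auto simp: mult.assoc)
    define W where "W = (\<lambda>x. a x * cos (\<nu> * co i x) / \<nu>)"
    have W: "wiener (cball 0 (2 * \<nu>)) (A / \<nu>) W"
      unfolding W_def by (rule corrugation_estimate(1)[OF v a pos(4) est(3) pos(3) est(1,2)])
    obtain u k where uk: "wiener (cball 0 (4 * \<nu>)) (64 * A * D / \<nu> + 16 * A\<^sup>2 * (d1 * \<mu>)\<^sup>2 / \<nu>\<^sup>2) u"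
      "wiener (cball 0 (4 * \<nu>)) (A\<^sup>2 * (d1 * \<mu>)\<^sup>2 / \<nu>\<^sup>2) k"
      "\<And>x. hess (\<lambda>x. v x + W x) x =
         hess v x - pd (\<not> i) (pd (\<not> i) (\<lambda>x. a x * a x / 4)) x + lap k x + pd i (pd i u) x"
      using corrugation_estimate(2)[OF v a pos(4) est(3) pos(3) est(1,2), of i]
      unfolding W_def by blast
    define e where "e = (\<lambda>x. \<delta> * (s x ^ Suc m * poly r (s x)))"
    have r: "wiener (cball 0 (d2 * \<mu>)) C2 (\<lambda>x. poly r (s x))" by (rule C2(3)[OF s pos(2,3)])
    have "wiener (cball 0 \<nu>) (\<kappa> ^ Suc m * C2) (\<lambda>x. s x ^ Suc m * poly r (s x))"
      by (rule wiener_mult_cball[OF wiener_power[OF s pos(3)] r])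
         (use mu[OF Cge(3)] in \<open>simp add: algebra_simps\<close>)
    from wiener_cmult[OF this, of \<delta>] have e: "wiener (cball 0 \<nu>) (\<delta> * (\<kappa> ^ Suc m * C2)) e"
      using pos by (simp add: e_def)
    have aa: "a x * a x / 4 = \<delta> + P x + e x" for x
    proof -
      have "a x * a x / 4 = \<delta> * (poly p (s x))\<^sup>2"
        using pos by (simp add: a_def power2_eq_square)
      also have "\<dots> = \<delta> + \<delta> * s x + e x" unfolding pr by (simp add: e_def algebra_simps)
      finally show ?thesis using pos by (simp add: s_def)
    qed
    have eps: "trig_poly P" "trig_poly R" "trig_poly e" "trig_poly u" "trig_poly k" using PR e uk by (auto intro: wiener_trig_poly)
    \<comment> \<open>The corrugation subtracts d_jj (\<delta> + P + e). The constant disappears, P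
      cancels and - e is left; \<open>lap k\<close> adds \<open>k\<close> to both potentials, and
      \<open>u\<close> goes to the direction i.\<close>
    define P' where "P' = (\<lambda>x. k x - e x)"
    define R' where "R' = (\<lambda>x. R x + (u x + k x))"
    have "hess (\<lambda>x. v x + W x) x - F0 x = pd (\<not> i) (pd (\<not> i) P') x + pd i (pd i R') x" for x
      using eq[of x] unfolding uk(3) aa P'_def R'_def lap_alt[of _ _ i]
      by (simp add: eps trig_poly_pd_simps)
    moreover have "wiener (cball 0 (2 * \<nu>)) (C * sqrt \<delta> / \<nu>) W"
    proof (rule wiener_mono[OF W order_refl])
      have "2 * C1 \<le> C" using Cge(4) C1(1) by linarith
      then show "A / \<nu> \<le> C * sqrt \<delta> / \<nu>"
        unfolding A_def using pos mult_right_mono[of "2 * C1" C "sqrt \<delta>"]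
        by (auto intro!: divide_right_mono simp: mult_ac)
    qed
    moreover have key: "16 * A\<^sup>2 * (d1 * \<mu>)\<^sup>2 / \<nu>\<^sup>2 + A\<^sup>2 * (d1 * \<mu>)\<^sup>2 / \<nu>\<^sup>2 \<le> C * (\<delta> * \<mu>\<^sup>2 / \<nu>\<^sup>2)"
    proof -
      have "16 * A\<^sup>2 * (d1 * \<mu>)\<^sup>2 / \<nu>\<^sup>2 + A\<^sup>2 * (d1 * \<mu>)\<^sup>2 / \<nu>\<^sup>2 = (68 * (C1\<^sup>2 * d1\<^sup>2)) * (\<delta> * \<mu>\<^sup>2 / \<nu>\<^sup>2)"
        unfolding A2 by (simp add: field_simps power_mult_distrib)
      also have "\<dots> \<le> C * (\<delta> * \<mu>\<^sup>2 / \<nu>\<^sup>2)"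
        using pos by (intro mult_right_mono Cge) auto
      finally show ?thesis .
    qed
    moreover have "wiener (cball 0 (4 * \<nu>)) (C * (\<kappa> ^ Suc m * \<delta> + \<delta> * \<mu>\<^sup>2 / \<nu>\<^sup>2)) P'"
      unfolding P'_def
    proof (rule wiener_mono[OF wiener_diff[OF uk(2) wiener_mono[OF e]] order_refl])
      have "(\<delta> * \<kappa> ^ Suc m) * C2 \<le> (\<delta> * \<kappa> ^ Suc m) * C"
        using pos k0 by (intro mult_left_mono Cge) auto
      moreover have "0 \<le> 16 * A\<^sup>2 * (d1 * \<mu>)\<^sup>2 / \<nu>\<^sup>2" by simp
      ultimately show "A\<^sup>2 * (d1 * \<mu>)\<^sup>2 / \<nu>\<^sup>2 + \<delta> * (\<kappa> ^ Suc m * C2) \<le> C * (\<kappa> ^ Suc m * \<delta> + \<delta> * \<mu>\<^sup>2 / \<nu>\<^sup>2)"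
        using key unfolding distrib_left mult.assoc[symmetric] mult.commute[of C "\<kappa> ^ Suc m"]
          mult.commute[of "\<kappa> ^ Suc m" \<delta>] by (simp only: mult_ac)
    qed (use pos in auto)
    moreover have "wiener (cball 0 (4 * \<nu>)) (N + C * (sqrt \<delta> * D / \<nu> + \<delta> * \<mu>\<^sup>2 / \<nu>\<^sup>2)) R'"
      unfolding R'_def
    proof (rule wiener_mono[OF wiener_add[OF wiener_mono[OF PR(2)] wiener_add[OF uk(1,2)]] order_refl])
      have "(128 * C1) * (sqrt \<delta> * D / \<nu>) \<le> C * (sqrt \<delta> * D / \<nu>)"
        using pos D0 by (intro mult_right_mono Cge) auto
      then have "64 * A * D / \<nu> \<le> C * (sqrt \<delta> * D / \<nu>)"
        by (simp add: A_def field_simps)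
      with key show "N + (64 * A * D / \<nu> + 16 * A\<^sup>2 * (d1 * \<mu>)\<^sup>2 / \<nu>\<^sup>2 + A\<^sup>2 * (d1 * \<mu>)\<^sup>2 / \<nu>\<^sup>2)
          \<le> N + C * (sqrt \<delta> * D / \<nu> + \<delta> * \<mu>\<^sup>2 / \<nu>\<^sup>2)"
        by (simp add: distrib_left)
    qed (use pos est in auto)
    ultimately show ?thesis by blast
  qed
  have "step_const m C"
    unfolding step_const_def by (intro conjI allI impI Cge(1), rule main) blast+
  then show ?thesis by blast
qed

text \<open>The frequencies are \<open>\<mu> (Suc q) = \<mu> q powr b\<close>, the squared amplitudes are
  \<open>H * \<mu> q powr (- 2 * t)\<close>, and \<open>\<mu> q powr (- \<sigma>)\<close> is the relative size of \<open>P\<close>. Each inequality compares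
  the exponent of one error term of a step with the size allowed for \<open>R\<close> or \<open>P\<close> after that step;
  the first one carries the main error and forces \<open>t < 1/3\<close>. The gap \<open>\<gamma>\<close> absorbs all constants.\<close>

definition admissible :: "real \<Rightarrow> real \<Rightarrow> real \<Rightarrow> nat \<Rightarrow> real \<Rightarrow> bool" where
  "admissible t b \<sigma> m \<gamma> \<longleftrightarrow> 0 < t \<and> t < 1/3 \<and> 1 < b \<and> b \<le> 2 \<and> 0 < \<sigma> \<and> 0 < \<gamma> \<and>
     \<gamma> \<le> b - 1 \<and> \<gamma> \<le> (1 - t) * (b - 1) \<and>
     1 - b - t - t * b + \<gamma> \<le> - 2 * t * b^2 - \<sigma> * b \<and>
     2 - 2 * b - 2 * t * b + \<gamma> \<le> - 2 * t * b^3 - \<sigma> * b^2 \<and>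
     - \<sigma> * real (Suc m) - 2 * t * b + \<gamma> \<le> - 2 * t * b^3 - \<sigma> * b^2 \<and>
     - (2/3) + \<gamma> \<le> - 2 * t * b^3 - \<sigma> * b^2 \<and>
     t * b^2 + \<sigma> * b / 2 - b * (1 + t) + \<gamma> \<le> 0"

text \<open>With b = 1 + e, the slack in the first two error inequalities vanishes at e = 0 and has
  a factor e; what remains is positive for small e because t < 1/3. The bound for the tail of f and
  the last inequality hold strictly in the limit e = 0. The order \<open>m\<close> of the square
  root is taken last, once b and \<sigma> are fixed, and \<gamma> is the smallest slack.\<close>

lemma admissible_exists:
  assumes "0 < t" "t < 1/3"
  shows "\<exists>b \<sigma> m \<gamma>. admissible t b \<sigma> m \<gamma>"
proof -
  \<comment> \<open>The first inequality has only first-order room e (1 - 3t), so \<sigma> must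
    shrink with e. Taking \<sigma> = c e with c half of 1 - 3t uses up half of that room.\<close>
  define c where "c = (1 - 3 * t) / 2"
  have c: "0 < c" "c < 1/2" "1 - 3 * t - c > 0" using assms by (auto simp: c_def field_simps)
  have "\<forall>\<^sub>F e in at_right 0. 0 < 1 - 3 * t - c - e * (2 * t + c)"
    by (rule order_tendstoD(1)[where y="1 - 3 * t - c"]) (use c in \<open>auto intro!: tendsto_eq_intros\<close>)
  moreover have "\<forall>\<^sub>F e in at_right 0. 0 < 2 - 2 * t * (1 + e) * (2 + e) - c * (1 + e)^2"
    by (rule order_tendstoD(1)[where y="2 - 4 * t - c"]) (use c assms in \<open>auto intro!: tendsto_eq_intros\<close>)
  moreover have "\<forall>\<^sub>F e in at_right 0. 0 < 2/3 - 2 * t * (1 + e)^3 - c * e * (1 + e)^2"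
    by (rule order_tendstoD(1)[where y="2/3 - 2 * t"]) (use assms in \<open>auto intro!: tendsto_eq_intros\<close>)
  moreover have "\<forall>\<^sub>F e in at_right 0. 0 < 1 - t * e - c * e / 2"
    by (rule order_tendstoD(1)[where y=1]) (auto intro!: tendsto_eq_intros)
  moreover have "\<forall>\<^sub>F e in at_right (0::real). 0 < e \<and> e < 1"
    using eventually_at_right_real[of 0 1] by simp
  ultimately have "\<forall>\<^sub>F e in at_right 0. 0 < 1 - 3 * t - c - e * (2 * t + c) \<and>
     0 < 2 - 2 * t * (1 + e) * (2 + e) - c * (1 + e)^2 \<and> 0 < 2/3 - 2 * t * (1 + e)^3 - c * e * (1 + e)^2 \<and>
     0 < 1 - t * e - c * e / 2 \<and> 0 < e \<and> e < 1"
    by eventually_elim blast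
  from eventually_happens'[OF trivial_limit_at_right_real this]
  obtain e where e: "0 < 1 - 3 * t - c - e * (2 * t + c)"
     "0 < 2 - 2 * t * (1 + e) * (2 + e) - c * (1 + e)^2" "0 < 2/3 - 2 * t * (1 + e)^3 - c * e * (1 + e)^2"
     "0 < 1 - t * e - c * e / 2" "0 < e" "e < 1"
    by blast
  define b \<sigma> where "b = 1 + e" and "\<sigma> = c * e"
  have s0: "0 < \<sigma>" using c(1) e(5) by (simp add: \<sigma>_def)
  obtain m :: nat where m: "(2 * t * b^3 + \<sigma> * b^2 - 2 * t * b) / \<sigma> < real m"
    using reals_Archimedean2 by blast
  define g1 where "g1 = - 2 * t * b^2 - \<sigma> * b - (1 - b - t - t * b)"
  define g2 where "g2 = - 2 * t * b^3 - \<sigma> * b^2 - (2 - 2 * b - 2 * t * b)"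
  define g3 where "g3 = - 2 * t * b^3 - \<sigma> * b^2 - (- \<sigma> * real (Suc m) - 2 * t * b)"
  define g4 where "g4 = - 2 * t * b^3 - \<sigma> * b^2 - (- (2/3))"
  define g5 where "g5 = - (t * b^2 + \<sigma> * b / 2 - b * (1 + t))"
  have "g1 = e * (1 - 3 * t - c - e * (2 * t + c))"
    by (simp add: g1_def b_def \<sigma>_def power2_eq_square algebra_simps)
  then have g1: "0 < g1" using e(1,5) by simp
  have "g2 = e * (2 - 2 * t * (1 + e) * (2 + e) - c * (1 + e)^2)"
    by (simp add: g2_def b_def \<sigma>_def power2_eq_square power3_eq_cube algebra_simps)
  then have g2: "0 < g2" using e(2,5) by simp
  have g3: "0 < g3" using m s0 by (simp add: g3_def divide_less_eq algebra_simps)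
  have g4: "0 < g4" using e(3) by (simp add: g4_def b_def \<sigma>_def)
  have "g5 = b * (1 - t * e - c * e / 2)"
    by (simp add: g5_def b_def \<sigma>_def power2_eq_square field_simps)
  then have g5: "0 < g5" using e(4,5) by (simp add: b_def)
  have e2: "0 < (1 - t) * e" using e(5) assms by (intro mult_pos_pos) auto
  define S where "S = {g1, g2, g3, g4, g5, e, (1 - t) * e}"
  define \<gamma> where "\<gamma> = Min S"
  have S: "finite S" "S \<noteq> {}" "\<And>g. g \<in> S \<Longrightarrow> 0 < g"
    unfolding S_def using g1 g2 g3 g4 g5 e(5) e2 by blast+
  have "0 < \<gamma>" unfolding \<gamma>_def using S by (simp add: Min_gr_iff)
  moreover have le: "\<gamma> \<le> g" if "g \<in> S" for g
    unfolding \<gamma>_def by (rule Min_le[OF S(1) that])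
  have "\<gamma> \<le> g1" "\<gamma> \<le> g2" "\<gamma> \<le> g3" "\<gamma> \<le> g4" "\<gamma> \<le> g5" "\<gamma> \<le> e" "\<gamma> \<le> (1 - t) * e"
    by (rule le, simp only: S_def insert_iff simp_thms)+
  moreover have "b - 1 = e" by (simp add: b_def)
  moreover have "1 < b" "b \<le> 2" using e(5,6) by (simp_all add: b_def)
  ultimately have "admissible t b \<sigma> m \<gamma>"
    unfolding admissible_def g1_def g2_def g3_def g4_def g5_def using assms s0
    by (intro conjI) (simp only: | linarith)+
  then show ?thesis by blast
qed

section \<open>One stage of the scheme and its infinite iteration\<close>

lemma powr_gap:
  assumes "1 \<le> (x::real)" "c \<le> x powr \<gamma>" "e1 + \<gamma> \<le> e2"
  shows "c * x powr e1 \<le> x powr e2"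
proof -
  have "c * x powr e1 \<le> x powr \<gamma> * x powr e1" using assms by (intro mult_right_mono) auto
  also have "\<dots> = x powr (e1 + \<gamma>)" by (simp add: powr_add mult.commute)
  also have "\<dots> \<le> x powr e2" using assms by (intro powr_mono) auto
  finally show ?thesis .
qed

text \<open>All that the iteration needs to know about the right-hand side: \<open>g N\<close>
  stands for the inverse Laplacian of f truncated at frequency N, with a uniform size and a tail of
  order N^(-2/3). Its relation to f enters only when the limit is tested.\<close>

definition lowpass :: "(real \<Rightarrow> real \<times> real \<Rightarrow> real) \<Rightarrow> real \<Rightarrow> bool" where
  "lowpass g G \<longleftrightarrow> (\<forall>N\<ge>1. wiener (cball 0 N) G (g N)) \<and>
     (\<forall>N N'. 1 \<le> N \<longrightarrow> N \<le> N' \<longrightarrow> wiener (cball 0 N') (G * N powr (-2/3)) (\<lambda>x. g N' x - g N x))"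

text \<open>Here \<open>x\<close> is the current frequency. With y = x^b the next squared amplitude
  is H y^(-2t), and \<open>P\<close> is smaller than it by x^(-\<sigma>). \<open>R\<close> already
  has half of the size that the next stage allows for its \<open>P\<close>, written in terms of x.
  The second derivatives have the size of amplitude times frequency; the factor 2 leaves room for
  the sum of all earlier contributions.\<close>

definition stage where
  "stage g C H t b \<sigma> i x v P R \<longleftrightarrow> trig_poly v \<and>
     (\<forall>k l. wiener (cball 0 x) (2 * C * sqrt H * x powr (1 - t)) (pd k (pd l v))) \<and>
     wiener (cball 0 x) (H * x powr (- 2 * t * b - \<sigma>)) P \<and>
     wiener (cball 0 x) (H / 2 * x powr (- 2 * t * b^2 - \<sigma> * b)) R \<and>
     (\<forall>y. hess v y - lap (g x) y = pd (\<not> i) (pd (\<not> i) P) y + pd i (pd i R) y)"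

text \<open>The hypotheses that x^\<gamma> dominates \<open>48 * C\<^sup>2\<close> and
  \<open>6 * G\<close> turn every strict inequality between exponents into an inequality that also
  absorbs its constant. The direction flips because the old \<open>R\<close> becomes the next
  potential to be removed.\<close>

lemma stage_step:
  fixes C :: real
  assumes adm: "admissible t b \<sigma> m \<gamma>" and sc: "step_const m C" and lp: "lowpass g G"
    and H: "1 \<le> H" and x: "1 \<le> x" "48 * C\<^sup>2 \<le> x powr \<gamma>" "6 * G \<le> x powr \<gamma>"
    and st: "stage g C H t b \<sigma> i x v P R"
  shows "\<exists>v' P' R'. stage g C H t b \<sigma> (\<not> i) (x powr b) v' P' R' \<and>
     wiener (cball 0 (x powr b)) (4 * C * sqrt H * x powr (- (b * (1 + t)))) (\<lambda>y. v' y - v y)"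
proof -
  note a = adm[unfolded admissible_def]
  have C8: "8 \<le> C" using sc by (simp add: step_const_def)
  have G0: "0 \<le> G" using lp wiener_nonneg unfolding lowpass_def by (metis order_refl)
  define y where "y = x powr b"
  define \<delta> where "\<delta> = H * x powr (- 2 * t * b)"
  define \<kappa> where "\<kappa> = x powr (- \<sigma>)"
  \<comment> \<open>One corrugation produces potentials with frequencies up to 4\<nu>, which must
    fit into the next band.\<close>
  define \<nu> where "\<nu> = y / 4"
  define D where "D = 2 * C * sqrt H * x powr (1 - t)"
  have y0: "0 < y" using x by (simp add: y_def)
  have pw: "x powr e1 * x powr e2 = x powr (e1 + e2)" for e1 e2 by (simp add: powr_add)
  have sqH: "sqrt H * sqrt H = H" "1 \<le> sqrt H" "sqrt H \<le> H"
    using H real_sqrt_le_mono[of 1 H] by (auto simp: real_le_lsqrt power2_eq_square)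
  have sqd: "sqrt \<delta> = sqrt H * x powr (- (t * b))"
  proof -
    have "x powr (- 2 * t * b) = (x powr (- (t * b)))\<^sup>2" by (simp add: power2_eq_square pw mult_ac)
    then show ?thesis using x by (simp add: \<delta>_def real_sqrt_mult)
  qed
  have CC: "C * 8 \<le> C\<^sup>2" using C8 by (simp add: power2_eq_square)
  have gap: "c * x powr e1 \<le> x powr e2" if "c \<le> 48 * C\<^sup>2 \<or> c \<le> 6 * G" "e1 + \<gamma> \<le> e2" for c e1 e2
    using that x by (intro powr_gap[of x c \<gamma>]) auto
  from st have v: "trig_poly v" "\<And>k l. wiener (cball 0 x) D (pd k (pd l v))"
    and P: "wiener (cball 0 x) (\<kappa> * \<delta>) P"
    and R: "wiener (cball 0 x) (H / 2 * x powr (- 2 * t * b^2 - \<sigma> * b)) R"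
    and eq: "\<forall>y. hess v y - lap (g x) y = pd (\<not> i) (pd (\<not> i) P) y + pd i (pd i R) y"
    by (auto simp: stage_def D_def \<kappa>_def \<delta>_def powr_diff powr_minus field_simps)
  have d0: "0 < \<delta>" using H x by (simp add: \<delta>_def)
  have k1: "\<kappa> \<le> 1" using x a powr_mono[of "- \<sigma>" 0 x] by (simp add: \<kappa>_def)
  have Cx: "C * x \<le> \<nu>"
  proof -
    have "(4 * C) * x powr 1 \<le> x powr b" using a CC C8 by (intro gap) auto
    then show ?thesis using x by (simp add: \<nu>_def y_def)
  qed
  have n0: "0 < \<nu>" using y0 by (simp add: \<nu>_def)
  obtain W P1 R1 where W: "wiener (cball 0 (2 * \<nu>)) (C * sqrt \<delta> / \<nu>) W"
    and P1: "wiener (cball 0 (4 * \<nu>)) (C * (\<kappa> ^ Suc m * \<delta> + \<delta> * x\<^sup>2 / \<nu>\<^sup>2)) P1"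
    and R1: "wiener (cball 0 (4 * \<nu>)) (H / 2 * x powr (- 2 * t * b^2 - \<sigma> * b) + C * (sqrt \<delta> * D / \<nu> + \<delta> * x\<^sup>2 / \<nu>\<^sup>2)) R1"
    and eq1: "\<And>y. hess (\<lambda>x. v x + W x) y - lap (g x) y = pd (\<not> i) (pd (\<not> i) P1) y + pd i (pd i R1) y"
    using sc[unfolded step_const_def, THEN conjunct2, rule_format, OF v P R d0 k1 _ n0 Cx eq[rule_format]] x(1)
    by auto
  have "8 * x \<le> C * x" using C8 x by (intro mult_right_mono) auto
  then have xy: "x \<le> y" using Cx x(1) unfolding \<nu>_def by linarith
  define h where "h = (\<lambda>z. g y z - g x z)"
  have h: "wiener (cball 0 y) (G * x powr (-2/3)) h"
    using lp x xy unfolding lowpass_def h_def by blast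
  have ny: "4 * \<nu> = y" by (simp add: \<nu>_def)
  \<comment> \<open>Passing from \<open>g x\<close> to \<open>g y\<close> changes the defect by
    minus the Laplacian of \<open>h\<close>, which is taken off both potentials. At the end they are
    passed to \<open>stage\<close> in swapped order together with the flipped direction.\<close>
  define v' P' R' where "v' = (\<lambda>z. v z + W z)" and "P' = (\<lambda>z. P1 z - h z)" and "R' = (\<lambda>z. R1 z - h z)"
  have "1 \<le> y" using xy x(1) by simp
  then have "wiener (cball 0 x) G (g x)" "wiener (cball 0 y) G (g y)"
    using lp x(1) unfolding lowpass_def by blast+
  then have eps: "trig_poly v" "trig_poly W" "trig_poly P1" "trig_poly R1" "trig_poly h" "trig_poly (g x)" "trig_poly (g y)"
    using v(1) wiener_trig_poly W P1 R1 h by blast+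
  have "hess v' z - lap (g y) z = pd i (pd i R') z + pd (\<not> i) (pd (\<not> i) P') z" for z
  proof -
    have "lap h z = lap (g y) z - lap (g x) z" by (simp add: h_def lap_simps eps)
    then show ?thesis
      using eq1[of z] unfolding v'_def P'_def R'_def lap_alt[of h z i]
      by (simp add: eps trig_poly_pd_simps)
  qed
  moreover have "trig_poly v'" using eps by (simp add: v'_def)
  moreover have "wiener (cball 0 y) (2 * C * sqrt H * y powr (1 - t)) (pd k (pd l v'))" for k l
  proof -
    have "wiener (cball 0 y) D (pd k (pd l v))" using xy by (intro wiener_mono[OF v(2)]) auto
    moreover have "wiener (cball 0 y) ((2 * \<nu>) * ((2 * \<nu>) * (C * sqrt \<delta> / \<nu>))) (pd k (pd l W))"
      using y0 by (intro wiener_mono[OF wiener_pd_cball[OF wiener_pd_cball[OF W]] _ order_refl]) (auto simp: \<nu>_def)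
    ultimately have "wiener (cball 0 y) (D + (2 * \<nu>) * ((2 * \<nu>) * (C * sqrt \<delta> / \<nu>))) (pd k (pd l v'))"
      using wiener_add by (simp add: v'_def trig_poly_pd_simps eps)
    moreover have "D + (2 * \<nu>) * ((2 * \<nu>) * (C * sqrt \<delta> / \<nu>)) \<le> 2 * C * sqrt H * y powr (1 - t)"
    proof -
      have "y * x powr (- (t * b)) = y powr (1 - t)"
        using x by (simp add: y_def powr_powr pw algebra_simps)
      then have "(2 * \<nu>) * ((2 * \<nu>) * (C * sqrt \<delta> / \<nu>)) = C * sqrt H * y powr (1 - t)"
        using y0 by (simp add: sqd \<nu>_def)
      moreover have "2 * x powr (1 - t) \<le> y powr (1 - t)"
        unfolding y_def powr_powr using a C8 CC by (intro gap) (auto simp: algebra_simps)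
      then have "C * sqrt H * (2 * x powr (1 - t)) \<le> C * sqrt H * y powr (1 - t)"
        using C8 sqH by (intro mult_left_mono) auto
      ultimately show ?thesis by (simp add: D_def)
    qed
    ultimately show ?thesis by (rule wiener_mono[OF _ order_refl])
  qed
  moreover
  have q: "C * (\<delta> * x\<^sup>2 / \<nu>\<^sup>2) = H * (16 * C * x powr (2 - 2 * b - 2 * t * b))"
  proof -
    have "x\<^sup>2 / \<nu>\<^sup>2 = 16 * x powr (2 - 2 * b)"
      using x by (simp add: \<nu>_def y_def powr_diff powr_mult_base power_divide powr_powr[symmetric] field_simps
          flip: powr_numeral)
    then have "\<delta> * (x\<^sup>2 / \<nu>\<^sup>2) = 16 * H * (x powr (2 - 2 * b) * x powr (- 2 * t * b))"
      by (simp only: \<delta>_def) simp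
    also have "\<dots> = 16 * H * x powr (2 - 2 * b - 2 * t * b)" unfolding pw by simp
    finally show ?thesis by simp
  qed
  \<comment> \<open>Every error term gets a share H/6. The largest constant that occurs is 8 C^2,
    from the main error, hence the threshold 48 C^2.\<close>
  have Hle: "H * (c * x powr e1) \<le> H / 6 * x powr e2" if "6 * c \<le> 48 * C\<^sup>2 \<or> 6 * c \<le> 6 * G" "e1 + \<gamma> \<le> e2" for c e1 e2
    using mult_left_mono[OF gap[OF that], of "H/6"] H by simp
  have ePR: "- 2 * t * b ^ 3 - \<sigma> * b\<^sup>2 \<le> - 2 * t * b ^ 2 - \<sigma> * b"
  proof -
    have "b ^ 2 \<le> b ^ 3" "b \<le> b\<^sup>2" using a by (auto simp: power2_eq_square power3_eq_cube)
    then show ?thesis using a mult_left_mono[of "b^2" "b^3" "2 * t"] mult_left_mono[of b "b^2" \<sigma>] by linarith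
  qed
  have Gle: "G * x powr (-2/3) \<le> H / 6 * x powr (- 2 * t * b ^ 3 - \<sigma> * b\<^sup>2)"
  proof -
    have "G * x powr (-2/3) \<le> H * (G * x powr (-2/3))" using H G0 mult_right_mono[of 1 H "G * x powr (-2/3)"] by simp
    also have "\<dots> \<le> H / 6 * x powr (- 2 * t * b ^ 3 - \<sigma> * b\<^sup>2)" using a by (intro Hle) auto
    finally show ?thesis .
  qed
  have qle: "C * (\<delta> * x\<^sup>2 / \<nu>\<^sup>2) \<le> H / 6 * x powr (- 2 * t * b ^ 3 - \<sigma> * b\<^sup>2)"
    unfolding q using a CC C8 by (intro Hle) auto
  have ytr: "y powr (- 2 * t * b - \<sigma>) = x powr (- 2 * t * b^2 - \<sigma> * b)"
     "y powr (- 2 * t * b^2 - \<sigma> * b) = x powr (- 2 * t * b^3 - \<sigma> * b^2)"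
    unfolding y_def powr_powr by (auto simp: algebra_simps power2_eq_square power3_eq_cube)
  have mono: "x powr (- 2 * t * b ^ 3 - \<sigma> * b\<^sup>2) \<le> x powr (- 2 * t * b ^ 2 - \<sigma> * b)"
    using ePR x by (intro powr_mono) auto
  have Hmono: "H / 6 * x powr (- 2 * t * b ^ 3 - \<sigma> * b\<^sup>2) \<le> H / 6 * x powr (- 2 * t * b ^ 2 - \<sigma> * b)"
    using mono H by (intro mult_left_mono) auto
  have "wiener (cball 0 y) (H * y powr (- 2 * t * b - \<sigma>)) R'"
    unfolding R'_def
  proof (rule wiener_mono[OF wiener_diff[OF R1[unfolded ny] h] order_refl])
    \<comment> \<open>The main error: new amplitude times old second derivatives over the new
      frequency. Its exponent is the one that forces t < 1/3. The budget is H/2 for the old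
      \<open>R\<close> and H/6 each for this term, for the quadratic term and for the tail of
      f.\<close>
    have "C * (sqrt \<delta> * D / \<nu>) = H * (8 * C\<^sup>2 * x powr (1 - b - t - t * b))"
    proof -
      have "x powr (- (t * b)) * x powr (1 - t) / y = x powr (1 - b - t - t * b)"
        using x by (simp add: y_def pw powr_diff[symmetric] algebra_simps)
      moreover have "sqrt \<delta> * D / \<nu> = 8 * C * (sqrt H * sqrt H) * (x powr (- (t * b)) * x powr (1 - t) / y)"
        by (simp add: sqd D_def \<nu>_def)
      ultimately show ?thesis unfolding sqH(1) by (simp add: power2_eq_square)
    qed
    also have "\<dots> \<le> H / 6 * x powr (- 2 * t * b ^ 2 - \<sigma> * b)" using a by (intro Hle) auto
    finally have "C * (sqrt \<delta> * D / \<nu>) \<le> H / 6 * x powr (- 2 * t * b ^ 2 - \<sigma> * b)" .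
    then show "H / 2 * x powr (- 2 * t * b^2 - \<sigma> * b) + C * (sqrt \<delta> * D / \<nu> + \<delta> * x\<^sup>2 / \<nu>\<^sup>2) + G * x powr (-2/3)
       \<le> H * y powr (- 2 * t * b - \<sigma>)"
      unfolding ytr distrib_left using Gle qle Hmono by linarith
  qed
  moreover have "wiener (cball 0 y) (H / 2 * y powr (- 2 * t * b^2 - \<sigma> * b)) P'"
    unfolding P'_def
  proof (rule wiener_mono[OF wiener_diff[OF P1[unfolded ny] h] order_refl])
    have "C * (\<kappa> ^ Suc m * \<delta>) = H * (C * x powr (- \<sigma> * real (Suc m) - 2 * t * b))"
    proof -
      have "\<kappa> ^ Suc m = x powr (- \<sigma> * real (Suc m))"
        using x powr_realpow[of \<kappa> "Suc m"] by (simp add: \<kappa>_def powr_powr del: power_Suc of_nat_Suc)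
      then have "\<kappa> ^ Suc m * \<delta> = H * (x powr (- \<sigma> * real (Suc m)) * x powr (- 2 * t * b))" by (simp add: \<delta>_def)
      then show ?thesis unfolding pw by simp
    qed
    also have "\<dots> \<le> H / 6 * x powr (- 2 * t * b ^ 3 - \<sigma> * b\<^sup>2)"
      using a CC C8 by (intro Hle) auto
    finally have "C * (\<kappa> ^ Suc m * \<delta>) \<le> H / 6 * x powr (- 2 * t * b ^ 3 - \<sigma> * b\<^sup>2)" .
    then show "C * (\<kappa> ^ Suc m * \<delta> + \<delta> * x\<^sup>2 / \<nu>\<^sup>2) + G * x powr (-2/3)
       \<le> H / 2 * y powr (- 2 * t * b^2 - \<sigma> * b)"
      unfolding ytr distrib_left using Gle qle by linarith
  qed
  moreover have "wiener (cball 0 y) (4 * C * sqrt H * x powr (- (b * (1 + t)))) (\<lambda>z. v' z - v z)"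
  proof -
    have "C * sqrt \<delta> / \<nu> = 4 * C * sqrt H * x powr (- (b * (1 + t)))"
    proof -
      have "x powr (- (t * b)) / y = x powr (- (b * (1 + t)))"
      proof -
        have "- (t * b) - b = - (b * (1 + t))" by (simp add: algebra_simps)
        then show ?thesis unfolding y_def powr_diff[symmetric] by simp
      qed
      moreover have "C * sqrt \<delta> / \<nu> = 4 * C * sqrt H * (x powr (- (t * b)) / y)"
        by (simp add: sqd \<nu>_def)
      ultimately show ?thesis by simp
    qed
    moreover have "wiener (cball 0 y) (C * sqrt \<delta> / \<nu>) W"
      using y0 by (intro wiener_mono[OF W _ order_refl]) (auto simp: \<nu>_def)
    ultimately show ?thesis by (simp add: v'_def)
  qed
  ultimately have "stage g C H t b \<sigma> (\<not> i) y v' R' P' \<and>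
      wiener (cball 0 y) (4 * C * sqrt H * x powr (- (b * (1 + t)))) (\<lambda>z. v' z - v z)"
    unfolding stage_def by simp
  then show ?thesis unfolding y_def by blast
qed

text \<open>The defect of any trigonometric polynomial is a Laplacian, because
  \<open>hess v0\<close> is one, and a Laplacian splits evenly as d_11 P + d_22 P. So the same
  function starts as both potentials. \<open>H\<close> is chosen so that the bound for
  \<open>R\<close> holds with equality; the one for \<open>P\<close> is then weaker.\<close>

lemma initial_stage:
  assumes adm: "admissible t b \<sigma> m \<gamma>" and C: "8 \<le> C" and lp: "lowpass g G"
    and v0: "wiener (cball 0 \<rho>) K v0" "0 \<le> \<rho>"
    and D0: "D0 = 2 * K\<^sup>2 * \<rho>\<^sup>2 + G + 1"
    and M: "1 \<le> M" "2 * \<rho> \<le> M" "\<rho>\<^sup>2 * K \<le> M powr (1 - t)"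
    and H: "H = 2 * D0 * M powr (2 * t * b^2 + \<sigma> * b)"
  shows "1 \<le> H" "\<exists>P R. stage g C H t b \<sigma> True M v0 P R"
proof -
  note a = adm[unfolded admissible_def]
  have K0: "0 \<le> K" using v0(1) by (rule wiener_nonneg)
  have g: "wiener (cball 0 M) G (g M)" using lp M(1) unfolding lowpass_def by blast
  then have G0: "0 \<le> G" by (rule wiener_nonneg)
  have D1: "1 \<le> D0" using K0 G0 by (simp add: D0)
  have "M powr 0 \<le> M powr (2 * t * b^2 + \<sigma> * b)" using M a by (intro powr_mono) auto
  then have "1 * 1 \<le> (2 * D0) * M powr (2 * t * b^2 + \<sigma> * b)" using D1 M by (intro mult_mono) auto
  then show H1: "1 \<le> H" by (simp add: H)
  obtain k where k: "wiener (cball 0 (2 * \<rho>)) (2 * K\<^sup>2 * \<rho>\<^sup>2) k" "lap k = hess v0"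
    using wiener_inverse_lap_hess[OF v0] by blast
  define P where "P = (\<lambda>x. k x - g M x)"
  have eps: "trig_poly k" "trig_poly (g M)" "trig_poly v0" using k g v0 by (auto intro: wiener_trig_poly)
  have P: "wiener (cball 0 M) D0 P"
    unfolding P_def
    by (rule wiener_mono[OF wiener_diff[OF wiener_mono[OF k(1) _ order_refl] g]]) (use M in \<open>auto simp: D0\<close>)
  have eq: "hess v0 y - lap (g M) y = pd (\<not> True) (pd (\<not> True) P) y + pd True (pd True P) y" for y
  proof -
    have "lap P y = lap k y - lap (g M) y" by (simp add: P_def lap_simps eps)
    then show ?thesis using lap_alt[of P y True] by (simp add: k(2))
  qed
  have D2: "wiener (cball 0 M) (2 * C * sqrt H * M powr (1 - t)) (pd k (pd l v0))" for k l
  proof (rule wiener_mono[OF wiener_pd_cball[OF wiener_pd_cball[OF v0] v0(2)]])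
    show "cball 0 \<rho> \<subseteq> cball 0 M" using M v0(2) by auto
    have "1 * (\<rho>\<^sup>2 * K) \<le> (2 * C * sqrt H) * M powr (1 - t)"
      using C H1 M K0 real_sqrt_le_mono[OF H1] mult_mono[of 1 "2 * C" 1 "sqrt H"] by (intro mult_mono) auto
    then show "\<rho> * (\<rho> * K) \<le> 2 * C * sqrt H * M powr (1 - t)" by (simp add: power2_eq_square)
  qed
  have R: "D0 = H / 2 * M powr (- 2 * t * b^2 - \<sigma> * b)"
    unfolding H using M by (simp add: powr_add[symmetric])
  have P1: "D0 \<le> H * M powr (- 2 * t * b - \<sigma>)"
  proof -
    have "b \<le> b\<^sup>2" using a by (simp add: power2_eq_square)
    moreover from this have "2 * t * b \<le> 2 * t * b\<^sup>2" using a by (intro mult_left_mono) auto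
    moreover have "\<sigma> * 1 \<le> \<sigma> * b" using a by (intro mult_left_mono) auto
    ultimately have "M powr (- 2 * t * b^2 - \<sigma> * b) \<le> M powr (- 2 * t * b - \<sigma>)" using M by (intro powr_mono) auto
    then have "H * M powr (- 2 * t * b^2 - \<sigma> * b) \<le> H * M powr (- 2 * t * b - \<sigma>)" using H1 by (intro mult_left_mono) auto
    moreover have "0 \<le> H * M powr (- 2 * t * b^2 - \<sigma> * b)" using H1 by simp
    ultimately show ?thesis unfolding R by simp
  qed
  have "stage g C H t b \<sigma> True M v0 P P"
    unfolding stage_def using eps(3) D2 wiener_mono[OF P order_refl P1] P[unfolded R] eq by blast
  then show "\<exists>P R. stage g C H t b \<sigma> True M v0 P R" by blast
qed

text \<open>The initial frequency M is the only free parameter left, and it is chosen after all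
  constants. Only what the limit needs is exported: frequencies at least double, increments decay
  like a negative power of the frequency, and the potentials tend to zero.\<close>

lemma iteration:
  assumes t: "0 < t" "t < 1/3" and lp: "lowpass g G"
    and v0: "wiener (cball 0 \<rho>) K v0" "0 \<le> \<rho>" and \<eta>: "0 < \<eta>"
  shows "\<exists>v \<mu> E e. (\<forall>q::nat. trig_poly (v q)) \<and> v 0 = v0 \<and> (\<forall>q. 1 \<le> \<mu> q) \<and> (\<forall>q. 2 * \<mu> q \<le> \<mu> (Suc q)) \<and>
     0 \<le> E \<and> E * \<mu> 1 powr (- 1 - t) \<le> \<eta> \<and> e \<longlonglongrightarrow> 0 \<and>
     (\<forall>q. wiener (cball 0 (\<mu> (Suc q))) (E * \<mu> (Suc q) powr (- 1 - t)) (\<lambda>x. v (Suc q) x - v q x)) \<and>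
     (\<forall>q. \<exists>i P R. wiener UNIV (e q) P \<and> wiener UNIV (e q) R \<and>
        (\<forall>x. hess (v q) x - lap (g (\<mu> q)) x = pd (\<not> i) (pd (\<not> i) P) x + pd i (pd i R) x))"
proof -
  obtain b \<sigma> m \<gamma> where adm: "admissible t b \<sigma> m \<gamma>" using admissible_exists[OF t] by blast
  note a = adm[unfolded admissible_def]
  obtain C where sc: "step_const m C" using step_const_exists by blast
  have C8: "8 \<le> C" using sc by (simp add: step_const_def)
  have K0: "0 \<le> K" using v0(1) by (rule wiener_nonneg)
  have G0: "0 \<le> G" using lp wiener_nonneg unfolding lowpass_def by (metis order_refl)
  define D0 where "D0 = 2 * K\<^sup>2 * \<rho>\<^sup>2 + G + 1"
  have D1: "1 \<le> D0" using K0 G0 by (simp add: D0_def)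
  \<comment> \<open>The sum of all quantities that M^\<gamma> has to dominate, so that M =
    L^(1/\<gamma>) meets every requirement at once.\<close>
  define L where "L = 2 + 48 * C\<^sup>2 + 6 * G + 2 * \<rho> + \<rho>\<^sup>2 * K + 4 * C * sqrt (2 * D0) / \<eta>"
  have L: "2 \<le> L" "48 * C\<^sup>2 \<le> L" "6 * G \<le> L" "2 * \<rho> \<le> L" "\<rho>\<^sup>2 * K \<le> L" "4 * C * sqrt (2 * D0) / \<eta> \<le> L"
    unfolding L_def using C8 G0 v0(2) K0 D1 \<eta> by (simp_all add: add_nonneg_nonneg)
  define M where "M = L powr (1 / \<gamma>)"
  have Mg: "M powr \<gamma> = L" using a L(1) by (simp add: M_def powr_powr)
  have M1: "1 \<le> M" using L(1) a unfolding M_def by (intro ge_one_powr_ge_zero) auto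
  have Mpow: "L \<le> M powr s" if "\<gamma> \<le> s" for s
    using powr_mono[OF that M1] Mg by simp
  have LM: "L \<le> M" using Mpow[of 1] a M1 by simp
  have t1: "\<gamma> \<le> 1 - t"
  proof -
    have "\<gamma> \<le> (1 - t) * (b - 1)" using a by blast
    also have "\<dots> \<le> (1 - t) * 1" using a by (intro mult_left_mono) auto
    finally show ?thesis by simp
  qed
  define H where "H = 2 * D0 * M powr (2 * t * b^2 + \<sigma> * b)"
  have Mr: "2 * \<rho> \<le> M" "\<rho>\<^sup>2 * K \<le> M powr (1 - t)" using LM L(4,5) Mpow[OF t1] by auto
  note init = initial_stage[OF adm C8 lp v0 D0_def M1 Mr H_def]
  define \<mu> where "\<mu> = (\<lambda>q::nat. M powr (b ^ q))"
  have bq: "1 \<le> b ^ q" for q using a by (intro one_le_power) auto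
  have muM: "M \<le> \<mu> q" for q using powr_mono[OF bq M1] M1 by (simp add: \<mu>_def)
  then have mu1: "1 \<le> \<mu> q" for q using M1 order_trans by blast
  have muS: "\<mu> (Suc q) = \<mu> q powr b" for q by (simp add: \<mu>_def powr_powr mult.commute)
  have muL: "L \<le> \<mu> q powr \<gamma>" for q
    using powr_mono2[of \<gamma> M "\<mu> q"] muM[of q] M1 a Mg by auto
  have dbl: "2 * \<mu> q \<le> \<mu> (Suc q)" for q
    using powr_gap[of "\<mu> q" 2 \<gamma> 1 b] mu1[of q] muL[of q] L(1) a unfolding muS by simp
  define E where "E = 4 * C * sqrt H"
  have step: "\<exists>v' P' R'. stage g C H t b \<sigma> (\<not> i) (\<mu> (Suc q)) v' P' R' \<and>
     wiener (cball 0 (\<mu> (Suc q))) (E * \<mu> (Suc q) powr (- 1 - t)) (\<lambda>y. v' y - v y)"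
    if "stage g C H t b \<sigma> i (\<mu> q) v P R" for q i v P R
  proof -
    have "\<mu> q powr (- (b * (1 + t))) = \<mu> (Suc q) powr (- 1 - t)"
      unfolding muS powr_powr by (simp add: algebra_simps)
    then show ?thesis
      using stage_step[OF adm sc lp init(1) mu1 _ _ that] muL[of q] L(2,3) unfolding muS E_def by auto
  qed
  obtain P0 R0 where st0: "stage g C H t b \<sigma> True (\<mu> 0) v0 P0 R0"
    using init(2) M1 by (auto simp: \<mu>_def)
  \<comment> \<open>The state chosen at each step is a pair of direction and function; the
    potentials are recovered from the existential statement. The clause for q = 0 fixes the start
    inside dependent choice.\<close>
  have "\<exists>f. \<forall>q. ((q = 0 \<longrightarrow> snd (f q) = v0) \<and>
       (\<exists>P R. stage g C H t b \<sigma> (fst (f q)) (\<mu> q) (snd (f q)) P R)) \<and>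
      wiener (cball 0 (\<mu> (Suc q))) (E * \<mu> (Suc q) powr (- 1 - t)) (\<lambda>y. snd (f (Suc q)) y - snd (f q) y)"
  proof (rule dependent_nat_choice, goal_cases)
    case 1
    show ?case using st0 by (intro exI[of _ "(True, v0)"]) auto
  next
    case (2 x q)
    then obtain P R where "stage g C H t b \<sigma> (fst x) (\<mu> q) (snd x) P R" by blast
    from step[OF this] obtain v' P' R' where *: "stage g C H t b \<sigma> (\<not> fst x) (\<mu> (Suc q)) v' P' R'"
     "wiener (cball 0 (\<mu> (Suc q))) (E * \<mu> (Suc q) powr (- 1 - t)) (\<lambda>y. v' y - snd x y)" by blast
    show ?case using * by (intro exI[of _ "(\<not> fst x, v')"]) auto
  qed
  then obtain f :: "nat \<Rightarrow> bool \<times> (real \<times> real \<Rightarrow> real)" where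
    f0: "snd (f 0) = v0" and
    fst1: "\<And>q. \<exists>P R. stage g C H t b \<sigma> (fst (f q)) (\<mu> q) (snd (f q)) P R" and
    fW: "\<And>q. wiener (cball 0 (\<mu> (Suc q))) (E * \<mu> (Suc q) powr (- 1 - t)) (\<lambda>y. snd (f (Suc q)) y - snd (f q) y)"
    by blast
  define v where "v = (\<lambda>q. snd (f q))"
  define e where "e = (\<lambda>q. H * \<mu> q powr (- \<sigma>))"
  have ex: "\<exists>i P R. wiener UNIV (e q) P \<and> wiener UNIV (e q) R \<and>
        (\<forall>x. hess (v q) x - lap (g (\<mu> q)) x = pd (\<not> i) (pd (\<not> i) P) x + pd i (pd i R) x)" for q
  proof -
    obtain P R where st: "stage g C H t b \<sigma> (fst (f q)) (\<mu> q) (v q) P R" using fst1[of q] unfolding v_def by blast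
    have b0: "0 \<le> t * b" "0 \<le> t * b\<^sup>2" "\<sigma> * 1 \<le> \<sigma> * b"
      using a by (auto intro!: mult_left_mono)
    have "\<mu> q powr (- 2 * t * b - \<sigma>) \<le> \<mu> q powr (- \<sigma>)" using b0 mu1 by (intro powr_mono) (auto simp: mult.commute)
    then have 1: "H * \<mu> q powr (- 2 * t * b - \<sigma>) \<le> e q" using init(1) unfolding e_def by (intro mult_left_mono) auto
    have "\<mu> q powr (- 2 * t * b^2 - \<sigma> * b) \<le> \<mu> q powr (- \<sigma>)" using b0 mu1 by (intro powr_mono) (auto simp: mult.commute)
    then have 2: "H / 2 * \<mu> q powr (- 2 * t * b^2 - \<sigma> * b) \<le> e q" using init(1) unfolding e_def by (intro mult_mono) auto
    from st have "wiener UNIV (e q) P" "wiener UNIV (e q) R"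
      unfolding stage_def using wiener_mono[OF _ subset_UNIV 1] wiener_mono[OF _ subset_UNIV 2] by blast+
    then show ?thesis using st unfolding stage_def by blast
  qed
  have "2 ^ q \<le> \<mu> q" for q
  proof (induction q)
    case 0 show ?case using mu1 by simp
  next
    case (Suc q) then show ?case using dbl[of q] by simp
  qed
  then have "real q \<le> \<mu> q" for q
    using of_nat_less_two_power[of q, where 'a=real] by (meson less_imp_le order_trans)
  then have "filterlim \<mu> at_top sequentially"
    by (intro filterlim_at_top_mono[OF filterlim_real_sequentially]) simp
  then have "(\<lambda>q. \<mu> q powr (- \<sigma>)) \<longlonglongrightarrow> 0" using a by (intro tendsto_neg_powr) auto
  then have "e \<longlonglongrightarrow> 0" unfolding e_def by (rule tendsto_mult_right_zero)
  \<comment> \<open>Smallness in the uniform norm is not automatic, because sqrt H itself grows like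
    M^(t b^2 + \<sigma> b / 2). The first increment lives at the frequency M^b and gains M^(-b (1 +
    t)); the last admissibility condition says that the gain wins by M^(-\<gamma>).\<close>
  moreover have "E * \<mu> 1 powr (- 1 - t) \<le> \<eta>"
  proof -
    have "sqrt H = sqrt (2 * D0) * M powr (t * b^2 + \<sigma> * b / 2)"
    proof -
      have "M powr (2 * t * b^2 + \<sigma> * b) = (M powr (t * b^2 + \<sigma> * b / 2))\<^sup>2"
        unfolding power2_eq_square powr_add[symmetric] by (simp add: mult_ac)
      then show ?thesis using M1 by (simp add: H_def real_sqrt_mult)
    qed
    then have "E * \<mu> 1 powr (- 1 - t) = 4 * C * sqrt (2 * D0) * (M powr (t * b^2 + \<sigma> * b / 2) * M powr (- (b * (1 + t))))"
      by (simp add: E_def \<mu>_def powr_powr algebra_simps)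
    also have "\<dots> = 4 * C * sqrt (2 * D0) * M powr (t * b^2 + \<sigma> * b / 2 - b * (1 + t))"
      unfolding powr_add[symmetric] by simp
    also have "\<dots> \<le> 4 * C * sqrt (2 * D0) * M powr (- \<gamma>)"
      using a M1 C8 D1 by (intro mult_left_mono powr_mono) auto
    also have "\<dots> = 4 * C * sqrt (2 * D0) / L"
      using M1 by (simp add: powr_minus Mg divide_inverse)
    also have "\<dots> \<le> \<eta>" using L(6,1) \<eta> by (simp add: field_simps)
    finally show ?thesis .
  qed
  moreover have "trig_poly (v q)" for q using fst1[of q] by (auto simp: v_def stage_def)
  moreover have "0 \<le> E" using C8 init(1) by (simp add: E_def)
  ultimately show ?thesis
    using f0 fW mu1 dbl ex unfolding v_def
    by (intro exI[of _ "\<lambda>q. snd (f q)"] exI[of _ \<mu>] exI[of _ E] exI[of _ e] conjI allI) auto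
qed

section \<open>Fourier series of the right-hand side\<close>

lemma differentiable_partial_derivatives:
  assumes "u differentiable (at (p, q))"
  shows "((\<lambda>t. u (t, q)) has_real_derivative pd True u (p, q)) (at p)"
    "((\<lambda>t. u (p, t)) has_real_derivative pd False u (p, q)) (at q)"
proof -
  note d = differentiable_has_pd[OF assms]
  have "((\<lambda>t. u (t, q)) has_derivative (\<lambda>h. pd True u (p, q) * fst (h, 0::real) + pd False u (p, q) * snd (h, 0::real))) (at p)"
    by (rule has_derivative_compose[where f="\<lambda>t. (t, q)" and g=u])
       (use d in \<open>auto intro!: derivative_eq_intros\<close>)
  then show "((\<lambda>t. u (t, q)) has_real_derivative pd True u (p, q)) (at p)"
    by (simp add: has_field_derivative_def)
  have "((\<lambda>t. u (p, t)) has_derivative (\<lambda>h. pd True u (p, q) * fst (0::real, h) + pd False u (p, q) * snd (0::real, h))) (at q)"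
    by (rule has_derivative_compose[where f="\<lambda>t. (p, t)" and g=u])
       (use d in \<open>auto intro!: derivative_eq_intros\<close>)
  then show "((\<lambda>t. u (p, t)) has_real_derivative pd False u (p, q)) (at q)"
    by (simp add: has_field_derivative_def)
qed

section \<open>Integration over a centred square\<close>

definition square :: "real \<Rightarrow> (real \<times> real) set" where
  "square L = cbox (- L, - L) (L, L)"

lemma in_square: "x \<in> square L \<longleftrightarrow> \<bar>fst x\<bar> \<le> L \<and> \<bar>snd x\<bar> \<le> L"
  by (cases x) (auto simp: square_def)

lemma integrable_square: "continuous_on UNIV f \<Longrightarrow> (f :: _ \<Rightarrow> real) integrable_on square L"
  unfolding square_def by (rule integrable_continuous) (auto intro: continuous_on_subset)

lemma integral_square:
  assumes "continuous_on UNIV (f :: real \<times> real \<Rightarrow> real)"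
  shows "integral (square L) f = integral {-L..L} (\<lambda>x. integral {-L..L} (\<lambda>y. f (x, y)))"
    "integral (square L) f = integral {-L..L} (\<lambda>y. integral {-L..L} (\<lambda>x. f (x, y)))"
proof -
  have c: "continuous_on (cbox (-L, -L) (L, L)) f" using assms by (rule continuous_on_subset) auto
  show 1: "integral (square L) f = integral {-L..L} (\<lambda>x. integral {-L..L} (\<lambda>y. f (x, y)))"
    using integral_prod_continuous[OF c] by (simp add: square_def)
  have "continuous_on (cbox (-L, -L) (L, L)) (\<lambda>(x, y). f (x, y))" using c by simp
  from integral_swap_continuous[OF this]
  show "integral (square L) f = integral {-L..L} (\<lambda>y. integral {-L..L} (\<lambda>x. f (x, y)))"
    unfolding 1 by simp
qed

lemma integral_deriv_interval:
  assumes "\<And>t. (F has_real_derivative f t) (at t)" "0 \<le> L"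
  shows "integral {-L..L} f = F L - F (- L)"
  using fundamental_theorem_of_calculus[of "-L" L F f] assms
  by (metis (no_types, lifting) has_field_derivative_at_within has_real_derivative_iff_has_vector_derivative integral_unique neg_le_0_iff_le order_trans)

lemma integral_pd_eq_0:
  assumes d: "\<And>x. F differentiable (at x)" and c: "continuous_on UNIV (pd i F)" and L: "0 \<le> L"
    and z: "\<And>x. \<bar>fst x\<bar> = L \<or> \<bar>snd x\<bar> = L \<Longrightarrow> F x = 0"
  shows "integral (square L) (pd i F) = 0"
proof (cases i)
  case True
  have "integral {-L..L} (\<lambda>x. pd i F (x, y)) = 0" for y
    using integral_deriv_interval[OF differentiable_partial_derivatives(1)[OF d] L, of y] z L True by simp
  then show ?thesis using integral_square(2)[OF c] by simp
next
  case False
  have "integral {-L..L} (\<lambda>y. pd i F (x, y)) = 0" for x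
    using integral_deriv_interval[OF differentiable_partial_derivatives(2)[OF d] L, of x] z L False by simp
  then show ?thesis using integral_square(1)[OF c] by simp
qed

definition c1 :: "(real \<times> real \<Rightarrow> real) \<Rightarrow> bool" where
  "c1 u \<longleftrightarrow> (\<forall>x. u differentiable (at x)) \<and> (\<forall>i. continuous_on UNIV (pd i u))"

lemma c1_continuous: "c1 u \<Longrightarrow> continuous_on A u"
  unfolding c1_def by (meson differentiable_imp_continuous_within continuous_at_imp_continuous_on)

lemma trig_poly_c1: "trig_poly u \<Longrightarrow> c1 u"
  unfolding c1_def by (auto intro: trig_poly_differentiable trig_poly_continuous_on)

lemma integration_by_parts:
  assumes u: "c1 u" and v: "c1 v" and L: "0 \<le> L"
    and z: "\<And>x. \<bar>fst x\<bar> = L \<or> \<bar>snd x\<bar> = L \<Longrightarrow> v x = 0"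
  shows "integral (square L) (\<lambda>x. u x * pd i v x) = - integral (square L) (\<lambda>x. pd i u x * v x)"
proof -
  have d: "u differentiable (at x)" "v differentiable (at x)" for x using u v unfolding c1_def by blast+
  have p: "pd i (\<lambda>x. u x * v x) = (\<lambda>x. pd i u x * v x + u x * pd i v x)"
    using pd_mult[OF d] by auto
  have c: "continuous_on UNIV (\<lambda>x. pd i u x * v x)" "continuous_on UNIV (\<lambda>x. u x * pd i v x)"
  proof -
    have "continuous_on UNIV (pd i u)" "continuous_on UNIV (pd i v)" using u v unfolding c1_def by blast+
    then show "continuous_on UNIV (\<lambda>x. pd i u x * v x)" "continuous_on UNIV (\<lambda>x. u x * pd i v x)"
      using c1_continuous[OF u] c1_continuous[OF v] by (auto intro: continuous_on_mult)
  qed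
  have "integral (square L) (pd i (\<lambda>x. u x * v x)) = 0"
  proof (rule integral_pd_eq_0[OF differentiable_mult[OF d] _ L])
    show "continuous_on UNIV (pd i (\<lambda>x. u x * v x))" unfolding p by (intro continuous_on_add c)
  qed (use z in auto)
  then show ?thesis
    unfolding p using integral_add[OF c[THEN integrable_square], of L] by simp
qed

section \<open>Orthogonality of lattice waves on the square\<close>

definition fr :: "real \<Rightarrow> int \<times> int \<Rightarrow> real \<times> real" where
  "fr \<kappa> k = (\<kappa> * of_int (fst k), \<kappa> * of_int (snd k))"

lemma fr_inner: "fr \<kappa> k \<bullet> x = \<kappa> * of_int (fst k) * fst x + \<kappa> * of_int (snd k) * snd x"
  by (simp add: fr_def inner_prod_def)

lemma fr_add: "fr \<kappa> (k + l) = fr \<kappa> k + fr \<kappa> l" "fr \<kappa> (k - l) = fr \<kappa> k - fr \<kappa> l"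
  by (auto simp: fr_def algebra_simps)

lemma continuous_wave: "continuous_on A (\<lambda>x. cos (\<xi> \<bullet> x + c))" for \<xi> :: "real \<times> real"
  by (intro continuous_intros)

lemma integral_cos_period:
  assumes "0 < L" "d \<noteq> 0"
  shows "integral {-L..L} (\<lambda>t. cos (pi / L * of_int d * t + c)) = 0"
proof -
  define w where "w = pi / L * of_int d"
  have w: "w \<noteq> 0" "w * L = pi * of_int d" using assms by (auto simp: w_def)
  have "integral {-L..L} (\<lambda>t. cos (w * t + c)) = sin (w * L + c) / w - sin (w * (- L) + c) / w"
    by (rule integral_deriv_interval[where F="\<lambda>t. sin (w * t + c) / w"])
       (use w assms in \<open>auto intro!: derivative_eq_intros\<close>)
  also have "\<dots> = (sin (w * L + c) - sin (w * (- L) + c)) / w" by (simp add: diff_divide_distrib)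
  also have "sin (w * L + c) = sin (w * (- L) + c)"
  proof -
    have "sin (pi * of_int d) = (0::real)" using sin_times_pi_eq_0[of "of_int d"] by (simp add: mult.commute)
    then show ?thesis using w(2) by (simp add: sin_add sin_diff)
  qed
  finally show ?thesis by (simp add: w_def)
qed

lemma integral_wave:
  assumes L: "0 < L"
  shows "integral (square L) (\<lambda>x. cos (fr (pi / L) k \<bullet> x + c)) = (if k = 0 then 4 * L\<^sup>2 * cos c else 0)"
proof -
  have I: "integral (square L) (\<lambda>x. cos (fr (pi / L) k \<bullet> x + c)) =
     integral {-L..L} (\<lambda>x. integral {-L..L} (\<lambda>y. cos (pi / L * of_int (snd k) * y + (pi / L * of_int (fst k) * x + c))))"
    unfolding integral_square(1)[OF continuous_wave] by (simp add: fr_inner algebra_simps)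
  show ?thesis
  proof (cases "snd k = 0")
    case False
    then show ?thesis unfolding I using integral_cos_period[OF L False] by auto
  next
    case s: True
    have J: "integral (square L) (\<lambda>x. cos (fr (pi / L) k \<bullet> x + c)) =
      (2 * L) * integral {-L..L} (\<lambda>x. cos (pi / L * of_int (fst k) * x + c))"
      unfolding I s using L by simp
    show ?thesis
    proof (cases "fst k = 0")
      case True
      then show ?thesis unfolding J using s L by (auto simp: power2_eq_square prod_eq_iff)
    next
      case False
      then show ?thesis unfolding J using integral_cos_period[OF L False] by auto
    qed
  qed
qed

lemma cos_mult_cos: "cos a * cos b = (cos (a + b) + cos (a - b)) / (2::real)"
  by (simp add: cos_add cos_diff)

text \<open>Parseval with arbitrary phases. A real wave contains both k and -k, so it can correlate
  with the waves of index k and -k; bounding the cosines of the phases by 1 gives an inequality that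
  no longer depends on the phases.\<close>

lemma integral_wave_sum_square_le:
  assumes L: "0 < L" and fin: "finite A"
  shows "integral (square L) (\<lambda>x. (\<Sum>k\<in>A. cos (fr (pi / L) k \<bullet> x + \<psi> k))\<^sup>2) \<le> 4 * L\<^sup>2 * card A"
proof -
  let ?w = "\<lambda>k x. cos (fr (pi / L) k \<bullet> x + \<psi> k)"
  have le: "integral (square L) (\<lambda>x. ?w k x * ?w l x) \<le> 2 * L\<^sup>2 * ((if l = - k then 1 else 0) + (if l = k then 1 else 0))" for k l
  proof -
    have "(\<lambda>x. ?w k x * ?w l x) = (\<lambda>x. (cos (fr (pi / L) (k + l) \<bullet> x + (\<psi> k + \<psi> l)) + cos (fr (pi / L) (k - l) \<bullet> x + (\<psi> k - \<psi> l))) / 2)"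
      unfolding cos_mult_cos by (simp add: fr_add algebra_simps)
    then have "integral (square L) (\<lambda>x. ?w k x * ?w l x) =
       (integral (square L) (\<lambda>x. cos (fr (pi / L) (k + l) \<bullet> x + (\<psi> k + \<psi> l))) +
        integral (square L) (\<lambda>x. cos (fr (pi / L) (k - l) \<bullet> x + (\<psi> k - \<psi> l)))) / 2"
      using integral_add[OF integrable_square[OF continuous_wave] integrable_square[OF continuous_wave],
          of L "fr (pi / L) (k + l)" "\<psi> k + \<psi> l" "fr (pi / L) (k - l)" "\<psi> k - \<psi> l"]
      by simp
    also have "\<dots> = ((if k + l = 0 then 4 * L\<^sup>2 * cos (\<psi> k + \<psi> l) else 0) + (if k - l = 0 then 4 * L\<^sup>2 * cos (\<psi> k - \<psi> l) else 0)) / 2"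
      unfolding integral_wave[OF L] ..
    also have "\<dots> \<le> ((if k + l = 0 then 4 * L\<^sup>2 * 1 else 0) + (if k - l = 0 then 4 * L\<^sup>2 * 1 else 0)) / 2"
      using cos_le_one by (intro divide_right_mono add_mono) (auto simp: mult_left_le)
    also have "\<dots> = 2 * L\<^sup>2 * ((if l = - k then 1 else 0) + (if l = k then 1 else 0))"
      by (auto simp: add_eq_0_iff)
    finally show ?thesis .
  qed
  have int: "(\<lambda>x. ?w k x * ?w l x) integrable_on square L" for k l
    by (intro integrable_square continuous_intros)
  have "integral (square L) (\<lambda>x. (\<Sum>k\<in>A. ?w k x)\<^sup>2) = (\<Sum>k\<in>A. \<Sum>l\<in>A. integral (square L) (\<lambda>x. ?w k x * ?w l x))"
    using fin by (simp add: power2_eq_square sum_product integral_sum int integrable_sum)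
  also have "\<dots> \<le> (\<Sum>k\<in>A. \<Sum>l\<in>A. 2 * L\<^sup>2 * ((if l = - k then 1 else 0) + (if l = k then 1 else 0)))"
    by (intro sum_mono le)
  also have "\<dots> \<le> (\<Sum>k\<in>A. 2 * L\<^sup>2 * 2)"
  proof (rule sum_mono)
    fix k assume "k \<in> A"
    have "(\<Sum>l\<in>A. (if l = - k then 1 else 0) + (if l = k then 1 else 0 :: real)) \<le> 2"
      using fin by (simp add: sum.distrib)
    then have "2 * L\<^sup>2 * (\<Sum>l\<in>A. (if l = - k then 1 else 0) + (if l = k then 1 else 0 :: real)) \<le> 2 * L\<^sup>2 * 2"
      by (intro mult_left_mono) auto
    then show "(\<Sum>l\<in>A. 2 * L\<^sup>2 * ((if l = - k then 1 else 0) + (if l = k then 1 else 0))) \<le> 2 * L\<^sup>2 * 2"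
      by (simp only: sum_distrib_left)
  qed
  also have "\<dots> = 4 * L\<^sup>2 * card A" by simp
  finally show ?thesis .
qed

text \<open>Young's inequality for the conjugate exponents 3/2 and 3 with a free weight t. One
  summand suffices in each case: the first if s <= t sqrt y, the second otherwise.\<close>

lemma young_three_halves:
  fixes y s t :: real
  assumes "0 \<le> y" "0 \<le> s" "0 < t"
  shows "y * s \<le> t * y powr (3/2) + s ^ 3 / t\<^sup>2"
proof -
  have y: "y powr (3/2) = y * sqrt y"
  proof (cases "y = 0")
    case False
    then have "y powr (3/2) = y powr 1 * y powr (1/2)" using assms(1) by (simp only: powr_add[symmetric]) simp
    then show ?thesis using assms by (simp add: powr_half_sqrt)
  qed simp
  show ?thesis
  proof (cases "s \<le> t * sqrt y")
    case True
    then have "y * s \<le> y * (t * sqrt y)" using assms by (intro mult_left_mono) auto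
    moreover have "0 \<le> s ^ 3 / t\<^sup>2" using assms by simp
    ultimately show ?thesis by (simp add: y mult_ac)
  next
    case False
    then have "sqrt y \<le> s / t" using assms by (simp add: field_simps)
    then have "y \<le> (s / t)\<^sup>2" using assms by (metis real_sqrt_le_iff real_sqrt_unique divide_nonneg_pos less_imp_le real_sqrt_ge_zero sqrt_le_D)
    then have "y * s \<le> (s / t)\<^sup>2 * s" using assms by (intro mult_right_mono) auto
    also have "\<dots> = s ^ 3 / t\<^sup>2" by (simp add: power2_eq_square power3_eq_cube)
    finally show ?thesis using assms by (simp add: y add_increasing)
  qed
qed

lemma polar_nonneg: "\<exists>r\<ge>0. \<exists>a. x = r * cos a \<and> y = r * sin a" for x y :: real
proof -
  obtain r a where ra: "x = r * cos a" "y = r * sin a" using polar_Ex by blast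
  show ?thesis
  proof (cases "0 \<le> r")
    case True
    then show ?thesis using ra by blast
  next
    case False
    then show ?thesis using ra by (intro exI[of _ "- r"] conjI exI[of _ "a + pi"]) auto
  qed
qed

text \<open>The right-hand side as a density on the torus of side 2L. The 3/2-integrability drives
  the coefficient bounds, and mean zero is the solvability condition of the periodic Poisson
  equation.\<close>

locale torus_density =
  fixes L :: real and F :: "real \<times> real \<Rightarrow> real"
  assumes L: "0 < L" and F: "F absolutely_integrable_on square L"
    and F32: "(\<lambda>x. \<bar>F x\<bar> powr (3/2)) integrable_on square L"
    and F0: "integral (square L) F = 0"
begin

definition \<kappa> :: real where "\<kappa> = pi / L"

lemma kappa_pos: "0 < \<kappa>" using L by (simp add: \<kappa>_def)

lemma integrable_F_mult:
  assumes "continuous_on UNIV g"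
  shows "(\<lambda>x. F x * g x) absolutely_integrable_on square L" "(\<lambda>x. F x * g x) integrable_on square L"
proof -
  have gc: "continuous_on (square L) g" using assms by (rule continuous_on_subset) auto
  have "(\<lambda>x. g x * F x) absolutely_integrable_on square L"
  proof (rule absolutely_integrable_bounded_measurable_product[OF bilinear_times _ _ _ F])
    show "g \<in> borel_measurable (lebesgue_on (square L))"
      by (rule continuous_imp_measurable_on_sets_lebesgue[OF gc]) (auto simp: square_def)
    show "square L \<in> sets lebesgue" by (auto simp: square_def)
    show "bounded (g ` square L)"
      by (rule compact_imp_bounded, rule compact_continuous_image[OF gc]) (simp add: square_def)
  qed
  then show 1: "(\<lambda>x. F x * g x) absolutely_integrable_on square L" by (simp add: mult.commute)
  then show "(\<lambda>x. F x * g x) integrable_on square L" by (rule set_lebesgue_integral_eq_integral)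
qed

text \<open>The phase of the Fourier coefficient is moved into the wave, so that the coefficient
  itself is a nonnegative number r. Then the sum of the moduli over a set of frequencies is a single
  integral of F against a sum of unit waves. The second formula says that r and \<psi> also describe
  the projection of F onto that frequency.\<close>

lemma coefficients_exist:
  "\<exists>r\<ge>0. \<exists>\<psi>. r = integral (square L) (\<lambda>y. F y * cos (fr \<kappa> k \<bullet> y + \<psi>)) \<and>
     (\<forall>x. integral (square L) (\<lambda>y. F y * cos (fr \<kappa> k \<bullet> (x - y))) = r * cos (fr \<kappa> k \<bullet> x + \<psi>))"
proof -
  define a where "a = integral (square L) (\<lambda>y. F y * cos (fr \<kappa> k \<bullet> y))"
  define b where "b = integral (square L) (\<lambda>y. F y * sin (fr \<kappa> k \<bullet> y))"
  have int: "(\<lambda>y. F y * cos (fr \<kappa> k \<bullet> y)) integrable_on square L" "(\<lambda>y. F y * sin (fr \<kappa> k \<bullet> y)) integrable_on square L"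
    by (intro integrable_F_mult continuous_intros)+
  have comb: "integral (square L) (\<lambda>y. p * (F y * cos (fr \<kappa> k \<bullet> y)) + q * (F y * sin (fr \<kappa> k \<bullet> y))) = p * a + q * b" for p q
    using integral_add[OF integrable_on_cmult_left[OF int(1), of p] integrable_on_cmult_left[OF int(2), of q]]
    by (simp add: a_def b_def)
  obtain r \<psi> where r: "0 \<le> r" "a = r * cos \<psi>" "- b = r * sin \<psi>" using polar_nonneg by blast
  have "integral (square L) (\<lambda>y. F y * cos (fr \<kappa> k \<bullet> y + \<psi>)) = cos \<psi> * a + (- sin \<psi>) * b"
    unfolding comb[symmetric] by (simp add: cos_add algebra_simps)
  also have "\<dots> = cos \<psi> * a + sin \<psi> * (- b)" by simp
  also have "\<dots> = r * ((cos \<psi>)\<^sup>2 + (sin \<psi>)\<^sup>2)" unfolding r(2,3) by (simp only: distrib_left power2_eq_square mult_ac)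
  finally have 1: "r = integral (square L) (\<lambda>y. F y * cos (fr \<kappa> k \<bullet> y + \<psi>))" by simp
  have "integral (square L) (\<lambda>y. F y * cos (fr \<kappa> k \<bullet> (x - y))) = cos (fr \<kappa> k \<bullet> x) * a + sin (fr \<kappa> k \<bullet> x) * b" for x
    unfolding comb[symmetric] by (simp add: inner_diff_right cos_diff algebra_simps)
  also have "cos (fr \<kappa> k \<bullet> x) * a + sin (fr \<kappa> k \<bullet> x) * b = r * cos (fr \<kappa> k \<bullet> x + \<psi>)" for x
  proof -
    have b: "b = - (r * sin \<psi>)" using r(3) by simp
    show ?thesis unfolding b r(2) by (simp add: cos_add algebra_simps)
  qed
  finally show ?thesis using r(1) 1 by blast
qed

definition amp :: "int \<times> int \<Rightarrow> real \<times> real" where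
  "amp k = (SOME p. 0 \<le> fst p \<and> fst p = integral (square L) (\<lambda>y. F y * cos (fr \<kappa> k \<bullet> y + snd p)) \<and>
     (\<forall>x. integral (square L) (\<lambda>y. F y * cos (fr \<kappa> k \<bullet> (x - y))) = fst p * cos (fr \<kappa> k \<bullet> x + snd p)))"

definition r :: "int \<times> int \<Rightarrow> real" where "r k = fst (amp k)"
definition \<psi> :: "int \<times> int \<Rightarrow> real" where "\<psi> k = snd (amp k)"

lemma r_psi:
  "0 \<le> r k" "r k = integral (square L) (\<lambda>y. F y * cos (fr \<kappa> k \<bullet> y + \<psi> k))"
  "integral (square L) (\<lambda>y. F y * cos (fr \<kappa> k \<bullet> (x - y))) = r k * cos (fr \<kappa> k \<bullet> x + \<psi> k)"
proof -
  obtain p q where "0 \<le> p \<and> p = integral (square L) (\<lambda>y. F y * cos (fr \<kappa> k \<bullet> y + q)) \<and>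
     (\<forall>x. integral (square L) (\<lambda>y. F y * cos (fr \<kappa> k \<bullet> (x - y))) = p * cos (fr \<kappa> k \<bullet> x + q))"
    using coefficients_exist[of k] by blast
  then have "\<exists>p. 0 \<le> fst p \<and> fst p = integral (square L) (\<lambda>y. F y * cos (fr \<kappa> k \<bullet> y + snd p)) \<and>
     (\<forall>x. integral (square L) (\<lambda>y. F y * cos (fr \<kappa> k \<bullet> (x - y))) = fst p * cos (fr \<kappa> k \<bullet> x + snd p))"
    by (intro exI[of _ "(p, q)"]) simp
  from someI_ex[OF this]
  show "0 \<le> r k" "r k = integral (square L) (\<lambda>y. F y * cos (fr \<kappa> k \<bullet> y + \<psi> k))"
    "integral (square L) (\<lambda>y. F y * cos (fr \<kappa> k \<bullet> (x - y))) = r k * cos (fr \<kappa> k \<bullet> x + \<psi> k)"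
    unfolding r_def \<psi>_def amp_def by blast+
qed

text \<open>The two contributions of Young's inequality after balancing: the 3/2-integral of F and
  the Parseval constant \<open>4 * L\<^sup>2\<close>.\<close>

definition I32 :: real where "I32 = integral (square L) (\<lambda>x. \<bar>F x\<bar> powr (3/2)) + 4 * L\<^sup>2"

lemma I32_nonneg: "0 \<le> I32"
  unfolding I32_def by (intro add_nonneg_nonneg integral_nonneg F32) auto

text \<open>Duality: the sum equals the integral of F times S, where S is a sum of m unit waves.
  Young's inequality leaves the cube of |S|, which is at most m S^2, and Parseval bounds the
  integral of S^2 by a multiple of m. The weight t = m^(2/3) satisfies m^2 = t^3 and makes the two
  parts equally large.\<close>

lemma sum_r_le:
  assumes fin: "finite A"
  shows "(\<Sum>k\<in>A. r k) \<le> real (card A) powr (2/3) * I32"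
proof (cases "A = {}")
  case False
  define m where "m = real (card A)"
  have m: "1 \<le> m" using False fin by (simp add: m_def card_gt_0_iff Suc_le_eq)
  define S where "S = (\<lambda>x. \<Sum>k\<in>A. cos (fr \<kappa> k \<bullet> x + \<psi> k))"
  define t where "t = m powr (2/3)"
  have t: "0 < t" using m by (simp add: t_def)
  have Sm: "\<bar>S x\<bar> \<le> m" for x
  proof -
    have "\<bar>S x\<bar> \<le> (\<Sum>k\<in>A. \<bar>cos (fr \<kappa> k \<bullet> x + \<psi> k)\<bar>)" unfolding S_def by (rule sum_abs)
    also have "\<dots> \<le> (\<Sum>k\<in>A. 1)" by (intro sum_mono) auto
    finally show ?thesis by (simp add: m_def)
  qed
  have Sc: "continuous_on UNIV S" unfolding S_def by (intro continuous_intros)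
  have point: "F x * S x \<le> t * \<bar>F x\<bar> powr (3/2) + (m / t\<^sup>2) * (S x)\<^sup>2" for x
  proof -
    have "F x * S x \<le> \<bar>F x\<bar> * \<bar>S x\<bar>" by (metis abs_ge_self abs_mult)
    also have "\<dots> \<le> t * \<bar>F x\<bar> powr (3/2) + \<bar>S x\<bar> ^ 3 / t\<^sup>2" by (rule young_three_halves) (use t in auto)
    also have "\<bar>S x\<bar> ^ 3 = \<bar>S x\<bar> * (S x)\<^sup>2" by (simp add: power3_eq_cube power2_eq_square)
    also have "\<bar>S x\<bar> * (S x)\<^sup>2 / t\<^sup>2 \<le> m * (S x)\<^sup>2 / t\<^sup>2"
      using Sm by (intro divide_right_mono mult_right_mono) auto
    finally show ?thesis by simp
  qed
  have i2: "(\<lambda>x. (m / t\<^sup>2) * (S x)\<^sup>2) integrable_on square L"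
    by (intro integrable_square continuous_intros Sc)
  have i1: "(\<lambda>x. t * \<bar>F x\<bar> powr (3/2)) integrable_on square L"
    using integrable_on_cmult_left[OF F32, of t] by simp
  have "(\<Sum>k\<in>A. r k) = integral (square L) (\<lambda>x. F x * S x)"
    unfolding S_def sum_distrib_left r_psi(2)
    by (rule integral_sum[symmetric, OF fin]) (intro integrable_F_mult continuous_wave)
  also have "\<dots> \<le> integral (square L) (\<lambda>x. t * \<bar>F x\<bar> powr (3/2) + (m / t\<^sup>2) * (S x)\<^sup>2)"
    by (rule integral_le[OF integrable_F_mult(2)[OF Sc] integrable_add[OF i1 i2] point])
  also have "\<dots> = t * integral (square L) (\<lambda>x. \<bar>F x\<bar> powr (3/2)) + (m / t\<^sup>2) * integral (square L) (\<lambda>x. (S x)\<^sup>2)"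
    using integral_add[OF i1 i2] by simp
  also have "\<dots> \<le> t * integral (square L) (\<lambda>x. \<bar>F x\<bar> powr (3/2)) + (m / t\<^sup>2) * (4 * L\<^sup>2 * m)"
    using integral_wave_sum_square_le[OF L fin, of \<psi>] m t unfolding S_def \<kappa>_def m_def
    by (intro add_left_mono mult_left_mono) auto
  also have "(m / t\<^sup>2) * (4 * L\<^sup>2 * m) = t * (4 * L\<^sup>2)"
  proof -
    have "m * m = t ^ 3" using m unfolding t_def by (simp add: powr_powr flip: powr_numeral) (simp add: power2_eq_square powr_numeral)
    then have "m * m / t\<^sup>2 = t" using t by (simp add: power2_eq_square power3_eq_cube)
    then have "(m * m / t\<^sup>2) * (4 * L\<^sup>2) = t * (4 * L\<^sup>2)" by simp
    then show ?thesis by (simp add: mult_ac)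
  qed
  finally show ?thesis by (simp add: I32_def t_def m_def algebra_simps)
qed simp

section \<open>Counting frequencies and the dyadic tail bound\<close>

definition freqs :: "real \<Rightarrow> (int \<times> int) set" where
  "freqs N = {k. norm (fr \<kappa> k) \<le> N}"

definition C0 :: real where "C0 = (2 / \<kappa> + 1)\<^sup>2"

lemma freqs_finite_card: "finite (freqs N)" "1 \<le> N \<Longrightarrow> real (card (freqs N)) \<le> C0 * N\<^sup>2"
proof -
  define n where "n = \<lfloor>N / \<kappa>\<rfloor>"
  have sub: "freqs N \<subseteq> {-n..n} \<times> {-n..n}"
  proof
    fix k assume k: "k \<in> freqs N"
    have "\<bar>of_int (f k)\<bar> \<le> N / \<kappa>" if "\<bar>\<kappa> * of_int (f k)\<bar> \<le> norm (fr \<kappa> k)" for f :: "int \<times> int \<Rightarrow> int"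
      using that k kappa_pos by (simp add: freqs_def abs_mult field_simps)
    from this[of fst] this[of snd]
    have "\<bar>of_int (fst k)\<bar> \<le> N / \<kappa>" "\<bar>of_int (snd k)\<bar> \<le> N / \<kappa>"
      using abs_co_le[of True "fr \<kappa> k"] abs_co_le[of False "fr \<kappa> k"] by (auto simp: fr_def)
    then have "\<bar>fst k\<bar> \<le> n" "\<bar>snd k\<bar> \<le> n" unfolding n_def by linarith+
    then show "k \<in> {-n..n} \<times> {-n..n}" by (cases k) auto
  qed
  then show "finite (freqs N)" by (rule finite_subset) auto
  assume N: "1 \<le> N"
  then have n: "0 \<le> n" using kappa_pos by (simp add: n_def)
  have "card (freqs N) \<le> card ({-n..n} \<times> {-n..n})" by (rule card_mono[OF _ sub]) auto
  also have "real \<dots> = (2 * of_int n + 1)\<^sup>2" using n by (simp add: card_cartesian_product power2_eq_square)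
  finally have "real (card (freqs N)) \<le> (2 * of_int n + 1)\<^sup>2" by simp
  also have "\<dots> \<le> (2 * (N / \<kappa>) + N)\<^sup>2"
  proof (rule power_mono)
    show "2 * of_int n + 1 \<le> 2 * (N / \<kappa>) + N" using N of_int_floor_le[of "N / \<kappa>"] unfolding n_def by linarith
  qed (use n in auto)
  also have "\<dots> = C0 * N\<^sup>2" unfolding C0_def by (simp add: power2_eq_square algebra_simps)
  finally show "real (card (freqs N)) \<le> C0 * N\<^sup>2" .
qed

text \<open>For \<open>k = 0\<close> the quotient is \<open>0\<close>, which is the right value because \<open>r 0 = 0\<close>.\<close>

definition a :: "int \<times> int \<Rightarrow> real" where "a k = r k / (4 * L\<^sup>2 * (norm (fr \<kappa> k))\<^sup>2)"

lemma a_nonneg: "0 \<le> a k" using r_psi(1) by (simp add: a_def)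

definition C1 :: real where "C1 = (4 * C0) powr (2/3) * I32 / (4 * L\<^sup>2)"

text \<open>A dyadic block has O(N^2) frequencies, so its coefficients sum to O(N^(4/3)); dividing
  by |\<xi>|^2 >= N^2 leaves N^(-2/3).\<close>

lemma block_sum_le:
  assumes N: "1 \<le> N"
  shows "(\<Sum>k\<in>freqs (2 * N) - freqs N. a k) \<le> C1 * N powr (-2/3)"
proof -
  let ?B = "freqs (2 * N) - freqs N"
  have "(\<Sum>k\<in>?B. a k) \<le> (\<Sum>k\<in>?B. r k / (4 * L\<^sup>2 * N\<^sup>2))"
  proof (rule sum_mono)
    fix k assume "k \<in> ?B"
    then have "N\<^sup>2 \<le> (norm (fr \<kappa> k))\<^sup>2" using N by (intro power_mono) (auto simp: freqs_def)
    then show "a k \<le> r k / (4 * L\<^sup>2 * N\<^sup>2)"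
      unfolding a_def using N L r_psi(1) by (intro divide_left_mono mult_left_mono mult_pos_pos) auto
  qed
  also have "\<dots> = (\<Sum>k\<in>?B. r k) / (4 * L\<^sup>2 * N\<^sup>2)" by (simp add: sum_divide_distrib)
  also have "\<dots> \<le> (real (card ?B) powr (2/3) * I32) / (4 * L\<^sup>2 * N\<^sup>2)"
    using freqs_finite_card(1) by (intro divide_right_mono sum_r_le) auto
  also have "\<dots> \<le> ((C0 * (2 * N)\<^sup>2) powr (2/3) * I32) / (4 * L\<^sup>2 * N\<^sup>2)"
  proof -
    have "real (card ?B) \<le> real (card (freqs (2 * N)))" by (intro of_nat_mono card_mono freqs_finite_card(1)) auto
    also have "\<dots> \<le> C0 * (2 * N)\<^sup>2" using N by (intro freqs_finite_card) auto
    finally show ?thesis using I32_nonneg by (intro divide_right_mono mult_right_mono powr_mono2) auto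
  qed
  also have "\<dots> = C1 * N powr (-2/3)"
  proof -
    have "(C0 * (2 * N)\<^sup>2) powr (2/3) = (4 * C0) powr (2/3) * (N\<^sup>2) powr (2/3)"
      using N by (simp add: C0_def power_mult_distrib mult_ac flip: powr_mult)
    also have "(N\<^sup>2) powr (2/3) = N powr (-2/3) * N\<^sup>2"
      using N by (simp add: powr_powr powr_add[symmetric] flip: powr_numeral)
    finally show ?thesis using N by (simp add: C1_def)
  qed
  finally show ?thesis .
qed

text \<open>The sum of the geometric series of block bounds, whose ratio is 2^(-2/3).\<close>

definition G1 :: real where "G1 = C1 / (1 - 2 powr (-2/3))"

lemma C1_nonneg: "0 \<le> C1" using I32_nonneg by (simp add: C1_def)

lemma two_powr: "2 powr (-2/3) < (1::real)"
  using powr_less_mono[of "-2/3" 0 "2::real"] by simp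

lemma freqs_mono: "N \<le> N' \<Longrightarrow> freqs N \<subseteq> freqs N'" by (auto simp: freqs_def)

lemma dyadic_tail_le:
  "1 \<le> N \<Longrightarrow> (\<Sum>k\<in>freqs (2 ^ j * N) - freqs N. a k) \<le> G1 * N powr (-2/3)"
proof (induction j arbitrary: N)
  case 0
  then show ?case using C1_nonneg two_powr by (simp add: G1_def)
next
  case (Suc j)
  have "freqs (2 ^ Suc j * N) - freqs N \<subseteq> (freqs (2 * N) - freqs N) \<union> (freqs (2 ^ j * (2 * N)) - freqs (2 * N))"
    by (auto simp: mult_ac)
  then have "(\<Sum>k\<in>freqs (2 ^ Suc j * N) - freqs N. a k) \<le> (\<Sum>k\<in>(freqs (2 * N) - freqs N) \<union> (freqs (2 ^ j * (2 * N)) - freqs (2 * N)). a k)"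
    by (intro sum_mono2) (auto simp: freqs_finite_card a_nonneg)
  also have "\<dots> = (\<Sum>k\<in>freqs (2 * N) - freqs N. a k) + (\<Sum>k\<in>freqs (2 ^ j * (2 * N)) - freqs (2 * N). a k)"
    by (rule sum.union_disjoint) (auto simp: freqs_finite_card)
  also have "\<dots> \<le> C1 * N powr (-2/3) + G1 * (2 * N) powr (-2/3)"
    using Suc.prems by (intro add_mono block_sum_le Suc.IH) auto
  also have "\<dots> = G1 * N powr (-2/3)"
  proof -
    have "C1 = G1 * (1 - 2 powr (-2/3))" using two_powr by (simp add: G1_def)
    moreover have "(2 * N) powr (-2/3) = 2 powr (-2/3) * N powr (-2/3)"
      using Suc.prems by (simp add: powr_mult)
    ultimately have "C1 * N powr (-2/3) + G1 * (2 * N) powr (-2/3)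
       = (G1 * (1 - 2 powr (-2/3))) * N powr (-2/3) + G1 * (2 powr (-2/3) * N powr (-2/3))" by simp
    then show ?thesis by (simp add: algebra_simps)
  qed
  finally show ?case .
qed

lemma tail_le:
  assumes "1 \<le> N"
  shows "(\<Sum>k\<in>freqs N' - freqs N. a k) \<le> G1 * N powr (-2/3)"
proof -
  obtain j :: nat where j: "N' < 2 ^ j" using real_arch_pow[of 2 N'] by auto
  have "(2::real) ^ j * 1 \<le> 2 ^ j * N" using assms by (intro mult_left_mono) auto
  then have "freqs N' \<subseteq> freqs (2 ^ j * N)" using j by (intro freqs_mono) linarith
  then have "(\<Sum>k\<in>freqs N' - freqs N. a k) \<le> (\<Sum>k\<in>freqs (2 ^ j * N) - freqs N. a k)"
    by (intro sum_mono2) (auto simp: freqs_finite_card a_nonneg)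
  also have "\<dots> \<le> G1 * N powr (-2/3)" by (rule dyadic_tail_le[OF assms])
  finally show ?thesis .
qed

definition G :: real where "G = (\<Sum>k\<in>freqs 1. a k) + G1"

lemma G1_le_G: "G1 \<le> G" unfolding G_def by (simp add: sum_nonneg a_nonneg)

lemma sum_a_le: "(\<Sum>k\<in>freqs N. a k) \<le> G"
proof -
  have "(\<Sum>k\<in>freqs N. a k) \<le> (\<Sum>k\<in>freqs 1 \<union> (freqs N - freqs 1). a k)"
    by (intro sum_mono2) (auto simp: freqs_finite_card a_nonneg)
  also have "\<dots> = (\<Sum>k\<in>freqs 1. a k) + (\<Sum>k\<in>freqs N - freqs 1. a k)"
    by (rule sum.union_disjoint) (auto simp: freqs_finite_card)
  also have "\<dots> \<le> G" unfolding G_def using tail_le[of 1 N] by simp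
  finally show ?thesis .
qed

text \<open>The minus sign makes the Laplacian of the wave the corresponding term of the Fourier
  series of F. Summation runs over k and -k alike, which matches the normalization by the full area
  of the square.\<close>

definition wave :: "int \<times> int \<Rightarrow> real \<times> real \<Rightarrow> real" where
  "wave k x = - a k * cos (fr \<kappa> k \<bullet> x + \<psi> k)"

definition g :: "real \<Rightarrow> real \<times> real \<Rightarrow> real" where
  "g N x = (\<Sum>k\<in>freqs N. wave k x)"

lemma wiener_wave_sum:
  assumes "A \<subseteq> freqs N"
  shows "wiener (cball 0 N) (\<Sum>k\<in>A. a k) (\<lambda>x. \<Sum>k\<in>A. wave k x)"
proof (rule wiener_sum)
  show "finite A" using assms freqs_finite_card(1) by (rule finite_subset)
  show "wiener (cball 0 N) (a k) (wave k)" if "k \<in> A" for k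
    using wiener_wave[of "fr \<kappa> k" "cball 0 N" "- a k" "\<psi> k"] that assms a_nonneg[of k]
    by (auto simp: wave_def[abs_def] freqs_def)
qed

lemma lowpass_g: "lowpass g G"
  unfolding lowpass_def
proof (intro conjI allI impI)
  fix N :: real
  show "wiener (cball 0 N) G (g N)"
    using wiener_mono[OF wiener_wave_sum[OF order_refl] order_refl sum_a_le] by (simp add: g_def[abs_def])
next
  fix N N' :: real assume N: "1 \<le> N" "N \<le> N'"
  have "G1 * N powr (-2/3) \<le> G * N powr (-2/3)" using G1_le_G by (intro mult_right_mono) auto
  with tail_le[OF N(1), of N'] have "(\<Sum>k\<in>freqs N' - freqs N. a k) \<le> G * N powr (-2/3)" by linarith
  from wiener_mono[OF wiener_wave_sum order_refl this]
  have "wiener (cball 0 N') (G * N powr (-2/3)) (\<lambda>x. \<Sum>k\<in>freqs N' - freqs N. wave k x)" by auto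
  moreover have "(\<Sum>k\<in>freqs N' - freqs N. wave k x) = g N' x - g N x" for x
    unfolding g_def using freqs_mono[OF N(2)] by (intro sum_diff freqs_finite_card) auto
  ultimately show "wiener (cball 0 N') (G * N powr (-2/3)) (\<lambda>x. g N' x - g N x)" by simp
qed

end

section \<open>Fejer means\<close>

text \<open>Dominated convergence for an absolutely convergent series with weights tending to 1. It
  is used with the indicator of a ball and with Fejer weights, and so identifies the two
  limits.\<close>

lemma weighted_sum_limit:
  fixes b :: "'k \<Rightarrow> real"
  assumes bound: "\<And>A. finite A \<Longrightarrow> (\<Sum>k\<in>A. \<bar>b k\<bar>) \<le> C"
    and w: "\<And>n k. \<bar>w n k\<bar> \<le> 1" "\<And>k. ((\<lambda>n. w n k) \<longlongrightarrow> 1) Fl"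
    and A: "\<And>n. finite (A n)" "\<And>n k. k \<notin> A n \<Longrightarrow> w n k = 0"
  shows "((\<lambda>n. \<Sum>k\<in>A n. w n k * b k) \<longlongrightarrow> infsum b UNIV) Fl"
proof (rule tendstoI)
  fix e :: real assume e: "0 < e"
  have sa: "(\<lambda>k. norm (b k)) summable_on UNIV"
    by (rule nonneg_bounded_partial_sums_imp_summable_on[of _ _ C])
       (use bound in \<open>auto intro!: eventually_finite_subsets_at_top_weakI\<close>)
  have "(b has_sum infsum b UNIV) UNIV"
    by (rule has_sum_infsum[OF abs_summable_summable[OF sa]])
  then have "\<forall>\<^sub>F X in finite_subsets_at_top UNIV. dist (sum b X) (infsum b UNIV) < e/3"
    using e unfolding has_sum_def by (intro tendstoD) auto
  then obtain B1 where "finite B1" and "\<forall>X. finite X \<and> B1 \<subseteq> X \<and> X \<subseteq> UNIV \<longrightarrow> dist (sum b X) (infsum b UNIV) < e/3"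
    unfolding eventually_finite_subsets_at_top by auto
  then have B1: "finite B1" "\<And>X. finite X \<Longrightarrow> B1 \<subseteq> X \<Longrightarrow> dist (sum b X) (infsum b UNIV) < e/3" by simp_all
  define S where "S = infsum (\<lambda>k. norm (b k)) UNIV"
  have hs: "((\<lambda>k. norm (b k)) has_sum S) UNIV" using sa unfolding S_def by (rule has_sum_infsum)
  then have "\<forall>\<^sub>F X in finite_subsets_at_top UNIV. dist (\<Sum>k\<in>X. norm (b k)) S < e/3"
    using e unfolding has_sum_def by (intro tendstoD) auto
  then obtain B2 where "finite B2" and "\<forall>X. finite X \<and> B2 \<subseteq> X \<and> X \<subseteq> UNIV \<longrightarrow> dist (\<Sum>k\<in>X. norm (b k)) S < e/3"
    unfolding eventually_finite_subsets_at_top by auto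
  then have B2: "finite B2" "\<And>X. finite X \<Longrightarrow> B2 \<subseteq> X \<Longrightarrow> dist (\<Sum>k\<in>X. norm (b k)) S < e/3" by simp_all
  have leS: "(\<Sum>k\<in>X. norm (b k)) \<le> S" if "finite X" for X
    unfolding S_def using that by (intro finite_sum_le_infsum sa) auto
  define B where "B = B1 \<union> B2"
  have B: "finite B" "B1 \<subseteq> B" "B2 \<subseteq> B" using B1 B2 by (auto simp: B_def)
  have tail: "(\<Sum>k\<in>X. norm (b k)) < e/3" if "finite X" "X \<inter> B = {}" for X
  proof -
    have "(\<Sum>k\<in>B \<union> X. norm (b k)) = (\<Sum>k\<in>B. norm (b k)) + (\<Sum>k\<in>X. norm (b k))"
      using that B(1) by (intro sum.union_disjoint) auto
    moreover have "dist (\<Sum>k\<in>B. norm (b k)) S < e/3" using B2(2) B by blast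
    moreover have "(\<Sum>k\<in>B \<union> X. norm (b k)) \<le> S" using that B(1) by (intro leS) auto
    ultimately show ?thesis unfolding dist_real_def by linarith
  qed
  have "((\<lambda>n. \<Sum>k\<in>B. w n k * b k) \<longlongrightarrow> (\<Sum>k\<in>B. 1 * b k)) Fl"
    by (intro tendsto_sum tendsto_mult w(2) tendsto_const)
  then have "\<forall>\<^sub>F n in Fl. dist (\<Sum>k\<in>B. w n k * b k) (\<Sum>k\<in>B. 1 * b k) < e/3"
    using e by (intro tendstoD) auto
  then show "\<forall>\<^sub>F n in Fl. dist (\<Sum>k\<in>A n. w n k * b k) (infsum b UNIV) < e"
  proof eventually_elim
    case (elim n)
    have "(\<Sum>k\<in>A n. w n k * b k) = (\<Sum>k\<in>B \<union> (A n - B). w n k * b k)"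
      by (rule sum.mono_neutral_left) (use A B in auto)
    also have "\<dots> = (\<Sum>k\<in>B. w n k * b k) + (\<Sum>k\<in>A n - B. w n k * b k)"
      by (rule sum.union_disjoint) (use A B in auto)
    finally have 1: "(\<Sum>k\<in>A n. w n k * b k) = (\<Sum>k\<in>B. w n k * b k) + (\<Sum>k\<in>A n - B. w n k * b k)" .
    have "\<bar>\<Sum>k\<in>A n - B. w n k * b k\<bar> \<le> (\<Sum>k\<in>A n - B. \<bar>w n k * b k\<bar>)" by (rule sum_abs)
    also have "\<dots> \<le> (\<Sum>k\<in>A n - B. norm (b k))"
      using w(1) by (intro sum_mono) (auto simp: abs_mult intro: mult_left_le_one_le)
    also have "\<dots> < e/3" using A by (intro tail) auto
    finally have "\<bar>\<Sum>k\<in>A n - B. w n k * b k\<bar> < e/3" .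
    moreover have "dist (sum b B) (infsum b UNIV) < e/3" using B1(2) B by blast
    moreover have "\<bar>(\<Sum>k\<in>B. w n k * b k) - sum b B\<bar> < e/3" using elim by (simp add: dist_real_def)
    ultimately show ?case unfolding 1 dist_real_def by linarith
  qed
qed

text \<open>Fejer weights are encoded by counting pairs (j, l) with prescribed difference instead of
  by the formula 1 - |d|/M. Sums over pairs factor as squares, from which positivity of the kernel
  is immediate.\<close>

definition pair_diff :: "nat \<times> nat \<Rightarrow> int" where "pair_diff p = int (fst p) - int (snd p)"

definition index_pairs :: "nat \<Rightarrow> (nat \<times> nat) set" where "index_pairs M = {..<M} \<times> {..<M}"

definition fejer_weight :: "nat \<Rightarrow> int \<Rightarrow> real" where
  "fejer_weight M d = real (card {p \<in> index_pairs M. pair_diff p = d}) / real M"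

lemma finite_index_pairs [simp]: "finite (index_pairs M)" by (simp add: index_pairs_def)

lemma fejer_weight_le: "0 \<le> fejer_weight M d" "fejer_weight M d \<le> 1"
proof -
  show "0 \<le> fejer_weight M d" by (simp add: fejer_weight_def)
  have "inj_on snd {p \<in> index_pairs M. pair_diff p = d}" by (auto simp: inj_on_def pair_diff_def)
  then have "card {p \<in> index_pairs M. pair_diff p = d} \<le> card {..<M}"
    by (intro card_inj_on_le[of snd]) (auto simp: index_pairs_def)
  then show "fejer_weight M d \<le> 1" by (auto simp: fejer_weight_def divide_le_eq)
qed

lemma fejer_weight_ge:
  assumes "1 \<le> M"
  shows "1 - real (nat \<bar>d\<bar>) / real M \<le> fejer_weight M d"
proof (cases "nat \<bar>d\<bar> < M")
  case True
  have "card {..<M - nat \<bar>d\<bar>} \<le> card {p \<in> index_pairs M. pair_diff p = d}"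
    by (rule card_inj_on_le[where f="\<lambda>j. (j + nat d, j + nat (- d))"])
       (use True in \<open>auto simp: inj_on_def index_pairs_def pair_diff_def\<close>)
  then have "real M - real (nat \<bar>d\<bar>) \<le> real (card {p \<in> index_pairs M. pair_diff p = d})" using True by simp
  then have "(real M - real (nat \<bar>d\<bar>)) / real M \<le> fejer_weight M d"
    unfolding fejer_weight_def by (intro divide_right_mono) auto
  then show ?thesis using True by (simp add: diff_divide_distrib)
next
  case False
  then have "1 \<le> real (nat \<bar>d\<bar>) / real M" using assms by (simp add: le_divide_eq)
  then show ?thesis using fejer_weight_le(1)[of M d] by linarith
qed

lemma fejer_weight_tendsto: "(\<lambda>M. fejer_weight M d) \<longlonglongrightarrow> 1"
proof (rule tendsto_sandwich[where h="\<lambda>_. 1"])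
  show "\<forall>\<^sub>F M in sequentially. 1 - real (nat \<bar>d\<bar>) / real M \<le> fejer_weight M d"
    using eventually_ge_at_top[of 1] by eventually_elim (rule fejer_weight_ge)
  have "(\<lambda>M. 1 - real (nat \<bar>d\<bar>) / real M) \<longlonglongrightarrow> 1 - 0"
    by (intro tendsto_diff tendsto_const lim_const_over_n)
  then show "(\<lambda>M. 1 - real (nat \<bar>d\<bar>) / real M) \<longlonglongrightarrow> 1" by simp
qed (auto simp: fejer_weight_le)

lemma sum_pair_diff:
  fixes f :: "int \<Rightarrow> real"
  shows "(\<Sum>p\<in>index_pairs M. f (pair_diff p)) = real M * (\<Sum>d\<in>{- int M..int M}. fejer_weight M d * f d)"
proof (cases "M = 0")
  case False
  have "(\<Sum>p\<in>index_pairs M. f (pair_diff p)) = (\<Sum>d\<in>{- int M..int M}. \<Sum>p\<in>{p \<in> index_pairs M. pair_diff p = d}. f (pair_diff p))"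
    by (rule sum.group[symmetric]) (auto simp: index_pairs_def pair_diff_def)
  also have "\<dots> = (\<Sum>d\<in>{- int M..int M}. real (card {p \<in> index_pairs M. pair_diff p = d}) * f d)" by simp
  finally show ?thesis using False by (simp add: fejer_weight_def sum_distrib_left)
qed (simp add: index_pairs_def)

lemma fejer_mean_limit:
  fixes b :: "int \<times> int \<Rightarrow> real"
  assumes bound: "\<And>A. finite A \<Longrightarrow> (\<Sum>k\<in>A. \<bar>b k\<bar>) \<le> C"
  shows "(\<lambda>M. (\<Sum>p\<in>index_pairs M. \<Sum>q\<in>index_pairs M. b (pair_diff p, pair_diff q)) / (real M)\<^sup>2) \<longlonglongrightarrow> infsum b UNIV"
proof -
  let ?A = "\<lambda>M. {- int M..int M} \<times> {- int M..int M}"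
  let ?w = "\<lambda>M k. if k \<in> ?A M then fejer_weight M (fst k) * fejer_weight M (snd k) else 0"
  have lim: "(\<lambda>M. \<Sum>k\<in>?A M. ?w M k * b k) \<longlonglongrightarrow> infsum b UNIV"
  proof (rule weighted_sum_limit[OF bound])
    fix k :: "int \<times> int"
    show "\<bar>?w M k\<bar> \<le> 1" for M
      using fejer_weight_le by (auto simp: abs_mult intro!: mult_le_one)
    have "(\<lambda>M. fejer_weight M (fst k) * fejer_weight M (snd k)) \<longlonglongrightarrow> 1 * 1"
      by (intro tendsto_mult fejer_weight_tendsto)
    moreover have "\<forall>\<^sub>F M in sequentially. fejer_weight M (fst k) * fejer_weight M (snd k) = ?w M k"
      using eventually_ge_at_top[of "nat (max \<bar>fst k\<bar> \<bar>snd k\<bar>)"]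
      by eventually_elim (cases k, auto)
    ultimately show "(\<lambda>M. ?w M k) \<longlonglongrightarrow> 1"
      using Lim_transform_eventually by fastforce
  qed auto
  have eq: "(\<Sum>k\<in>?A M. ?w M k * b k) = (\<Sum>p\<in>index_pairs M. \<Sum>q\<in>index_pairs M. b (pair_diff p, pair_diff q)) / (real M)\<^sup>2" if "1 \<le> M" for M
  proof -
    have "(\<Sum>p\<in>index_pairs M. \<Sum>q\<in>index_pairs M. b (pair_diff p, pair_diff q)) =
       (\<Sum>p\<in>index_pairs M. real M * (\<Sum>d\<in>{- int M..int M}. fejer_weight M d * b (pair_diff p, d)))"
    proof (rule sum.cong[OF refl])
      fix p
      show "(\<Sum>q\<in>index_pairs M. b (pair_diff p, pair_diff q)) = real M * (\<Sum>d\<in>{- int M..int M}. fejer_weight M d * b (pair_diff p, d))"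
        by (rule sum_pair_diff[where f="\<lambda>e. b (pair_diff p, e)"])
    qed
    also have "\<dots> = real M * (\<Sum>d\<in>{- int M..int M}. fejer_weight M d *
         (real M * (\<Sum>d'\<in>{- int M..int M}. fejer_weight M d' * b (d, d'))))"
      by (rule sum_pair_diff[where f="\<lambda>e. real M * (\<Sum>d\<in>{- int M..int M}. fejer_weight M d * b (e, d))"])
    also have "\<dots> = (real M)\<^sup>2 * (\<Sum>d\<in>{- int M..int M}. \<Sum>d'\<in>{- int M..int M}. fejer_weight M d * fejer_weight M d' * b (d, d'))"
      by (simp add: sum_distrib_left power2_eq_square mult_ac)
    also have "(\<Sum>d\<in>{- int M..int M}. \<Sum>d'\<in>{- int M..int M}. fejer_weight M d * fejer_weight M d' * b (d, d'))
       = (\<Sum>k\<in>?A M. ?w M k * b k)"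
      unfolding sum.cartesian_product by (intro sum.cong) auto
    finally show ?thesis using that by simp
  qed
  have "\<forall>\<^sub>F M in sequentially. (\<Sum>k\<in>?A M. ?w M k * b k) = (\<Sum>p\<in>index_pairs M. \<Sum>q\<in>index_pairs M. b (pair_diff p, pair_diff q)) / (real M)\<^sup>2"
    using eventually_ge_at_top[of 1] by eventually_elim (rule eq)
  with lim show ?thesis by (rule Lim_transform_eventually)
qed

section \<open>The one-dimensional Fejer kernel\<close>

definition fejer1 :: "nat \<Rightarrow> real \<Rightarrow> real" where
  "fejer1 M \<theta> = (\<Sum>p\<in>index_pairs M. cos (of_int (pair_diff p) * \<theta>)) / real M"

lemma sum_index_pairs: "(\<Sum>p\<in>index_pairs M. f (fst p) (snd p)) = (\<Sum>j<M. \<Sum>l<M. f j l)"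
  unfolding index_pairs_def sum.cartesian_product by (simp add: case_prod_beta)

text \<open>The right-hand side is the squared modulus of the sum of exp(i j \<theta>) for j < M,
  divided by M and written with real functions.\<close>

lemma fejer1_square:
  "fejer1 M \<theta> = ((\<Sum>j<M. cos (real j * \<theta>))\<^sup>2 + (\<Sum>j<M. sin (real j * \<theta>))\<^sup>2) / real M"
proof -
  have "(\<Sum>p\<in>index_pairs M. cos (of_int (pair_diff p) * \<theta>)) =
     (\<Sum>p\<in>index_pairs M. cos (real (fst p) * \<theta>) * cos (real (snd p) * \<theta>) + sin (real (fst p) * \<theta>) * sin (real (snd p) * \<theta>))"
    by (simp add: pair_diff_def left_diff_distrib cos_diff)
  also have "\<dots> = (\<Sum>j<M. \<Sum>l<M. cos (real j * \<theta>) * cos (real l * \<theta>) + sin (real j * \<theta>) * sin (real l * \<theta>))"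
    by (rule sum_index_pairs)
  also have "\<dots> = (\<Sum>j<M. cos (real j * \<theta>))\<^sup>2 + (\<Sum>j<M. sin (real j * \<theta>))\<^sup>2"
    by (simp add: sum.distrib power2_eq_square sum_product)
  finally show ?thesis by (simp add: fejer1_def)
qed

lemma fejer1_nonneg: "0 \<le> fejer1 M \<theta>"
  unfolding fejer1_square by simp

text \<open>Exchanging the two indices changes the sign. Because of this the two-dimensional kernel,
  a sum of cosines of sums, is exactly a product of one-dimensional ones.\<close>

lemma sum_sin_pair_diff:
  fixes \<theta> :: real
  shows "(\<Sum>p\<in>index_pairs M. sin (of_int (pair_diff p) * \<theta>)) = 0"
proof -
  have "(\<Sum>p\<in>index_pairs M. sin (of_int (pair_diff p) * \<theta>)) =
     (\<Sum>p\<in>index_pairs M. sin (real (fst p) * \<theta>) * cos (real (snd p) * \<theta>) - cos (real (fst p) * \<theta>) * sin (real (snd p) * \<theta>))"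
    by (simp add: pair_diff_def left_diff_distrib sin_diff)
  also have "\<dots> = (\<Sum>j<M. \<Sum>l<M. sin (real j * \<theta>) * cos (real l * \<theta>) - cos (real j * \<theta>) * sin (real l * \<theta>))"
    by (rule sum_index_pairs)
  also have "\<dots> = (\<Sum>j<M. sin (real j * \<theta>)) * (\<Sum>j<M. cos (real j * \<theta>)) - (\<Sum>j<M. cos (real j * \<theta>)) * (\<Sum>j<M. sin (real j * \<theta>))"
    by (simp add: sum_subtractf sum_product)
  finally show ?thesis by simp
qed

lemma dirichlet_sums:
  fixes \<theta> :: real
  shows "2 * sin (\<theta> / 2) * (\<Sum>j<M. cos (real j * \<theta>)) = sin (real M * \<theta> - \<theta> / 2) + sin (\<theta> / 2)"
  "2 * sin (\<theta> / 2) * (\<Sum>j<M. sin (real j * \<theta>)) = cos (\<theta> / 2) - cos (real M * \<theta> - \<theta> / 2)"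
proof -
  have e: "real (Suc M) * \<theta> - \<theta> / 2 = real M * \<theta> + \<theta> / 2" for M by (simp add: field_simps)
  show "2 * sin (\<theta> / 2) * (\<Sum>j<M. cos (real j * \<theta>)) = sin (real M * \<theta> - \<theta> / 2) + sin (\<theta> / 2)"
  proof (induction M)
    case (Suc M)
    then show ?case unfolding e by (simp add: distrib_left sin_add sin_diff)
  qed simp
  show "2 * sin (\<theta> / 2) * (\<Sum>j<M. sin (real j * \<theta>)) = cos (\<theta> / 2) - cos (real M * \<theta> - \<theta> / 2)"
  proof (induction M)
    case (Suc M)
    then show ?case unfolding e by (simp add: distrib_left cos_add cos_diff)
  qed simp
qed

text \<open>Multiplying the geometric sum of exponentials by 2 sin(\<theta>/2) leaves a difference
  of two unit vectors, whose squared modulus is at most 4.\<close>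

lemma fejer1_decay: "fejer1 M \<theta> * (sin (\<theta> / 2))\<^sup>2 \<le> 1 / real M"
proof -
  let ?a = "real M * \<theta> - \<theta> / 2" and ?b = "\<theta> / 2"
  have "4 * ((sin ?b)\<^sup>2 * ((\<Sum>j<M. cos (real j * \<theta>))\<^sup>2 + (\<Sum>j<M. sin (real j * \<theta>))\<^sup>2)) =
      (2 * sin ?b * (\<Sum>j<M. cos (real j * \<theta>)))\<^sup>2 + (2 * sin ?b * (\<Sum>j<M. sin (real j * \<theta>)))\<^sup>2"
    by (simp add: power_mult_distrib algebra_simps)
  also have "\<dots> = (sin ?a + sin ?b)\<^sup>2 + (cos ?b - cos ?a)\<^sup>2" unfolding dirichlet_sums ..
  also have "\<dots> = ((sin ?a)\<^sup>2 + (cos ?a)\<^sup>2) + ((sin ?b)\<^sup>2 + (cos ?b)\<^sup>2) - 2 * (cos ?a * cos ?b - sin ?a * sin ?b)"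
  proof -
    have "(s + b)\<^sup>2 + (d - c)\<^sup>2 = (s\<^sup>2 + c\<^sup>2) + (b\<^sup>2 + d\<^sup>2) - 2 * (c * d - s * b)" for s b c d :: real
      by (simp add: power2_eq_square algebra_simps)
    then show ?thesis .
  qed
  also have "\<dots> = 2 - 2 * cos (?a + ?b)"
    unfolding sin_cos_squared_add cos_add[of ?a ?b] by simp
  also have "\<dots> \<le> 4" using cos_ge_minus_one[of "?a + ?b"] by linarith
  finally have "(sin ?b)\<^sup>2 * ((\<Sum>j<M. cos (real j * \<theta>))\<^sup>2 + (\<Sum>j<M. sin (real j * \<theta>))\<^sup>2) \<le> 1" by simp
  then show ?thesis unfolding fejer1_square by (simp add: divide_right_mono mult.commute)
qed

lemma sum_pair_diff_zero: "(\<Sum>p\<in>index_pairs M. if pair_diff p = 0 then 1 else 0 :: real) = real M"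
proof -
  have "(\<Sum>p\<in>index_pairs M. if pair_diff p = 0 then 1 else 0 :: real) = (\<Sum>p\<in>index_pairs M. if snd p = fst p then 1 else 0)"
    by (intro sum.cong) (auto simp: pair_diff_def)
  also have "\<dots> = (\<Sum>j<M. \<Sum>l<M. if l = j then 1 else 0)" by (rule sum_index_pairs)
  finally show ?thesis by simp
qed

section \<open>Moving derivatives onto compactly supported functions\<close>

lemma pd_eq_0_open:
  assumes "open U" "\<And>x. x \<in> U \<Longrightarrow> u x = 0" "x \<in> U"
  shows "pd i u x = 0"
proof -
  have "(u has_derivative (\<lambda>h. 0)) (at x)"
    by (rule has_derivative_transform_within_open[OF has_derivative_const assms(1,3)]) (use assms(2) in auto)
  then show ?thesis using pd_unique[where D="\<lambda>i. 0", of u x i] by simp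
qed

lemma pd_eq_0_outside:
  assumes "\<And>x. x \<notin> square l \<Longrightarrow> u x = 0" "x \<notin> square l"
  shows "pd i u x = 0"
proof (rule pd_eq_0_open)
  show "open (- square l)" by (simp add: square_def closed_cbox open_Compl)
qed (use assms in auto)

lemma boundary_not_in_square: "l < L \<Longrightarrow> \<bar>fst x\<bar> = L \<or> \<bar>snd x\<bar> = L \<Longrightarrow> x \<notin> square l"
  by (auto simp: in_square)

lemma integral_mult_pd2:
  assumes u: "trig_poly u" and \<phi>: "c1 \<phi>" "\<And>i. c1 (pd i \<phi>)" "\<And>x. x \<notin> square l \<Longrightarrow> \<phi> x = 0"
    and l: "0 \<le> L" "l < L"
  shows "integral (square L) (\<lambda>x. u x * pd i (pd j \<phi>) x) = integral (square L) (\<lambda>x. pd j (pd i u) x * \<phi> x)"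
proof -
  have z: "\<phi> x = 0" "pd j \<phi> x = 0" if "\<bar>fst x\<bar> = L \<or> \<bar>snd x\<bar> = L" for x
    using boundary_not_in_square[OF l(2) that] \<phi>(3) pd_eq_0_outside[OF \<phi>(3)] by auto
  have "integral (square L) (\<lambda>x. u x * pd i (pd j \<phi>) x) = - integral (square L) (\<lambda>x. pd i u x * pd j \<phi> x)"
    by (rule integration_by_parts[OF trig_poly_c1[OF u] \<phi>(2) l(1)]) (rule z(2))
  also have "integral (square L) (\<lambda>x. pd i u x * pd j \<phi> x) = - integral (square L) (\<lambda>x. pd j (pd i u) x * \<phi> x)"
    by (rule integration_by_parts[OF trig_poly_c1[OF trig_poly_pd[OF u]] \<phi>(1) l(1)]) (rule z(1))
  finally show ?thesis by simp
qed

lemma continuous_pd2: "c1 (pd j u) \<Longrightarrow> continuous_on UNIV (pd i (pd j u))"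
  by (simp add: c1_def)

lemma integral_mult_lap:
  assumes u: "trig_poly u" and \<phi>: "c1 \<phi>" "\<And>i. c1 (pd i \<phi>)" "\<And>x. x \<notin> square l \<Longrightarrow> \<phi> x = 0"
    and l: "0 \<le> L" "l < L"
  shows "integral (square L) (\<lambda>x. u x * lap \<phi> x) = integral (square L) (\<lambda>x. lap u x * \<phi> x)"
proof -
  have i1: "(\<lambda>x. u x * pd i (pd i \<phi>) x) integrable_on square L" for i
    using u by (intro integrable_square continuous_on_mult trig_poly_continuous_on continuous_pd2 \<phi>(2))
  have i2: "(\<lambda>x. pd i (pd i u) x * \<phi> x) integrable_on square L" for i
    using u by (intro integrable_square continuous_on_mult trig_poly_continuous_on c1_continuous \<phi>(1)) auto
  show ?thesis
    unfolding lap_def distrib_left distrib_right integral_add[OF i1 i1] integral_add[OF i2 i2]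
    by (simp add: integral_mult_pd2[OF u \<phi> l])
qed

text \<open>The half-angle sine vanishes at t = 0 and next at |t| = 2L. For |t| up to 3L/2 and
  \<eta> at most L/2 the minimum is attained at \<eta>, by reflection at the quarter period. The
  range 3L/2 is that of differences between a point of the square and a point of the square of half
  the size.\<close>

lemma sin_square_ge:
  assumes "0 < L" "0 < \<eta>" "\<eta> \<le> L / 2" "\<eta> \<le> \<bar>t\<bar>" "\<bar>t\<bar> \<le> 3 / 2 * L"
  shows "(sin (pi / L * \<eta> / 2))\<^sup>2 \<le> (sin (pi / L * t / 2))\<^sup>2"
proof -
  define x y where "x = pi / L * \<eta> / 2" and "y = pi / L * \<bar>t\<bar> / 2"
  have x: "0 < x" "x \<le> pi / 4" and y: "x \<le> y" "y \<le> 3 / 4 * pi"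
    using assms unfolding x_def y_def by (simp_all add: field_simps)
  have "sin x \<le> sin y"
  proof (cases "y \<le> pi / 2")
    case True
    then show ?thesis using x y by (intro sin_monotone_2pi_le) auto
  next
    case False
    then have "sin x \<le> sin (pi - y)" using x y by (intro sin_monotone_2pi_le) auto
    then show ?thesis by simp
  qed
  moreover have "0 \<le> sin x" using x by (intro sin_ge_zero) auto
  ultimately have "(sin x)\<^sup>2 \<le> (sin y)\<^sup>2" by (intro power_mono) auto
  moreover have "(sin y)\<^sup>2 = (sin (pi / L * t / 2))\<^sup>2"
    unfolding y_def by (cases "0 \<le> t") (auto simp: abs_if)
  ultimately show ?thesis by (simp add: x_def)
qed

section \<open>The two-dimensional Fejer kernel as an approximate identity\<close>

context torus_density
begin

definition K :: "nat \<Rightarrow> real \<times> real \<Rightarrow> real" where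
  "K M u = fejer1 M (\<kappa> * fst u) * fejer1 M (\<kappa> * snd u)"

lemma K_nonneg: "0 \<le> K M u" by (simp add: K_def fejer1_nonneg)

lemma K_eq: "K M u = (\<Sum>p\<in>index_pairs M. \<Sum>q\<in>index_pairs M. cos (fr \<kappa> (pair_diff p, pair_diff q) \<bullet> u)) / (real M)\<^sup>2"
proof -
  let ?a = "\<lambda>p. of_int (pair_diff p) * (\<kappa> * fst u)" and ?b = "\<lambda>p. of_int (pair_diff p) * (\<kappa> * snd u)"
  have "fr \<kappa> (pair_diff p, pair_diff q) \<bullet> u = ?a p + ?b q" for p q by (simp add: fr_inner)
  then have "(\<Sum>p\<in>index_pairs M. \<Sum>q\<in>index_pairs M. cos (fr \<kappa> (pair_diff p, pair_diff q) \<bullet> u)) =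
     (\<Sum>p\<in>index_pairs M. cos (?a p)) * (\<Sum>q\<in>index_pairs M. cos (?b q)) - (\<Sum>p\<in>index_pairs M. sin (?a p)) * (\<Sum>q\<in>index_pairs M. sin (?b q))"
    by (simp add: cos_add sum_subtractf sum_product)
  then show ?thesis unfolding sum_sin_pair_diff by (simp add: K_def fejer1_def power2_eq_square)
qed

lemma continuous_K: "continuous_on UNIV (\<lambda>x. K M (x - y))"
  unfolding K_eq divide_inverse by (intro continuous_intros)

lemma integral_cos_shift:
  "integral (square L) (\<lambda>x. cos (fr \<kappa> k \<bullet> (x - y))) = (if k = 0 then 4 * L\<^sup>2 else 0)"
proof -
  have "fr \<kappa> 0 = 0" by (simp add: fr_def zero_prod_def)
  then show ?thesis
    using integral_wave[OF L, of k "- (fr \<kappa> k \<bullet> y)"] by (simp add: inner_diff_right flip: \<kappa>_def)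
qed

lemma integrable_cos_shift: "(\<lambda>x. cos (fr \<kappa> k \<bullet> (x - y))) integrable_on square L"
  by (intro integrable_square continuous_intros)

lemma integral_K:
  assumes "1 \<le> M"
  shows "integral (square L) (\<lambda>x. K M (x - y)) = 4 * L\<^sup>2"
proof -
  have "integral (square L) (\<lambda>x. K M (x - y)) =
     (\<Sum>p\<in>index_pairs M. \<Sum>q\<in>index_pairs M. integral (square L) (\<lambda>x. cos (fr \<kappa> (pair_diff p, pair_diff q) \<bullet> (x - y)))) / (real M)\<^sup>2"
    unfolding K_eq by (simp add: integral_sum integrable_sum integrable_cos_shift)
  also have "(\<Sum>p\<in>index_pairs M. \<Sum>q\<in>index_pairs M. integral (square L) (\<lambda>x. cos (fr \<kappa> (pair_diff p, pair_diff q) \<bullet> (x - y))))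
     = (\<Sum>p\<in>index_pairs M. \<Sum>q\<in>index_pairs M. (4 * L\<^sup>2) * ((if pair_diff p = 0 then 1 else 0) * (if pair_diff q = 0 then 1 else 0)))"
    unfolding integral_cos_shift by (intro sum.cong) (auto simp: prod_eq_iff)
  also have "\<dots> = (4 * L\<^sup>2) * ((\<Sum>p\<in>index_pairs M. if pair_diff p = 0 then 1 else 0) * (\<Sum>p\<in>index_pairs M. if pair_diff p = 0 then 1 else 0))"
    by (subst sum_product) (simp only: sum_distrib_left)
  also have "\<dots> = 4 * L\<^sup>2 * (real M)\<^sup>2" unfolding sum_pair_diff_zero by (simp add: power2_eq_square)
  finally show ?thesis using assms by simp
qed

lemma integral_fejer1:
  assumes "1 \<le> M"
  shows "(\<lambda>x. fejer1 M (\<kappa> * co i (x - y))) integrable_on square L"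
    "integral (square L) (\<lambda>x. fejer1 M (\<kappa> * co i (x - y))) = 4 * L\<^sup>2"
proof -
  define k where "k = (\<lambda>p. if i then (pair_diff p, 0) else (0, pair_diff p))"
  have e: "fejer1 M (\<kappa> * co i u) = (\<Sum>p\<in>index_pairs M. cos (fr \<kappa> (k p) \<bullet> u)) / real M" for u
    by (auto simp: fejer1_def k_def co_def fr_inner mult_ac)
  have k0: "k p = 0 \<longleftrightarrow> pair_diff p = 0" for p by (auto simp: k_def zero_prod_def)
  show "(\<lambda>x. fejer1 M (\<kappa> * co i (x - y))) integrable_on square L"
    unfolding e divide_inverse by (intro integrable_square continuous_intros)
  have "integral (square L) (\<lambda>x. fejer1 M (\<kappa> * co i (x - y))) =
     (\<Sum>p\<in>index_pairs M. integral (square L) (\<lambda>x. cos (fr \<kappa> (k p) \<bullet> (x - y)))) / real M"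
    unfolding e by (simp add: integral_sum integrable_cos_shift)
  also have "(\<Sum>p\<in>index_pairs M. integral (square L) (\<lambda>x. cos (fr \<kappa> (k p) \<bullet> (x - y))))
     = (\<Sum>p\<in>index_pairs M. (4 * L\<^sup>2) * (if pair_diff p = 0 then 1 else 0))"
    unfolding integral_cos_shift k0 by (intro sum.cong) auto
  also have "\<dots> = 4 * L\<^sup>2 * real M" unfolding sum_distrib_left[symmetric] sum_pair_diff_zero ..
  finally show "integral (square L) (\<lambda>x. fejer1 M (\<kappa> * co i (x - y))) = 4 * L\<^sup>2" using assms by simp
qed

text \<open>A quantitative form of concentration. In direction i the sine factor flattens the kernel
  to at most 1/M, while the factor in the other direction still has a bounded integral.\<close>

lemma integral_K_sin:
  assumes "1 \<le> M"
  shows "(\<lambda>x. K M (x - y) * (sin (\<kappa> * co i (x - y) / 2))\<^sup>2) integrable_on square L"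
    "integral (square L) (\<lambda>x. K M (x - y) * (sin (\<kappa> * co i (x - y) / 2))\<^sup>2) \<le> 4 * L\<^sup>2 / real M"
proof -
  have cc: "continuous_on UNIV (\<lambda>x. co i (x - y))" by (cases i) (auto simp: co_def intro!: continuous_intros)
  show I: "(\<lambda>x. K M (x - y) * (sin (\<kappa> * co i (x - y) / 2))\<^sup>2) integrable_on square L"
    by (intro integrable_square continuous_intros continuous_K cc) auto
  have point: "K M u * (sin (\<kappa> * co i u / 2))\<^sup>2 \<le> fejer1 M (\<kappa> * co (\<not> i) u) * (1 / real M)" for u
  proof -
    have "K M u = fejer1 M (\<kappa> * co (\<not> i) u) * fejer1 M (\<kappa> * co i u)"
      by (cases i) (auto simp: K_def co_def)
    then show ?thesis
      using mult_left_mono[OF fejer1_decay[of M "\<kappa> * co i u"] fejer1_nonneg[of M "\<kappa> * co (\<not> i) u"]]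
      by (simp add: mult.assoc)
  qed
  have J: "(\<lambda>x. fejer1 M (\<kappa> * co (\<not> i) (x - y)) * (1 / real M)) integrable_on square L"
    using integrable_on_mult_left[OF integral_fejer1(1)[OF assms, of "\<not> i" y], of "1 / real M"] by simp
  have "integral (square L) (\<lambda>x. K M (x - y) * (sin (\<kappa> * co i (x - y) / 2))\<^sup>2)
    \<le> integral (square L) (\<lambda>x. fejer1 M (\<kappa> * co (\<not> i) (x - y)) * (1 / real M))"
    by (rule integral_le[OF I J point])
  also have "\<dots> = 4 * L\<^sup>2 / real M" using integral_fejer1(2)[OF assms, of "\<not> i" y] by simp
  finally show "integral (square L) (\<lambda>x. K M (x - y) * (sin (\<kappa> * co i (x - y) / 2))\<^sup>2) \<le> 4 * L\<^sup>2 / real M" .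
qed

text \<open>Uniform convergence is claimed only for y in the square of half the size, because \<phi>
  is not assumed periodic: there the periodic images of y stay away from the square of
  integration.\<close>

lemma fejer_approximation:
  assumes c: "continuous_on UNIV \<phi>" and e: "0 < e"
  shows "\<forall>\<^sub>F M in sequentially. \<forall>y\<in>square (L / 2).
     \<bar>integral (square L) (\<lambda>x. K M (x - y) * \<phi> x) / (4 * L\<^sup>2) - \<phi> y\<bar> \<le> e"
proof -
  have cs: "continuous_on (square L) \<phi>" and comp: "compact (square L)"
    using c by (auto intro: continuous_on_subset simp: square_def)
  obtain d where d: "0 < d" "\<And>x y. x \<in> square L \<Longrightarrow> y \<in> square L \<Longrightarrow> dist y x < d \<Longrightarrow> dist (\<phi> y) (\<phi> x) < e / 2"
    using compact_uniformly_continuous[OF cs comp] e unfolding uniformly_continuous_on_def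
    by (metis half_gt_zero)
  obtain B where B: "0 < B" "\<And>x. x \<in> square L \<Longrightarrow> \<bar>\<phi> x\<bar> \<le> B"
    using compact_imp_bounded[OF compact_continuous_image[OF cs comp]] unfolding bounded_pos by auto
  define \<eta> where "\<eta> = min (d / 2) (L / 2)"
  have \<eta>: "0 < \<eta>" "\<eta> \<le> L / 2" "2 * \<eta> \<le> d" using d L by (auto simp: \<eta>_def)
  define s where "s = (sin (\<kappa> * \<eta> / 2))\<^sup>2"
  have "0 < sin (\<kappa> * \<eta> / 2)"
    using \<eta> L by (intro sin_gt_zero) (auto simp: \<kappa>_def field_simps)
  then have s: "0 < s" by (simp add: s_def)
  let ?S = "\<lambda>i u. (sin (\<kappa> * co i u / 2))\<^sup>2"
  \<comment> \<open>Uniform continuity handles x near y; elsewhere one of the two sines is at least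
    \<open>s\<close> and the bound 2B applies. Adding both bounds avoids splitting the domain of
    integration.\<close>
  have point: "\<bar>\<phi> x - \<phi> y\<bar> \<le> e / 2 + 2 * B / s * (?S True (x - y) + ?S False (x - y))"
    if x: "x \<in> square L" and y: "y \<in> square (L / 2)" for x y
  proof -
    have y': "y \<in> square L" using y L by (auto simp: in_square)
    have nn: "0 \<le> 2 * B / s * ?S i (x - y)" for i using B s by simp
    show ?thesis
    proof (cases "\<bar>co True (x - y)\<bar> < \<eta> \<and> \<bar>co False (x - y)\<bar> < \<eta>")
      case True
      have "dist x y \<le> \<bar>co True (x - y)\<bar> + \<bar>co False (x - y)\<bar>"
        using sqrt_sum_squares_le_sum_abs[of "fst (x - y)" "snd (x - y)"]
        by (simp add: dist_norm norm_prod_def co_def)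
      then have "dist x y < d" using True \<eta> by linarith
      then have "\<bar>\<phi> x - \<phi> y\<bar> < e / 2" using d(2)[OF y' x] by (simp add: dist_real_def)
      then show ?thesis using nn[of True] nn[of False] by (simp add: distrib_left)
    next
      case False
      then obtain i where i: "\<eta> \<le> \<bar>co i (x - y)\<bar>" by (metis not_le)
      have "\<bar>fst x\<bar> \<le> L" "\<bar>snd x\<bar> \<le> L" "\<bar>fst y\<bar> \<le> L / 2" "\<bar>snd y\<bar> \<le> L / 2"
        using x y by (simp_all add: in_square)
      then have "\<bar>fst x - fst y\<bar> \<le> 3 / 2 * L" "\<bar>snd x - snd y\<bar> \<le> 3 / 2 * L" by linarith+
      then have "\<bar>co i (x - y)\<bar> \<le> 3 / 2 * L" unfolding co_def fst_diff snd_diff by presburger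
      then have "s \<le> ?S i (x - y)"
        unfolding s_def \<kappa>_def using sin_square_ge[OF L \<eta>(1,2) i] by simp
      then have "2 * B \<le> 2 * B / s * ?S i (x - y)" using B s by (simp add: field_simps)
      moreover have "\<bar>\<phi> x - \<phi> y\<bar> \<le> 2 * B" using B(2)[OF x] B(2)[OF y'] by linarith
      ultimately show ?thesis using nn[of True] nn[of False] e by (cases i) (auto simp: distrib_left)
    qed
  qed
  have gen: "\<bar>k * a - k * b\<bar> \<le> k * c + f * (k * p + k * q)" if "0 \<le> k" "\<bar>a - b\<bar> \<le> c + f * (p + q)"
    for k a b c f p q :: real
  proof -
    have "\<bar>k * a - k * b\<bar> = k * \<bar>a - b\<bar>" using that(1) by (simp add: right_diff_distrib[symmetric] abs_mult)
    also have "\<dots> \<le> k * (c + f * (p + q))" using that by (intro mult_left_mono)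
    finally show ?thesis by (simp add: algebra_simps)
  qed
  obtain M0 :: nat where M0: "8 * B / (s * e) < real M0" using reals_Archimedean2 by blast
  show ?thesis
    using eventually_ge_at_top[of "max 1 M0"]
  proof eventually_elim
    case (elim M)
    then have M: "1 \<le> M" "8 * B / (s * e) < real M" using M0 by auto
    show ?case
    proof
      fix y assume y: "y \<in> square (L / 2)"
      have iK: "(\<lambda>x. K M (x - y)) integrable_on square L" by (intro integrable_square continuous_K)
      have iKp: "(\<lambda>x. K M (x - y) * \<phi> x) integrable_on square L"
        by (intro integrable_square continuous_on_mult continuous_K c)
      have iKc: "(\<lambda>x. K M (x - y) * c) integrable_on square L" for c
        by (intro integrable_square continuous_on_mult continuous_K continuous_intros)
      have i12: "(\<lambda>x. 2 * B / s * (K M (x - y) * ?S True (x - y) + K M (x - y) * ?S False (x - y))) integrable_on square L"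
        by (intro integrable_add integrable_on_mult_right integral_K_sin(1)[OF M(1)])
      have "\<bar>integral (square L) (\<lambda>x. K M (x - y) * \<phi> x - K M (x - y) * \<phi> y)\<bar>
         \<le> integral (square L) (\<lambda>x. K M (x - y) * (e / 2) + 2 * B / s * (K M (x - y) * ?S True (x - y) + K M (x - y) * ?S False (x - y)))"
      proof (rule integral_norm_bound_integral[where 'a=real, unfolded real_norm_def])
        show "(\<lambda>x. K M (x - y) * \<phi> x - K M (x - y) * \<phi> y) integrable_on square L"
          by (intro integrable_diff iKp iKc)
        show "(\<lambda>x. K M (x - y) * (e / 2) + 2 * B / s * (K M (x - y) * ?S True (x - y) + K M (x - y) * ?S False (x - y))) integrable_on square L"
          by (rule integrable_add[OF iKc i12])
        fix x assume "x \<in> square L"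
        then show "\<bar>K M (x - y) * \<phi> x - K M (x - y) * \<phi> y\<bar> \<le>
          K M (x - y) * (e / 2) + 2 * B / s * (K M (x - y) * ?S True (x - y) + K M (x - y) * ?S False (x - y))"
          by (intro gen K_nonneg point y)
      qed
      also have "\<dots> = 4 * L\<^sup>2 * (e / 2) + 2 * B / s * (integral (square L) (\<lambda>x. K M (x - y) * ?S True (x - y)) + integral (square L) (\<lambda>x. K M (x - y) * ?S False (x - y)))"
        unfolding integral_add[OF iKc i12] integral_mult_right integral_mult_left integral_K[OF M(1)]
          integral_add[OF integral_K_sin(1)[OF M(1)] integral_K_sin(1)[OF M(1)]] ..
      also have "\<dots> \<le> 4 * L\<^sup>2 * (e / 2) + 2 * B / s * (4 * L\<^sup>2 / real M + 4 * L\<^sup>2 / real M)"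
        using B s by (intro add_left_mono mult_left_mono add_mono integral_K_sin(2)[OF M(1)]) auto
      also have "\<dots> = 4 * L\<^sup>2 * (e / 2 + 4 * B / (s * real M))" by (simp add: field_simps)
      also have "\<dots> \<le> 4 * L\<^sup>2 * e"
      proof (rule mult_left_mono)
        have "8 * B < real M * (s * e)" using M(2) s e by (simp add: divide_less_eq)
        then have "4 * B / (s * real M) \<le> e / 2" using M(1) s by (simp add: field_simps)
        then show "e / 2 + 4 * B / (s * real M) \<le> e" by linarith
      qed simp
      finally have "\<bar>integral (square L) (\<lambda>x. K M (x - y) * \<phi> x - K M (x - y) * \<phi> y)\<bar> \<le> 4 * L\<^sup>2 * e" .
      also have "integral (square L) (\<lambda>x. K M (x - y) * \<phi> x - K M (x - y) * \<phi> y)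
         = integral (square L) (\<lambda>x. K M (x - y) * \<phi> x) - 4 * L\<^sup>2 * \<phi> y"
        using integral_diff[OF iKp iKc[of "\<phi> y"]] integral_K[OF M(1), of y] by simp
      also have "\<dots> = 4 * L\<^sup>2 * (integral (square L) (\<lambda>x. K M (x - y) * \<phi> x) / (4 * L\<^sup>2) - \<phi> y)"
        using L by (simp add: field_simps)
      finally show "\<bar>integral (square L) (\<lambda>x. K M (x - y) * \<phi> x) / (4 * L\<^sup>2) - \<phi> y\<bar> \<le> e"
        using L by (simp add: abs_mult)
    qed
  qed
qed

end

section \<open>Weak convergence of the Laplacians of the truncations\<close>

context torus_density
begin

lemma r_zero: "r 0 = 0"
  using r_psi(2)[of 0] F0 by (simp add: fr_def zero_prod_def[symmetric])

lemma trig_poly_wave: "trig_poly (wave k)"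
proof -
  have "trig_poly (\<lambda>x. - a k * cos (fr \<kappa> k \<bullet> x + \<psi> k))" by (intro trig_poly_intros)
  then show ?thesis by (simp add: wave_def[abs_def])
qed

lemma lap_wave_eq: "lap (wave k) x = r k * cos (fr \<kappa> k \<bullet> x + \<psi> k) / (4 * L\<^sup>2)"
proof -
  have w: "lap (wave k) x = a k * (norm (fr \<kappa> k))\<^sup>2 * cos (fr \<kappa> k \<bullet> x + \<psi> k)"
    unfolding wave_def[abs_def] lap_wave by simp
  show ?thesis
  proof (cases "k = 0")
    case True
    then show ?thesis unfolding w by (simp add: a_def r_zero)
  next
    case False
    then have "norm (fr \<kappa> k) \<noteq> 0" using kappa_pos by (auto simp: fr_def zero_prod_def prod_eq_iff)
    then show ?thesis unfolding w by (simp add: a_def)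
  qed
qed

lemma cos_diff_inner: "cos (\<xi> \<bullet> (x - y)) = cos (\<xi> \<bullet> x) * cos (\<xi> \<bullet> y) + sin (\<xi> \<bullet> x) * sin (\<xi> \<bullet> y)"
  for \<xi> :: "real \<times> real"
  by (simp add: inner_diff_right cos_diff)

text \<open>Projection onto one frequency is symmetric and may be moved from F to \<phi>. Expanding
  the cosine of a difference gives a kernel of rank two, so products of single integrals suffice and
  no exchange of integrations occurs.\<close>

lemma wave_pairing:
  assumes c: "continuous_on UNIV \<phi>"
  shows "integral (square L) (\<lambda>x. r k * cos (fr \<kappa> k \<bullet> x + \<psi> k) * \<phi> x)
     = integral (square L) (\<lambda>y. F y * integral (square L) (\<lambda>x. cos (fr \<kappa> k \<bullet> (x - y)) * \<phi> x))"
    and "continuous_on UNIV (\<lambda>y. integral (square L) (\<lambda>x. cos (fr \<kappa> k \<bullet> (x - y)) * \<phi> x))"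
proof -
  let ?c = "\<lambda>x. cos (fr \<kappa> k \<bullet> x)" and ?s = "\<lambda>x. sin (fr \<kappa> k \<bullet> x)"
  define A B Pc Ps where "A = integral (square L) (\<lambda>y. F y * ?c y)" and "B = integral (square L) (\<lambda>y. F y * ?s y)"
    and "Pc = integral (square L) (\<lambda>x. ?c x * \<phi> x)" and "Ps = integral (square L) (\<lambda>x. ?s x * \<phi> x)"
  have iF: "(\<lambda>y. F y * ?c y) integrable_on square L" "(\<lambda>y. F y * ?s y) integrable_on square L"
    by (intro integrable_F_mult continuous_intros)+
  have iP: "(\<lambda>x. ?c x * \<phi> x) integrable_on square L" "(\<lambda>x. ?s x * \<phi> x) integrable_on square L"
    by (intro integrable_square continuous_intros c)+
  have comb: "integral (square L) (\<lambda>x. p * u x + q * v x) = p * integral (square L) u + q * integral (square L) v"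
    if "u integrable_on square L" "v integrable_on square L" for u v :: "real \<times> real \<Rightarrow> real" and p q
    using integral_add[OF integrable_on_mult_right[OF that(1)] integrable_on_mult_right[OF that(2)]] by simp
  have P: "integral (square L) (\<lambda>x. cos (fr \<kappa> k \<bullet> (x - y)) * \<phi> x) = ?c y * Pc + ?s y * Ps" for y
    unfolding Pc_def Ps_def comb[OF iP, symmetric] cos_diff_inner by (simp add: algebra_simps)
  have R: "r k * cos (fr \<kappa> k \<bullet> x + \<psi> k) = ?c x * A + ?s x * B" for x
    unfolding A_def B_def comb[OF iF, symmetric] r_psi(3)[symmetric] cos_diff_inner by (simp add: algebra_simps)
  have "integral (square L) (\<lambda>x. r k * cos (fr \<kappa> k \<bullet> x + \<psi> k) * \<phi> x) = A * Pc + B * Ps"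
    unfolding R Pc_def Ps_def comb[OF iP, symmetric] by (simp add: algebra_simps)
  also have "\<dots> = Pc * A + Ps * B" by simp
  also have "\<dots> = integral (square L) (\<lambda>y. F y * integral (square L) (\<lambda>x. cos (fr \<kappa> k \<bullet> (x - y)) * \<phi> x))"
    unfolding P A_def B_def comb[OF iF, symmetric] by (simp add: algebra_simps)
  finally show "integral (square L) (\<lambda>x. r k * cos (fr \<kappa> k \<bullet> x + \<psi> k) * \<phi> x)
     = integral (square L) (\<lambda>y. F y * integral (square L) (\<lambda>x. cos (fr \<kappa> k \<bullet> (x - y)) * \<phi> x))" .
  show "continuous_on UNIV (\<lambda>y. integral (square L) (\<lambda>x. cos (fr \<kappa> k \<bullet> (x - y)) * \<phi> x))"
    unfolding P by (intro continuous_intros)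
qed

lemma fejer_mean_pairing:
  assumes c: "continuous_on UNIV \<phi>"
  shows "(\<Sum>p\<in>index_pairs M. \<Sum>q\<in>index_pairs M. integral (square L) (\<lambda>x. r (pair_diff p, pair_diff q) * cos (fr \<kappa> (pair_diff p, pair_diff q) \<bullet> x + \<psi> (pair_diff p, pair_diff q)) * \<phi> x)) / (real M)\<^sup>2
     = integral (square L) (\<lambda>y. F y * integral (square L) (\<lambda>x. K M (x - y) * \<phi> x))"
    and "continuous_on UNIV (\<lambda>y. integral (square L) (\<lambda>x. K M (x - y) * \<phi> x))"
proof -
  let ?P = "\<lambda>p q y. integral (square L) (\<lambda>x. cos (fr \<kappa> (pair_diff p, pair_diff q) \<bullet> (x - y)) * \<phi> x)"
  have iP: "(\<lambda>x. cos (fr \<kappa> k \<bullet> (x - y)) * \<phi> x) integrable_on square L" for k y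
    by (intro integrable_square continuous_intros c)
  have Keq: "integral (square L) (\<lambda>x. K M (x - y) * \<phi> x) = (\<Sum>p\<in>index_pairs M. \<Sum>q\<in>index_pairs M. ?P p q y) / (real M)\<^sup>2" for y
  proof -
    have "integral (square L) (\<lambda>x. K M (x - y) * \<phi> x) =
      integral (square L) (\<lambda>x. (\<Sum>p\<in>index_pairs M. \<Sum>q\<in>index_pairs M. cos (fr \<kappa> (pair_diff p, pair_diff q) \<bullet> (x - y)) * \<phi> x) / (real M)\<^sup>2)"
      by (simp add: K_eq sum_distrib_right)
    also have "\<dots> = (\<Sum>p\<in>index_pairs M. \<Sum>q\<in>index_pairs M. ?P p q y) / (real M)\<^sup>2"
      by (simp add: integral_sum integrable_sum iP)
    finally show ?thesis .
  qed
  show "continuous_on UNIV (\<lambda>y. integral (square L) (\<lambda>x. K M (x - y) * \<phi> x))"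
    unfolding Keq divide_inverse by (intro continuous_intros wave_pairing(2) c)
  have iF: "(\<lambda>y. F y * ?P p q y) integrable_on square L" for p q
    by (intro integrable_F_mult wave_pairing(2) c)
  have "integral (square L) (\<lambda>y. F y * integral (square L) (\<lambda>x. K M (x - y) * \<phi> x))
     = integral (square L) (\<lambda>y. (\<Sum>p\<in>index_pairs M. \<Sum>q\<in>index_pairs M. F y * ?P p q y) / (real M)\<^sup>2)"
    unfolding Keq by (simp add: sum_distrib_left)
  also have "\<dots> = (\<Sum>p\<in>index_pairs M. \<Sum>q\<in>index_pairs M. integral (square L) (\<lambda>y. F y * ?P p q y)) / (real M)\<^sup>2"
    by (simp add: integral_sum integrable_sum iF)
  finally show "(\<Sum>p\<in>index_pairs M. \<Sum>q\<in>index_pairs M. integral (square L) (\<lambda>x. r (pair_diff p, pair_diff q) * cos (fr \<kappa> (pair_diff p, pair_diff q) \<bullet> x + \<psi> (pair_diff p, pair_diff q)) * \<phi> x)) / (real M)\<^sup>2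
     = integral (square L) (\<lambda>y. F y * integral (square L) (\<lambda>x. K M (x - y) * \<phi> x))"
    unfolding wave_pairing(1)[OF c] by simp
qed

text \<open>F is supported exactly where the Fejer means of \<phi> converge uniformly, so
  integrability of F is enough.\<close>

lemma fejer_limit:
  assumes c: "continuous_on UNIV \<phi>" and supp: "\<And>y. y \<notin> square (L / 2) \<Longrightarrow> F y = 0"
  shows "(\<lambda>M. integral (square L) (\<lambda>y. F y * integral (square L) (\<lambda>x. K M (x - y) * \<phi> x)) / (4 * L\<^sup>2))
     \<longlonglongrightarrow> integral (square L) (\<lambda>y. F y * \<phi> y)"
proof (rule tendstoI)
  fix e :: real assume e: "0 < e"
  define I where "I = integral (square L) (\<lambda>y. \<bar>F y\<bar>)"
  have iabs: "(\<lambda>y. \<bar>F y\<bar>) integrable_on square L"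
    using F by (simp add: absolutely_integrable_on_def)
  have I0: "0 \<le> I" unfolding I_def by (intro integral_nonneg iabs) auto
  define d where "d = e / (2 * (I + 1))"
  have d: "0 < d" "d * I < e"
  proof -
    have "0 \<le> I * e" using e I0 by simp
    then have "e * I < e * (2 * (I + 1))" using e by (simp add: distrib_left)
    then show "d * I < e" using I0 by (simp add: d_def divide_less_eq)
  qed (use e I0 in \<open>simp add: d_def\<close>)
  show "\<forall>\<^sub>F M in sequentially. dist (integral (square L) (\<lambda>y. F y * integral (square L) (\<lambda>x. K M (x - y) * \<phi> x)) / (4 * L\<^sup>2))
      (integral (square L) (\<lambda>y. F y * \<phi> y)) < e"
    using fejer_approximation[OF c d(1)]
  proof eventually_elim
    case (elim M)
    let ?P = "\<lambda>y. integral (square L) (\<lambda>x. K M (x - y) * \<phi> x) / (4 * L\<^sup>2)"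
    have cP: "continuous_on UNIV ?P" unfolding divide_inverse by (intro continuous_intros fejer_mean_pairing(2) c)
    have i1: "(\<lambda>y. F y * ?P y) integrable_on square L" "(\<lambda>y. F y * \<phi> y) integrable_on square L"
      by (intro integrable_F_mult cP c)+
    have "\<bar>integral (square L) (\<lambda>y. F y * ?P y - F y * \<phi> y)\<bar> \<le> integral (square L) (\<lambda>y. d * \<bar>F y\<bar>)"
    proof (rule integral_norm_bound_integral[where 'a=real, unfolded real_norm_def])
      show "(\<lambda>y. F y * ?P y - F y * \<phi> y) integrable_on square L" by (intro integrable_diff i1)
      show "(\<lambda>y. d * \<bar>F y\<bar>) integrable_on square L" by (intro integrable_on_mult_right iabs)
      fix y
      have "\<bar>F y\<bar> * \<bar>?P y - \<phi> y\<bar> \<le> \<bar>F y\<bar> * d"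
      proof (cases "y \<in> square (L / 2)")
        case True
        then show ?thesis using elim by (intro mult_left_mono) auto
      qed (simp add: supp)
      then show "\<bar>F y * ?P y - F y * \<phi> y\<bar> \<le> d * \<bar>F y\<bar>"
        by (simp only: right_diff_distrib[symmetric] abs_mult mult.commute)
    qed
    also have "\<dots> = d * I" by (simp add: I_def)
    also have "\<dots> < e" by (rule d)
    finally have "\<bar>integral (square L) (\<lambda>y. F y * ?P y) - integral (square L) (\<lambda>y. F y * \<phi> y)\<bar> < e"
      unfolding integral_diff[OF i1] .
    then show ?case by (simp add: dist_real_def)
  qed
qed

text \<open>The pairings \<open>b k\<close> of single waves with the Laplacian of \<phi> are
  absolutely summable, since the amplitudes \<open>a k\<close> are. Their sum is evaluated twice:
  sharp truncation gives the limit on the left, and Fejer means give the integral of F against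
  \<phi>. No convergence of the Fourier series of F or of \<phi> is required.\<close>

lemma weak_limit:
  assumes \<phi>: "c1 \<phi>" "\<And>i. c1 (pd i \<phi>)" "\<And>x. x \<notin> square l \<Longrightarrow> \<phi> x = 0" "l < L"
    and supp: "\<And>y. y \<notin> square (L / 2) \<Longrightarrow> F y = 0"
  shows "((\<lambda>N. integral (square L) (\<lambda>x. g N x * lap \<phi> x)) \<longlongrightarrow> integral (square L) (\<lambda>x. F x * \<phi> x)) at_top"
proof -
  define b where "b = (\<lambda>k. integral (square L) (\<lambda>x. wave k x * lap \<phi> x))"
  have cl: "continuous_on UNIV (lap \<phi>)"
    unfolding lap_def[abs_def] by (intro continuous_intros continuous_pd2 \<phi>(2))
  have iw: "(\<lambda>x. wave k x * lap \<phi> x) integrable_on square L" for k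
    by (intro integrable_square continuous_on_mult cl trig_poly_continuous_on trig_poly_wave)
  have ial: "(\<lambda>x. \<bar>lap \<phi> x\<bar>) integrable_on square L"
    by (intro integrable_square continuous_intros cl)
  define J where "J = integral (square L) (\<lambda>x. \<bar>lap \<phi> x\<bar>)"
  have J0: "0 \<le> J" unfolding J_def by (intro integral_nonneg ial) auto
  have ble: "\<bar>b k\<bar> \<le> a k * J" for k
  proof -
    have "\<bar>b k\<bar> \<le> integral (square L) (\<lambda>x. a k * \<bar>lap \<phi> x\<bar>)"
      unfolding b_def
    proof (rule integral_norm_bound_integral[where 'a=real, unfolded real_norm_def])
      fix x
      have "\<bar>wave k x\<bar> \<le> a k"
        using a_nonneg[of k] by (simp add: wave_def abs_mult mult_left_le)
      then show "\<bar>wave k x * lap \<phi> x\<bar> \<le> a k * \<bar>lap \<phi> x\<bar>" by (simp add: abs_mult mult_right_mono)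
    qed (intro iw integrable_on_mult_right ial)+
    then show ?thesis by (simp add: J_def)
  qed
  have bound: "(\<Sum>k\<in>A. \<bar>b k\<bar>) \<le> G * J" if A: "finite A" for A
  proof -
    have "A \<subseteq> freqs (\<Sum>k\<in>A. norm (fr \<kappa> k))"
      using A by (auto simp: freqs_def intro: member_le_sum)
    then have "(\<Sum>k\<in>A. a k) \<le> (\<Sum>k\<in>freqs (\<Sum>k\<in>A. norm (fr \<kappa> k)). a k)"
      by (intro sum_mono2 freqs_finite_card a_nonneg)
    also have "\<dots> \<le> G" by (rule sum_a_le)
    finally have "(\<Sum>k\<in>A. a k) * J \<le> G * J" using J0 by (rule mult_right_mono)
    moreover have "(\<Sum>k\<in>A. \<bar>b k\<bar>) \<le> (\<Sum>k\<in>A. a k * J)" by (intro sum_mono ble)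
    ultimately show ?thesis by (simp add: sum_distrib_right)
  qed
  have "((\<lambda>N. \<Sum>k\<in>freqs N. (if k \<in> freqs N then 1 else 0) * b k) \<longlongrightarrow> infsum b UNIV) at_top"
  proof (rule weighted_sum_limit[OF bound])
    fix k
    have "\<forall>\<^sub>F N in at_top. (1::real) = (if k \<in> freqs N then 1 else 0)"
      using eventually_ge_at_top[of "norm (fr \<kappa> k)"] by eventually_elim (auto simp: freqs_def)
    then show "((\<lambda>N. if k \<in> freqs N then 1 else 0) \<longlongrightarrow> (1::real)) at_top"
      by (rule Lim_transform_eventually[OF tendsto_const])
  qed (auto simp: freqs_finite_card)
  moreover have "(\<Sum>k\<in>freqs N. (if k \<in> freqs N then 1 else 0) * b k) = integral (square L) (\<lambda>x. g N x * lap \<phi> x)" for N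
  proof -
    have "(\<Sum>k\<in>freqs N. (if k \<in> freqs N then 1 else 0) * b k) = (\<Sum>k\<in>freqs N. b k)" by (intro sum.cong) auto
    also have "\<dots> = integral (square L) (\<lambda>x. g N x * lap \<phi> x)"
      unfolding b_def g_def sum_distrib_right by (rule integral_sum[symmetric]) (auto simp: freqs_finite_card iw)
    finally show ?thesis .
  qed
  ultimately have lim1: "((\<lambda>N. integral (square L) (\<lambda>x. g N x * lap \<phi> x)) \<longlongrightarrow> infsum b UNIV) at_top" by simp
  have c: "continuous_on UNIV \<phi>" by (rule c1_continuous[OF \<phi>(1)])
  have beq: "b k = integral (square L) (\<lambda>x. r k * cos (fr \<kappa> k \<bullet> x + \<psi> k) * \<phi> x) / (4 * L\<^sup>2)" for k
  proof -
    have "b k = integral (square L) (\<lambda>x. lap (wave k) x * \<phi> x)"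
      unfolding b_def by (rule integral_mult_lap[OF trig_poly_wave \<phi>(1,2,3) less_imp_le[OF L] \<phi>(4)])
    then show ?thesis unfolding lap_wave_eq by simp
  qed
  have "(\<lambda>M. (\<Sum>p\<in>index_pairs M. \<Sum>q\<in>index_pairs M. b (pair_diff p, pair_diff q)) / (real M)\<^sup>2) \<longlonglongrightarrow> infsum b UNIV"
    by (rule fejer_mean_limit[OF bound])
  moreover have "(\<Sum>p\<in>index_pairs M. \<Sum>q\<in>index_pairs M. b (pair_diff p, pair_diff q)) / (real M)\<^sup>2 =
     integral (square L) (\<lambda>y. F y * integral (square L) (\<lambda>x. K M (x - y) * \<phi> x)) / (4 * L\<^sup>2)" for M
    unfolding beq fejer_mean_pairing(1)[OF c, symmetric] by (simp add: sum_divide_distrib mult.commute)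
  ultimately have "infsum b UNIV = integral (square L) (\<lambda>y. F y * \<phi> y)"
    using LIMSEQ_unique[OF _ fejer_limit[OF c supp]] by simp
  with lim1 show ?thesis by simp
qed

end

section \<open>Assembling the solution\<close>

lemma smooth_differentiable: "smooth u \<Longrightarrow> u differentiable (at x)"
  unfolding smooth_def by (drule spec[of _ "Suc 0"]) (simp only: Ck.simps, blast)

lemma smooth_pd: "smooth u \<Longrightarrow> smooth (pd i u)"
  unfolding smooth_def pd_def by (auto dest: spec[of _ "Suc _"])

lemma smooth_continuous: "smooth u \<Longrightarrow> continuous_on UNIV u"
  unfolding smooth_def by (drule spec[of _ 0]) (simp only: Ck.simps)

lemma smooth_c1: "smooth u \<Longrightarrow> c1 u"
  unfolding c1_def by (intro conjI allI smooth_differentiable smooth_continuous smooth_pd)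

lemma test_fun_zero: "test_fun \<Omega> \<phi> \<Longrightarrow> x \<notin> \<Omega> \<Longrightarrow> \<phi> x = 0"
  unfolding test_fun_def using closure_subset[of "{x. \<phi> x \<noteq> 0}"] by blast

text \<open>Bridge between the set integral of the definition of a solution and the gauge integral
  over a square, in which integration by parts is carried out.\<close>

lemma set_lebesgue_integral_eq_integral_square:
  fixes h :: "real \<times> real \<Rightarrow> real"
  assumes sub: "\<Omega> \<subseteq> square L" and z: "\<And>x. x \<in> square L \<Longrightarrow> x \<notin> \<Omega> \<Longrightarrow> h x = 0"
    and eq: "\<And>x. x \<in> \<Omega> \<Longrightarrow> h x = u x" and int: "h absolutely_integrable_on square L"
  shows "(LINT x:\<Omega>|lebesgue. u x) = integral (square L) h"
proof -
  have "(LINT x:\<Omega>|lebesgue. u x) = (LINT x:square L|lebesgue. h x)"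
    unfolding set_lebesgue_integral_def
    by (intro Bochner_Integration.integral_cong refl)
       (use sub z eq in \<open>auto simp: indicator_def\<close>)
  then show ?thesis using set_lebesgue_integral_eq_integral(2)[OF int] by simp
qed

lemma square_mono: "l \<le> L \<Longrightarrow> square l \<subseteq> square L"
  by (fastforce simp: in_square)

lemma absolutely_integrable_square:
  "continuous_on UNIV f \<Longrightarrow> (f :: _ \<Rightarrow> real) absolutely_integrable_on square L"
  unfolding square_def by (rule absolutely_integrable_continuous) (auto intro: continuous_on_subset)

text \<open>On a set of finite measure |f|^s is dominated by 1 + |f|^p.\<close>

lemma Lp_on_imp_integrable:
  assumes "Lp_on p \<Omega> f" "open \<Omega>" "bounded \<Omega>" "0 < s" "s \<le> p"
  shows "(\<lambda>x. \<bar>f x\<bar> powr s) absolutely_integrable_on \<Omega>"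
proof -
  have O: "\<Omega> \<in> lmeasurable" using assms(2,3) by (simp add: lmeasurable_open)
  then have Os: "\<Omega> \<in> sets lebesgue" by (rule fmeasurableD)
  have f: "f \<in> borel_measurable (lebesgue_on \<Omega>)" and i: "integrable (lebesgue_on \<Omega>) (\<lambda>x. \<bar>f x\<bar> powr p)"
    using assms(1) by (auto simp: Lp_on_def)
  have "integrable (lebesgue_on \<Omega>) (\<lambda>x. 1 + \<bar>f x\<bar> powr p)"
    by (intro Bochner_Integration.integrable_add i finite_measure.integrable_const finite_measure_lebesgue_on O)
  then have "integrable (lebesgue_on \<Omega>) (\<lambda>x. \<bar>f x\<bar> powr s)"
  proof (rule Bochner_Integration.integrable_bound)
    show "(\<lambda>x. \<bar>f x\<bar> powr s) \<in> borel_measurable (lebesgue_on \<Omega>)" using f by measurable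
    have "\<bar>f x\<bar> powr s \<le> 1 + \<bar>f x\<bar> powr p" for x
    proof (cases "1 \<le> \<bar>f x\<bar>")
      case True
      then have "\<bar>f x\<bar> powr s \<le> \<bar>f x\<bar> powr p" using assms(5) by (intro powr_mono) auto
      then show ?thesis by simp
    next
      case False
      then have "\<bar>f x\<bar> powr s \<le> 1 powr s" using assms(4) by (intro powr_mono2) auto
      then show ?thesis by (simp add: add_increasing2)
    qed
    then show "AE x in lebesgue_on \<Omega>. norm (\<bar>f x\<bar> powr s) \<le> norm (1 + \<bar>f x\<bar> powr p)"
      by (intro AE_I2) simp
  qed
  then show ?thesis using Os by (simp add: integrable_restrict_space set_integrable_def)
qed

text \<open>Outside \<open>\<Omega>\<close> the right-hand side is set to a constant on a small square so that its mean
  vanishes; otherwise the Poisson equation would have no periodic solution.\<close>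

lemma density_exists:
  assumes f: "Lp_on p \<Omega> f" and \<Omega>: "open \<Omega>" "bounded \<Omega>" and p: "3/2 \<le> p"
  shows "\<exists>L F. torus_density L F \<and> (\<forall>y. y \<notin> square (L / 2) \<longrightarrow> F y = 0) \<and> \<Omega> \<subseteq> square (L / 4) \<and> (\<forall>y\<in>\<Omega>. F y = f y)"
proof -
  obtain B where B: "0 < B" "\<And>x. x \<in> \<Omega> \<Longrightarrow> norm x \<le> B"
    using \<Omega>(2) unfolding bounded_pos by blast
  define L where "L = 4 * B"
  have L: "0 < L" using B by (simp add: L_def)
  have sub: "\<Omega> \<subseteq> square (L / 4)"
  proof
    fix x assume "x \<in> \<Omega>"
    then show "x \<in> square (L / 4)"
      using B(2)[of x] abs_co_le[of True x] abs_co_le[of False x] by (auto simp: in_square L_def co_def)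
  qed
  have Os: "\<Omega> \<in> sets lebesgue" using \<Omega>(1) by (simp add: borel_open sets_completionI_sets)
  \<comment> \<open>A square of side L/8 in the corner between 3L/8 and L/2. It misses the domain,
    which lies in \<open>square (L / 4)\<close>, and still fits into \<open>square (L / 2)\<close>,
    where F has to be supported. The constant \<open>c\<close> is minus the integral of f divided by
    its area.\<close>
  define Z where "Z = cbox (3/8 * L, 3/8 * L) (L / 2, L / 2)"
  have disj: "x \<notin> \<Omega>" if "x \<in> Z" for x
  proof
    assume "x \<in> \<Omega>"
    then have "\<bar>fst x\<bar> \<le> L / 4" using sub by (auto simp: in_square)
    moreover have "3/8 * L \<le> fst x" using that by (cases x) (simp add: Z_def)
    ultimately show False using L by linarith
  qed
  have Zs: "Z \<in> sets lebesgue" by (simp add: Z_def)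
  have Zm: "measure lebesgue Z = (L / 8)\<^sup>2"
    using L by (simp add: Z_def content_Pair power2_eq_square)
  define I where "I = (LINT x:\<Omega>|lebesgue. f x)"
  define c where "c = - I / (L / 8)\<^sup>2"
  define F where "F = (\<lambda>x. indicator \<Omega> x * f x + indicator Z x * c)"
  have Ff: "F x = f x" if "x \<in> \<Omega>" for x using that disj[of x] by (auto simp: F_def indicator_def)
  have fm: "f \<in> borel_measurable (lebesgue_on \<Omega>)" using f by (simp add: Lp_on_def)
  have fabs: "(\<lambda>x. \<bar>f x\<bar>) absolutely_integrable_on \<Omega>"
    using Lp_on_imp_integrable[OF f \<Omega>, of 1] p by simp
  have fi: "f absolutely_integrable_on \<Omega>"
  proof -
    have "integrable (lebesgue_on \<Omega>) (\<lambda>x. \<bar>f x\<bar>)"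
      using fabs Os by (simp add: integrable_restrict_space set_integrable_def)
    from integrable_abs_cancel[OF this fm] show ?thesis
      using Os by (simp add: integrable_restrict_space set_integrable_def)
  qed
  have ZI: "(\<lambda>x. c) absolutely_integrable_on Z" for c :: real
    unfolding Z_def by (rule absolutely_integrable_continuous) auto
  have F1: "integrable lebesgue F"
    using Bochner_Integration.integrable_add[OF fi[unfolded set_integrable_def] ZI[unfolded set_integrable_def]]
    by (simp add: F_def)
  have "Z \<subseteq> square (L / 2)" using L by (auto simp: Z_def in_square)
  then have OZ: "\<Omega> \<subseteq> square (L / 2)" "Z \<subseteq> square (L / 2)" "\<Omega> \<subseteq> square L" "Z \<subseteq> square L"
    using sub square_mono[of "L / 4" "L / 2"] square_mono[of "L / 2" L] L by auto
  have supp: "F y = 0" if "y \<notin> square (L / 2)" for y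
    using that OZ by (auto simp: F_def indicator_def)
  have FL: "indicator (square L) x * F x = F x" for x
    using supp[of x] L by (cases "x \<in> square L") (auto simp: in_square)
  have F32: "(\<lambda>x. \<bar>F x\<bar> powr (3/2)) absolutely_integrable_on square L"
  proof -
    have e: "indicator (square L) x *\<^sub>R (\<bar>F x\<bar> powr (3/2)) = indicator \<Omega> x *\<^sub>R (\<bar>f x\<bar> powr (3/2)) + indicator Z x *\<^sub>R (\<bar>c\<bar> powr (3/2))" for x
      using disj[of x] OZ(3,4) by (auto simp: F_def indicator_def)
    show ?thesis
      unfolding set_integrable_def e
      using Bochner_Integration.integrable_add[OF Lp_on_imp_integrable[OF f \<Omega> _ p, unfolded set_integrable_def] ZI[unfolded set_integrable_def]]
      by simp
  qed
  have FA: "F absolutely_integrable_on square L" using F1 by (simp add: set_integrable_def FL)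
  have "integral (square L) F = (LINT x:square L|lebesgue. F x)"
    using set_lebesgue_integral_eq_integral(2)[OF FA] by simp
  also have "\<dots> = (LINT x|lebesgue. indicator \<Omega> x *\<^sub>R f x + indicator Z x *\<^sub>R c)"
    unfolding set_lebesgue_integral_def by (simp add: FL) (simp add: F_def)
  also have "\<dots> = I + (LINT x|lebesgue. indicator Z x *\<^sub>R c)"
    unfolding I_def set_lebesgue_integral_def
    by (rule Bochner_Integration.integral_add[OF fi[unfolded set_integrable_def] ZI[unfolded set_integrable_def]])
  also have "(LINT x|lebesgue. indicator Z x *\<^sub>R c) = c * (L / 8)\<^sup>2"
    using Zs by (simp add: Zm)
  also have "I + c * (L / 8)\<^sup>2 = 0" using L by (simp add: c_def)
  finally have F0: "integral (square L) F = 0" .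
  have "torus_density L F"
    by unfold_locales (use L FA set_lebesgue_integral_eq_integral(1)[OF F32] F0 in auto)
  then show ?thesis using supp sub Ff by blast
qed

lemma lowpass_of_density:
  assumes f: "Lp_on p \<Omega> f" and \<Omega>: "open \<Omega>" "bounded \<Omega>" and p: "3/2 \<le> p"
  shows "\<exists>L g G. 0 < L \<and> \<Omega> \<subseteq> square (L / 4) \<and> lowpass g G \<and> (\<forall>\<phi>. test_fun \<Omega> \<phi> \<longrightarrow>
     ((\<lambda>N. integral (square L) (\<lambda>x. g N x * lap \<phi> x)) \<longlongrightarrow> (LINT x:\<Omega>|lebesgue. f x * \<phi> x)) at_top)"
proof -
  obtain L F where FF: "torus_density L F" "\<And>y. y \<notin> square (L / 2) \<Longrightarrow> F y = 0" "\<Omega> \<subseteq> square (L / 4)" "\<And>y. y \<in> \<Omega> \<Longrightarrow> F y = f y"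
    using density_exists[OF f \<Omega> p] by blast
  interpret torus_density L F by (rule FF(1))
  have "((\<lambda>N. integral (square L) (\<lambda>x. g N x * lap \<phi> x)) \<longlongrightarrow> (LINT x:\<Omega>|lebesgue. f x * \<phi> x)) at_top"
    if \<phi>: "test_fun \<Omega> \<phi>" for \<phi>
  proof -
    have sm: "smooth \<phi>" using \<phi> by (simp add: test_fun_def)
    have c: "c1 \<phi>" "\<And>i. c1 (pd i \<phi>)" using sm by (auto intro: smooth_c1 smooth_pd)
    have z: "\<phi> x = 0" if "x \<notin> square (L / 4)" for x using that FF(3) test_fun_zero[OF \<phi>] by blast
    have "(LINT x:\<Omega>|lebesgue. f x * \<phi> x) = integral (square L) (\<lambda>x. F x * \<phi> x)"
    proof (rule set_lebesgue_integral_eq_integral_square)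
      show "\<Omega> \<subseteq> square L" using FF(3) square_mono[of "L / 4" L] L by auto
      show "(\<lambda>x. F x * \<phi> x) absolutely_integrable_on square L" by (rule integrable_F_mult(1)[OF c1_continuous[OF c(1)]])
    qed (auto simp: FF(4) test_fun_zero[OF \<phi>])
    moreover have "L / 4 < L" using L by simp
    ultimately show ?thesis using weak_limit[OF c z _ FF(2)] by simp
  qed
  then show ?thesis using L FF(3) lowpass_g by blast
qed

text \<open>Stone-Weierstrass; this is where free frequencies are convenient. To separate x from y,
  take \<xi> with \<xi> . (x - y) = 1 and centre the phase at y, so that the two values are cos 1
  and cos 0.\<close>

lemma trig_poly_dense:
  assumes S: "compact S" and c: "continuous_on S u" and e: "0 < e"
  shows "\<exists>v. trig_poly v \<and> (\<forall>x\<in>S. \<bar>u x - v x\<bar> < e)"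
proof -
  interpret function_ring_on "Collect trig_poly" S
  proof
    show "continuous_on S f" if "f \<in> Collect trig_poly" for f using that by (auto intro: trig_poly_continuous_on)
    fix x y :: "real \<times> real" assume "x \<noteq> y"
    define \<xi> where "\<xi> = (1 / (norm (x - y))\<^sup>2) *\<^sub>R (x - y)"
    have "\<xi> \<bullet> x - \<xi> \<bullet> y = 1"
      using \<open>x \<noteq> y\<close> unfolding \<xi>_def inner_diff_right[symmetric] by (simp add: dot_square_norm)
    then have "cos (\<xi> \<bullet> x + (- (\<xi> \<bullet> y))) = cos 1" by simp
    moreover have "cos (1::real) < cos 0" by (rule cos_monotone_0_pi) (use pi_gt3 in auto)
    ultimately have "cos (\<xi> \<bullet> x + (- (\<xi> \<bullet> y))) \<noteq> cos (\<xi> \<bullet> y + (- (\<xi> \<bullet> y)))" by simp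
    moreover have "(\<lambda>z. cos (\<xi> \<bullet> z + (- (\<xi> \<bullet> y)))) \<in> Collect trig_poly"
      by (rule CollectI, rule trig_poly_intros)
    ultimately show "\<exists>f\<in>Collect trig_poly. f x \<noteq> f y" by (rule bexI)
  qed (use S in auto)
  show ?thesis using Stone_Weierstrass_basic[OF c e] by auto
qed

section \<open>Hoelder bounds and the passage to the limit\<close>

lemma abs_cos_diff_le: "\<bar>cos a - cos b\<bar> \<le> \<bar>a - b\<bar>" for a b :: real
proof -
  have "\<bar>cos a - cos b\<bar> = 2 * (\<bar>sin ((a + b) / 2)\<bar> * \<bar>sin ((b - a) / 2)\<bar>)"
    unfolding cos_diff_cos by (simp add: abs_mult)
  also have "\<dots> \<le> 2 * (1 * \<bar>(b - a) / 2\<bar>)"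
    by (intro mult_left_mono mult_mono abs_sin_x_le_abs_x) auto
  finally show ?thesis by simp
qed

lemma geometric_limit:
  fixes f :: "nat \<Rightarrow> 'a \<Rightarrow> real"
  assumes step: "\<And>q x. \<bar>f (Suc q) x - f q x\<bar> \<le> c * \<rho> ^ q" and \<rho>: "0 \<le> \<rho>" "\<rho> < 1"
  shows "\<exists>l. \<forall>q x. \<bar>f q x - l x\<bar> \<le> c * \<rho> ^ q / (1 - \<rho>)"
proof -
  define l where "l = (\<lambda>x. f 0 x + (\<Sum>j. f (Suc j) x - f j x))"
  have "\<bar>f q x - l x\<bar> \<le> c * \<rho> ^ q / (1 - \<rho>)" for q x
  proof -
    let ?g = "\<lambda>j. f (Suc j) x - f j x"
    have sg: "summable (\<lambda>j. c * \<rho> ^ j)" using \<rho> by (intro summable_mult summable_geometric) auto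
    have sn: "summable ?g" by (rule summable_comparison_test'[OF sg]) (use step in auto)
    have "(\<Sum>j<q. ?g j) = f q x - f 0 x" by (rule sum_lessThan_telescope)
    then have "l x - f q x = (\<Sum>j. ?g (j + q))"
      unfolding l_def using suminf_split_initial_segment[OF sn, of q] by simp
    moreover have "\<bar>\<Sum>j. ?g (j + q)\<bar> \<le> (\<Sum>j. c * \<rho> ^ q * \<rho> ^ j)"
    proof -
      have sg': "summable (\<lambda>j. c * \<rho> ^ q * \<rho> ^ j)" using \<rho> by (intro summable_mult summable_geometric) auto
      have le: "norm (?g (j + q)) \<le> c * \<rho> ^ q * \<rho> ^ j" for j
        using step[of "j + q" x] by (simp add: power_add mult_ac)
      show ?thesis using norm_suminf_le[OF le sg'] by simp
    qed
    moreover have "(\<Sum>j. c * \<rho> ^ q * \<rho> ^ j) = c * \<rho> ^ q / (1 - \<rho>)"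
      using \<rho> by (simp add: suminf_mult suminf_geometric)
    ultimately show ?thesis by linarith
  qed
  then show ?thesis by blast
qed

lemma wiener_lipschitz:
  assumes "wiener (cball 0 \<mu>) K u" "0 \<le> \<mu>"
  shows "\<bar>u x - u y\<bar> \<le> K * (\<mu> * dist x y)"
  using assms(1)
proof (induction rule: wiener.induct)
  case (wiener_0 K)
  then show ?case using assms(2) by simp
next
  case (wiener_step \<xi> K u r \<phi>)
  have "\<bar>\<xi> \<bullet> (x - y)\<bar> \<le> norm \<xi> * norm (x - y)" by (rule Cauchy_Schwarz_ineq2)
  also have "\<dots> \<le> \<mu> * dist x y" using wiener_step(1) by (auto simp: dist_norm intro!: mult_right_mono)
  finally have "\<bar>cos (\<xi> \<bullet> x + \<phi>) - cos (\<xi> \<bullet> y + \<phi>)\<bar> \<le> \<mu> * dist x y"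
    using abs_cos_diff_le[of "\<xi> \<bullet> x + \<phi>" "\<xi> \<bullet> y + \<phi>"] by (simp add: inner_diff_right)
  then have "\<bar>r\<bar> * \<bar>cos (\<xi> \<bullet> x + \<phi>) - cos (\<xi> \<bullet> y + \<phi>)\<bar> \<le> \<bar>r\<bar> * (\<mu> * dist x y)"
    by (intro mult_left_mono) auto
  then have "\<bar>r * cos (\<xi> \<bullet> x + \<phi>) - r * cos (\<xi> \<bullet> y + \<phi>)\<bar> \<le> \<bar>r\<bar> * (\<mu> * dist x y)"
    by (simp only: right_diff_distrib[symmetric] abs_mult)
  with wiener_step.IH show ?case unfolding distrib_right by linarith
qed

text \<open>Interpolation between the bound 2K, used when \<mu> |x - y| >= 1, and the Lipschitz
  bound, used otherwise.\<close>

lemma wiener_holder: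
  assumes u: "wiener (cball 0 \<mu>) K u" and \<mu>: "0 \<le> \<mu>" and \<theta>: "0 < \<theta>" "\<theta> \<le> 1"
  shows "\<bar>u x - u y\<bar> \<le> 2 * K * \<mu> powr \<theta> * dist x y powr \<theta>"
proof -
  let ?s = "\<mu> * dist x y"
  have K: "0 \<le> K" using u by (rule wiener_nonneg)
  have s: "0 \<le> ?s" using \<mu> by simp
  have "\<bar>u x - u y\<bar> \<le> 2 * K * ?s powr \<theta>"
  proof (cases "1 \<le> ?s")
    case True
    then have "1 \<le> ?s powr \<theta>" using \<theta> by (intro ge_one_powr_ge_zero) auto
    then have "2 * K * 1 \<le> 2 * K * ?s powr \<theta>" using K by (intro mult_left_mono) auto
    moreover have "\<bar>u x - u y\<bar> \<le> 2 * K" using wiener_bound[OF u, of x] wiener_bound[OF u, of y] by linarith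
    ultimately show ?thesis by linarith
  next
    case False
    have "?s \<le> ?s powr \<theta>"
    proof (cases "?s = 0")
      case f: False
      have "?s powr 1 \<le> ?s powr \<theta>" by (rule powr_mono') (use False s \<theta> in auto)
      then show ?thesis using s f by simp
    next
      case True
      show ?thesis unfolding True by simp
    qed
    then have "K * ?s \<le> K * ?s powr \<theta>" using K by (intro mult_left_mono)
    moreover have "0 \<le> K * ?s powr \<theta>" using K by simp
    ultimately show ?thesis using wiener_lipschitz[OF u \<mu>, of x y] by linarith
  qed
  then show ?thesis using \<mu> by (simp add: powr_mult mult.assoc)
qed

text \<open>The integrand is stated for an arbitrary pair \<open>p\<close> in place of a gradient,
  so that it covers the approximations and the limit field alike.\<close>

abbreviation weak_form :: "(bool \<Rightarrow> real \<times> real \<Rightarrow> real) \<Rightarrow> (real \<times> real \<Rightarrow> real) \<Rightarrow> real \<times> real \<Rightarrow> real" where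
  "weak_form p \<phi> \<equiv> (\<lambda>x. p True x * p False x * pd True (pd False \<phi>) x
     - (1/2) * (p True x)\<^sup>2 * pd False (pd False \<phi>) x - (1/2) * (p False x)\<^sup>2 * pd True (pd True \<phi>) x)"

lemma integral_hess_mult:
  assumes v: "trig_poly v" and \<phi>: "c1 \<phi>" "\<And>i. c1 (pd i \<phi>)" "\<And>x. x \<notin> square l \<Longrightarrow> \<phi> x = 0"
    and l: "0 \<le> L" "l < L"
  shows "integral (square L) (weak_form (\<lambda>i. pd i v) \<phi>)
    = integral (square L) (\<lambda>x. hess v x * \<phi> x)"
proof -
  define a where "a = (\<lambda>x. pd True v x * pd False v x)"
  define b where "b = (\<lambda>x. pd True v x * pd True v x / 2)"
  define c where "c = (\<lambda>x. pd False v x * pd False v x / 2)"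
  have e: "trig_poly a" "trig_poly b" "trig_poly c" using v by (auto simp: a_def b_def c_def)
  have m: "integral (square L) (\<lambda>x. u x * pd i (pd j \<phi>) x) = integral (square L) (\<lambda>x. pd j (pd i u) x * \<phi> x)"
    if "trig_poly u" for u i j
    by (rule integral_mult_pd2[OF that \<phi> l])
  have i1: "(\<lambda>x. u x * pd i (pd j \<phi>) x) integrable_on square L" if "trig_poly u" for u i j
    using that by (intro integrable_square continuous_on_mult trig_poly_continuous_on continuous_pd2 \<phi>(2))
  have i2: "(\<lambda>x. pd i (pd j u) x * \<phi> x) integrable_on square L" if "trig_poly u" for u i j
    using that by (intro integrable_square continuous_on_mult trig_poly_continuous_on c1_continuous \<phi>(1)) auto
  have "integral (square L) (\<lambda>x. a x * pd True (pd False \<phi>) x - b x * pd False (pd False \<phi>) x - c x * pd True (pd True \<phi>) x)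
     = integral (square L) (\<lambda>x. a x * pd True (pd False \<phi>) x) - integral (square L) (\<lambda>x. b x * pd False (pd False \<phi>) x)
       - integral (square L) (\<lambda>x. c x * pd True (pd True \<phi>) x)"
    using integral_diff[OF integrable_diff[OF i1[OF e(1)] i1[OF e(2)]] i1[OF e(3)]] integral_diff[OF i1[OF e(1)] i1[OF e(2)]] by simp
  also have "\<dots> = integral (square L) (\<lambda>x. pd True (pd False a) x * \<phi> x) - integral (square L) (\<lambda>x. pd False (pd False b) x * \<phi> x)
       - integral (square L) (\<lambda>x. pd True (pd True c) x * \<phi> x)"
    unfolding m[OF e(1)] m[OF e(2)] m[OF e(3)] trig_poly_pd_commute[OF e(1), of False True] ..
  also have "\<dots> = integral (square L) (\<lambda>x. pd True (pd False a) x * \<phi> x - pd False (pd False b) x * \<phi> x - pd True (pd True c) x * \<phi> x)"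
    using integral_diff[OF integrable_diff[OF i2[OF e(1)] i2[OF e(2)]] i2[OF e(3)]] integral_diff[OF i2[OF e(1)] i2[OF e(2)]] by simp
  also have "\<dots> = integral (square L) (\<lambda>x. hess v x * \<phi> x)"
    unfolding hess_double_divergence[OF v, of _ True] a_def b_def c_def by (simp add: algebra_simps)
  finally show ?thesis by (simp add: a_def b_def c_def power2_eq_square)
qed

text \<open>The potentials P and R converge to zero only as functions, with no control of their
  second derivatives. Two integrations by parts put these derivatives on the test function, which is
  all that a distributional solution asks for.\<close>

lemma integral_hess_defect:
  assumes v: "trig_poly v" "trig_poly g" "wiener UNIV e P" "wiener UNIV e R"
    and eq: "\<And>x. hess v x - lap g x = pd (\<not> i) (pd (\<not> i) P) x + pd i (pd i R) x"
    and \<phi>: "c1 \<phi>" "\<And>i. c1 (pd i \<phi>)" "\<And>x. x \<notin> square l \<Longrightarrow> \<phi> x = 0"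
    and l: "0 \<le> L" "l < L"
  shows "\<bar>integral (square L) (\<lambda>x. hess v x * \<phi> x) - integral (square L) (\<lambda>x. g x * lap \<phi> x)\<bar>
    \<le> e * (integral (square L) (\<lambda>x. \<bar>pd True (pd True \<phi>) x\<bar>) + integral (square L) (\<lambda>x. \<bar>pd False (pd False \<phi>) x\<bar>))"
proof -
  have e: "trig_poly P" "trig_poly R" using v by (auto intro: wiener_trig_poly)
  have m: "integral (square L) (\<lambda>x. u x * pd i (pd j \<phi>) x) = integral (square L) (\<lambda>x. pd j (pd i u) x * \<phi> x)"
    if "trig_poly u" for u i j
    by (rule integral_mult_pd2[OF that \<phi> l])
  have ml: "integral (square L) (\<lambda>x. g x * lap \<phi> x) = integral (square L) (\<lambda>x. lap g x * \<phi> x)"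
    by (rule integral_mult_lap[OF v(2) \<phi> l])
  have i2: "(\<lambda>x. u x * \<phi> x) integrable_on square L" if "trig_poly u" for u
    using that by (intro integrable_square continuous_on_mult trig_poly_continuous_on c1_continuous \<phi>(1)) auto
  have bnd: "\<bar>integral (square L) (\<lambda>x. u x * pd j (pd j \<phi>) x)\<bar> \<le> e * integral (square L) (\<lambda>x. \<bar>pd j (pd j \<phi>) x\<bar>)"
    if u: "wiener UNIV e u" for u j
  proof -
    have i: "(\<lambda>x. \<bar>pd j (pd j \<phi>) x\<bar>) integrable_on square L"
      by (intro integrable_square continuous_intros continuous_pd2 \<phi>(2))
    have "\<bar>integral (square L) (\<lambda>x. u x * pd j (pd j \<phi>) x)\<bar> \<le> integral (square L) (\<lambda>x. e * \<bar>pd j (pd j \<phi>) x\<bar>)"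
    proof (rule integral_norm_bound_integral[where 'a=real, unfolded real_norm_def])
      show "(\<lambda>x. u x * pd j (pd j \<phi>) x) integrable_on square L"
        using u by (intro integrable_square continuous_on_mult trig_poly_continuous_on continuous_pd2 \<phi>(2)) (rule wiener_trig_poly)
      show "(\<lambda>x. e * \<bar>pd j (pd j \<phi>) x\<bar>) integrable_on square L" by (intro integrable_on_mult_right i)
      show "\<bar>u x * pd j (pd j \<phi>) x\<bar> \<le> e * \<bar>pd j (pd j \<phi>) x\<bar>" for x
        unfolding abs_mult using wiener_bound[OF u] by (intro mult_right_mono) auto
    qed
    then show ?thesis by simp
  qed
  have h: "hess v x = (lap g x + pd (\<not> i) (pd (\<not> i) P) x) + pd i (pd i R) x" for x using eq[of x] by simp
  have "integral (square L) (\<lambda>x. hess v x * \<phi> x) = integral (square L) (\<lambda>x. lap g x * \<phi> x)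
     + integral (square L) (\<lambda>x. pd (\<not> i) (pd (\<not> i) P) x * \<phi> x) + integral (square L) (\<lambda>x. pd i (pd i R) x * \<phi> x)"
    unfolding h distrib_right
    using integral_add[OF integrable_add[OF i2[of "lap g"] i2[of "pd (\<not> i) (pd (\<not> i) P)"]] i2[of "pd i (pd i R)"]]
      integral_add[OF i2[of "lap g"] i2[of "pd (\<not> i) (pd (\<not> i) P)"]] v(2) e by simp
  also have "\<dots> = integral (square L) (\<lambda>x. g x * lap \<phi> x) + integral (square L) (\<lambda>x. P x * pd (\<not> i) (pd (\<not> i) \<phi>) x)
     + integral (square L) (\<lambda>x. R x * pd i (pd i \<phi>) x)"
    unfolding ml m[OF e(1)] m[OF e(2)] ..
  finally show ?thesis
    using bnd[OF v(3), of "\<not> i"] bnd[OF v(4), of i] by (cases i) (simp_all add: distrib_left)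
qed

text \<open>A point outside the domain has a neighbourhood in the open complement of the support,
  and there all derivatives vanish.\<close>

lemma test_fun_pd2_zero:
  assumes "test_fun \<Omega> \<phi>" "x \<notin> \<Omega>"
  shows "pd i (pd j \<phi>) x = 0"
proof -
  let ?U = "- closure {x. \<phi> x \<noteq> 0}"
  have U: "open ?U" "x \<in> ?U" using assms unfolding test_fun_def by auto
  have "\<phi> y = 0" if "y \<in> ?U" for y using that closure_subset[of "{x. \<phi> x \<noteq> 0}"] by blast
  then have "pd j \<phi> y = 0" if "y \<in> ?U" for y by (rule pd_eq_0_open[OF U(1) _ that])
  then show ?thesis by (rule pd_eq_0_open[OF U(1) _ U(2)])
qed

lemma limit_of_gradients:
  fixes v :: "nat \<Rightarrow> real \<times> real \<Rightarrow> real"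
  assumes d: "\<And>q x. v q differentiable (at x)"
    and V: "\<And>x. (\<lambda>q. v q x) \<longlonglongrightarrow> V x"
    and p: "\<And>i q x. \<bar>pd i (v q) x - p i x\<bar> \<le> c q" and c: "c \<longlonglongrightarrow> 0"
  shows "(V has_derivative (\<lambda>h. p True x * fst h + p False x * snd h)) (at x)"
proof -
  have "\<exists>g. \<forall>x\<in>UNIV. (\<lambda>q. v q x) \<longlonglongrightarrow> g x \<and>
    (g has_derivative (\<lambda>h. p True x * fst h + p False x * snd h)) (at x within UNIV)"
  proof (rule has_derivative_sequence[OF convex_UNIV])
    show "(v q has_derivative (\<lambda>h. pd True (v q) x * fst h + pd False (v q) x * snd h)) (at x within UNIV)" for q x
      using differentiable_has_pd[OF d] by simp
    fix e :: real assume "0 < e"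
    then have "\<forall>\<^sub>F q in sequentially. dist (c q) 0 < e / 2" using c by (intro tendstoD) auto
    then show "\<forall>\<^sub>F q in sequentially. \<forall>x\<in>UNIV. \<forall>h. norm ((pd True (v q) x * fst h + pd False (v q) x * snd h) - (p True x * fst h + p False x * snd h)) \<le> e * norm h"
    proof eventually_elim
      case (elim q)
      show ?case
      proof (intro ballI allI)
        fix x h :: "real \<times> real"
        have c0: "0 \<le> c q" using p[of True q x] by linarith
        have t: "\<bar>(pd i (v q) x - p i x) * z\<bar> \<le> c q * norm h" if "\<bar>z\<bar> \<le> norm h" for i z
          unfolding abs_mult using p c0 that by (intro mult_mono) auto
        have "(pd True (v q) x * fst h + pd False (v q) x * snd h) - (p True x * fst h + p False x * snd h)
          = (pd True (v q) x - p True x) * fst h + (pd False (v q) x - p False x) * snd h" by (simp add: algebra_simps)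
        also have "norm \<dots> \<le> \<bar>(pd True (v q) x - p True x) * fst h\<bar> + \<bar>(pd False (v q) x - p False x) * snd h\<bar>"
          unfolding real_norm_def by (rule abs_triangle_ineq)
        also have "\<dots> \<le> c q * norm h + c q * norm h"
          using abs_co_le[of True h] abs_co_le[of False h] by (intro add_mono t) (simp_all add: co_def)
        also have "\<dots> = (2 * c q) * norm h" by simp
        also have "\<dots> \<le> e * norm h" using elim c0 by (intro mult_right_mono) auto
        finally show "norm ((pd True (v q) x * fst h + pd False (v q) x * snd h) - (p True x * fst h + p False x * snd h)) \<le> e * norm h" .
      qed
    qed
  qed (auto intro: V)
  then obtain g where g: "\<And>x. (\<lambda>q. v q x) \<longlonglongrightarrow> g x"
    "\<And>x. (g has_derivative (\<lambda>h. p True x * fst h + p False x * snd h)) (at x)" by auto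
  have "g = V" using LIMSEQ_unique[OF g(1) V] by blast
  then show ?thesis using g(2) by blast
qed

lemma geometric_tendsto_0:
  "0 \<le> \<rho> \<Longrightarrow> \<rho> < 1 \<Longrightarrow> (\<lambda>q. c * \<rho> ^ q / (1 - \<rho>)) \<longlonglongrightarrow> 0" for \<rho> c :: real
  using tendsto_mult_right_zero[OF LIMSEQ_power_zero[of \<rho>], of "c / (1 - \<rho>)"] by simp

text \<open>The weak form is quadratic in the gradient alone, so uniformly bounded gradients that
  converge pointwise are enough for dominated convergence.\<close>

lemma weak_hessian_limit:
  fixes v :: "nat \<Rightarrow> real \<times> real \<Rightarrow> real"
  assumes v: "\<And>q. trig_poly (v q)" and c\<phi>: "c1 \<phi>" "\<And>i. c1 (pd i \<phi>)" "\<And>x. x \<notin> square l \<Longrightarrow> \<phi> x = 0" "0 \<le> L" "l < L"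
    and M: "\<And>i q x. \<bar>pd i (v q) x\<bar> \<le> M"
    and p: "\<And>i x. (\<lambda>q. pd i (v q) x) \<longlonglongrightarrow> p i x"
  shows "(\<lambda>q. integral (square L) (\<lambda>x. hess (v q) x * \<phi> x)) \<longlonglongrightarrow>
    integral (square L) (weak_form p \<phi>)"
proof -
  have M0: "0 \<le> M" using M[of True 0 0] by linarith
  have c2: "continuous_on UNIV (pd i (pd j \<phi>))" for i j by (rule continuous_pd2[OF c\<phi>(2)])
  have h: "integral (square L) (\<lambda>x. hess (v q) x * \<phi> x) = integral (square L) (weak_form (\<lambda>i. pd i (v q)) \<phi>)" for q
    by (rule integral_hess_mult[OF v c\<phi>, symmetric])
  show ?thesis
    unfolding h
  proof (rule dominated_convergence(2))
    fix q
    have cv: "continuous_on UNIV (pd i (v q))" for i by (rule trig_poly_continuous_on[OF trig_poly_pd[OF v]])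
    show "(weak_form (\<lambda>i. pd i (v q)) \<phi>) integrable_on square L"
      by (intro integrable_square continuous_intros cv c2)
    show "(\<lambda>x. M\<^sup>2 * (\<bar>pd True (pd False \<phi>) x\<bar> + \<bar>pd False (pd False \<phi>) x\<bar> + \<bar>pd True (pd True \<phi>) x\<bar>)) integrable_on square L"
      by (intro integrable_square continuous_intros c2)
    fix x
    have m: "\<bar>pd i (v q) x * pd j (v q) x\<bar> \<le> M\<^sup>2" for i j
      unfolding abs_mult power2_eq_square using M M0 by (intro mult_mono) auto
    have b: "\<bar>a * c - (1/2) * d * c' - (1/2) * d' * c''\<bar> \<le> K * (\<bar>c\<bar> + \<bar>c'\<bar> + \<bar>c''\<bar>)"
      if "\<bar>a\<bar> \<le> K" "\<bar>d\<bar> \<le> K" "\<bar>d'\<bar> \<le> K" for a c d c' d' c'' K :: real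
    proof -
      have "\<bar>a * c\<bar> \<le> K * \<bar>c\<bar>" "\<bar>d * c'\<bar> \<le> K * \<bar>c'\<bar>" "\<bar>d' * c''\<bar> \<le> K * \<bar>c''\<bar>"
        unfolding abs_mult using that by (auto intro: mult_right_mono)
      then show ?thesis unfolding distrib_left mult.assoc by linarith
    qed
    show "norm (pd True (v q) x * pd False (v q) x * pd True (pd False \<phi>) x
      - (1/2) * (pd True (v q) x)\<^sup>2 * pd False (pd False \<phi>) x - (1/2) * (pd False (v q) x)\<^sup>2 * pd True (pd True \<phi>) x)
      \<le> M\<^sup>2 * (\<bar>pd True (pd False \<phi>) x\<bar> + \<bar>pd False (pd False \<phi>) x\<bar> + \<bar>pd True (pd True \<phi>) x\<bar>)"
      unfolding real_norm_def using m[of True True] m[of False False] by (intro b m) (simp_all add: power2_eq_square)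
  next
    fix x
    show "(\<lambda>q. pd True (v q) x * pd False (v q) x * pd True (pd False \<phi>) x
      - (1/2) * (pd True (v q) x)\<^sup>2 * pd False (pd False \<phi>) x - (1/2) * (pd False (v q) x)\<^sup>2 * pd True (pd True \<phi>) x)
      \<longlonglongrightarrow> p True x * p False x * pd True (pd False \<phi>) x
      - (1/2) * (p True x)\<^sup>2 * pd False (pd False \<phi>) x - (1/2) * (p False x)\<^sup>2 * pd True (pd True \<phi>) x"
      by (intro tendsto_intros p)
  qed
qed

lemma doubling_powr_le:
  fixes \<mu> :: "nat \<Rightarrow> real"
  assumes "\<And>q. 1 \<le> \<mu> q" "\<And>q. 2 * \<mu> q \<le> \<mu> (Suc q)" "0 \<le> s"
  shows "\<mu> (Suc q) powr (- s) \<le> \<mu> 1 powr (- s) * (2 powr (- s)) ^ q"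
proof -
  have "2 ^ q * \<mu> 1 \<le> \<mu> (Suc q)"
  proof (induction q)
    case (Suc q)
    then show ?case using assms(2)[of "Suc q"] by simp
  qed simp
  moreover have "0 < 2 ^ q * \<mu> 1" using assms(1)[of 1] by simp
  ultimately have "\<mu> (Suc q) powr (- s) \<le> (2 ^ q * \<mu> 1) powr (- s)"
    using assms(3) by (intro powr_mono2') auto
  also have "\<dots> = \<mu> 1 powr (- s) * (2 powr (- s)) ^ q"
    using assms(1)[of 1] by (simp add: powr_mult powr_powr mult.commute flip: powr_realpow)
  finally show ?thesis .
qed

lemma two_powr_neg: "0 < s \<Longrightarrow> 0 \<le> 2 powr (- s) \<and> 2 powr (- s) < (1::real)"
  using powr_less_mono[of "- s" 0 "2::real"] by simp

lemma sum_power_le: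
  fixes \<rho> :: real
  assumes "0 \<le> \<rho>" "\<rho> < 1" "0 \<le> c"
  shows "(\<Sum>j<q. c * \<rho> ^ j) \<le> c / (1 - \<rho>)"
proof -
  have "(\<Sum>j<q. c * \<rho> ^ j) = c * ((1 - \<rho> ^ q) / (1 - \<rho>))"
    using assms by (simp add: sum_gp_strict flip: sum_distrib_left)
  also have "\<dots> \<le> c * (1 / (1 - \<rho>))"
    using assms by (intro mult_left_mono divide_right_mono) auto
  finally show ?thesis by simp
qed

text \<open>The limit is tested against any function with two continuous derivatives supported in a
  smaller square. Whatever value T the truncations converge to is inherited by the weak form; this
  keeps f out of the argument.\<close>

lemma holder_solution:
  assumes \<theta>: "0 < \<theta>" "\<theta> < 1/3" and lp: "lowpass g G" and v0: "trig_poly v0" and \<eta>: "0 < \<eta>"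
  shows "\<exists>V p C. (\<forall>x. (V has_derivative (\<lambda>h. p True x * fst h + p False x * snd h)) (at x)) \<and>
    (\<forall>x. \<bar>v0 x - V x\<bar> \<le> 2 * \<eta>) \<and> (\<forall>i. continuous_on UNIV (p i)) \<and>
    (\<forall>i x y. \<bar>p i x - p i y\<bar> \<le> C * dist x y powr \<theta>) \<and>
    (\<forall>\<phi> l L T. c1 \<phi> \<longrightarrow> (\<forall>i. c1 (pd i \<phi>)) \<longrightarrow> (\<forall>x. x \<notin> square l \<longrightarrow> \<phi> x = 0) \<longrightarrow> 0 \<le> L \<longrightarrow> l < L \<longrightarrow>
      ((\<lambda>N. integral (square L) (\<lambda>x. g N x * lap \<phi> x)) \<longlongrightarrow> T) at_top \<longrightarrow>
      integral (square L) (weak_form p \<phi>) = T)"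
proof -
  \<comment> \<open>Strictly between \<theta> and 1/3: increments of the gradient have size
    \<mu>^(-t) at frequency \<mu>, hence Hoelder seminorm of order \<mu>^(-(t - \<theta>)), which is
    summable along the doubling frequencies.\<close>
  define t where "t = (\<theta> + 1/3) / 2"
  have t: "0 < t" "t < 1/3" "\<theta> < t" using \<theta> by (auto simp: t_def)
  obtain \<rho>0 K where K: "0 \<le> \<rho>0" "wiener (cball 0 \<rho>0) K v0" using trig_poly_cball[OF v0] by blast
  have "\<exists>v \<mu> E e. (\<forall>q::nat. trig_poly (v q)) \<and> v 0 = v0 \<and> (\<forall>q. 1 \<le> \<mu> q) \<and> (\<forall>q. 2 * \<mu> q \<le> \<mu> (Suc q)) \<and>
     0 \<le> E \<and> E * \<mu> 1 powr (- 1 - t) \<le> \<eta> \<and> e \<longlonglongrightarrow> 0 \<and>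
     (\<forall>q. wiener (cball 0 (\<mu> (Suc q))) (E * \<mu> (Suc q) powr (- 1 - t)) (\<lambda>x. v (Suc q) x - v q x)) \<and>
     (\<forall>q. \<exists>i P R. wiener UNIV (e q) P \<and> wiener UNIV (e q) R \<and>
        (\<forall>x. hess (v q) x - lap (g (\<mu> q)) x = pd (\<not> i) (pd (\<not> i) P) x + pd i (pd i R) x))"
    by (rule iteration[OF t(1,2) lp K(2,1) \<eta>])
  then obtain v \<mu> E e where v: "\<And>q::nat. trig_poly (v q)" "v 0 = v0" and \<mu>: "\<And>q. 1 \<le> \<mu> q" "\<And>q. 2 * \<mu> q \<le> \<mu> (Suc q)"
    and E: "0 \<le> E" "E * \<mu> 1 powr (- 1 - t) \<le> \<eta>" and e: "e \<longlonglongrightarrow> 0"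
    and W: "\<And>q. wiener (cball 0 (\<mu> (Suc q))) (E * \<mu> (Suc q) powr (- 1 - t)) (\<lambda>x. v (Suc q) x - v q x)"
    and def: "\<And>q. \<exists>i P R. wiener UNIV (e q) P \<and> wiener UNIV (e q) R \<and>
        (\<forall>x. hess (v q) x - lap (g (\<mu> q)) x = pd (\<not> i) (pd (\<not> i) P) x + pd i (pd i R) x)" by auto
  have \<mu>1: "\<mu> 1 powr (- s) \<le> 1" if "0 \<le> s" for s
    using powr_mono[of "- s" 0 "\<mu> 1"] \<mu>(1)[of 1] that by simp
  have decay: "\<mu> (Suc q) powr (- s) \<le> (2 powr (- s)) ^ q" if "0 < s" for s q
  proof -
    have "\<mu> 1 powr (- s) * (2 powr (- s)) ^ q \<le> 1 * (2 powr (- s)) ^ q"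
      using \<mu>1[of s] that by (intro mult_right_mono) auto
    moreover have "\<mu> (Suc q) powr (- s) \<le> \<mu> 1 powr (- s) * (2 powr (- s)) ^ q"
      using \<mu> that by (intro doubling_powr_le) auto
    ultimately show ?thesis by linarith
  qed
  have stepV: "\<bar>v (Suc q) x - v q x\<bar> \<le> \<eta> * (1/2) ^ q" for q x
  proof -
    have "\<bar>v (Suc q) x - v q x\<bar> \<le> E * \<mu> (Suc q) powr (- (1 + t))" using wiener_bound[OF W] by simp
    also have "\<dots> \<le> E * (\<mu> 1 powr (- (1 + t)) * (2 powr (- (1 + t))) ^ q)"
      using E(1) t \<mu> by (intro mult_left_mono doubling_powr_le) auto
    also have "\<dots> \<le> E * (\<mu> 1 powr (- (1 + t)) * (1/2) ^ q)"
    proof -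
      have "2 powr (- (1 + t)) \<le> 2 powr (- 1 :: real)" using t by (intro powr_mono) auto
      also have "\<dots> = 1/2" by (simp add: powr_minus)
      finally show ?thesis using E(1) by (intro mult_left_mono power_mono) auto
    qed
    also have "\<dots> = (E * \<mu> 1 powr (- 1 - t)) * (1/2) ^ q" by simp
    also have "\<dots> \<le> \<eta> * (1/2) ^ q" using E(2) by (intro mult_right_mono) auto
    finally show ?thesis .
  qed
  have pdW: "pd i (\<lambda>x. v (Suc q) x - v q x) = (\<lambda>x. pd i (v (Suc q)) x - pd i (v q) x)" for i q
    using v(1) by (simp add: trig_poly_pd_simps)
  have pW: "wiener (cball 0 (\<mu> (Suc q))) (E * \<mu> (Suc q) powr (- t)) (\<lambda>x. pd i (v (Suc q)) x - pd i (v q) x)" for i q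
  proof -
    have m: "0 < \<mu> (Suc q)" using \<mu>(1)[of "Suc q"] by simp
    have eq: "\<mu> (Suc q) * (E * \<mu> (Suc q) powr (- 1 - t)) = E * \<mu> (Suc q) powr (- t)"
      using m by (simp add: powr_diff powr_minus field_simps)
    show ?thesis using wiener_pd_cball[OF W[of q], of i] m unfolding pdW eq by simp
  qed
  define \<rho>1 where "\<rho>1 = 2 powr (- t)"
  define \<rho>2 where "\<rho>2 = 2 powr (- (t - \<theta>))"
  have \<rho>1: "0 \<le> \<rho>1" "\<rho>1 < 1" using two_powr_neg[of t] t by (auto simp: \<rho>1_def)
  have \<rho>2: "0 \<le> \<rho>2" "\<rho>2 < 1" using two_powr_neg[of "t - \<theta>"] t by (auto simp: \<rho>2_def)
  have stepP: "\<bar>pd i (v (Suc q)) x - pd i (v q) x\<bar> \<le> E * \<rho>1 ^ q" for i q x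
  proof -
    have "\<bar>pd i (v (Suc q)) x - pd i (v q) x\<bar> \<le> E * \<mu> (Suc q) powr (- t)" by (rule wiener_bound[OF pW])
    also have "\<dots> \<le> E * \<rho>1 ^ q" unfolding \<rho>1_def using E(1) t by (intro mult_left_mono decay) auto
    finally show ?thesis .
  qed
  have stepH: "\<bar>(pd i (v (Suc q)) x - pd i (v q) x) - (pd i (v (Suc q)) y - pd i (v q) y)\<bar> \<le> (2 * E * \<rho>2 ^ q) * dist x y powr \<theta>" for i q x y
  proof -
    have m: "0 \<le> \<mu> (Suc q)" using \<mu>(1)[of "Suc q"] by simp
    have "\<bar>(pd i (v (Suc q)) x - pd i (v q) x) - (pd i (v (Suc q)) y - pd i (v q) y)\<bar>
      \<le> 2 * (E * \<mu> (Suc q) powr (- t)) * \<mu> (Suc q) powr \<theta> * dist x y powr \<theta>"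
      using \<theta> by (intro wiener_holder[OF pW m]) auto
    also have "2 * (E * \<mu> (Suc q) powr (- t)) * \<mu> (Suc q) powr \<theta> = 2 * E * \<mu> (Suc q) powr (- (t - \<theta>))"
      by (simp add: powr_add[symmetric] mult.assoc)
    also have "2 * E * \<mu> (Suc q) powr (- (t - \<theta>)) * dist x y powr \<theta> \<le> (2 * E * \<rho>2 ^ q) * dist x y powr \<theta>"
      unfolding \<rho>2_def using E(1) t by (intro mult_right_mono mult_left_mono decay) auto
    finally show ?thesis .
  qed
  obtain V where V: "\<And>q x. \<bar>v q x - V x\<bar> \<le> \<eta> * (1/2) ^ q / (1 - 1/2)"
    using geometric_limit[of v \<eta> "1/2", OF stepV] by auto
  have "\<exists>p. \<forall>q x. \<bar>pd i (v q) x - p x\<bar> \<le> E * \<rho>1 ^ q / (1 - \<rho>1)" for i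
    by (rule geometric_limit[OF stepP \<rho>1])
  then obtain p where p: "\<And>i q x. \<bar>pd i (v q) x - p i x\<bar> \<le> E * \<rho>1 ^ q / (1 - \<rho>1)" by metis
  have c0: "(\<lambda>q. E * \<rho>1 ^ q / (1 - \<rho>1)) \<longlonglongrightarrow> 0" by (rule geometric_tendsto_0[OF \<rho>1])
  have plim: "(\<lambda>q. pd i (v q) x) \<longlonglongrightarrow> p i x" for i x
  proof -
    have "(\<lambda>q. pd i (v q) x - p i x) \<longlonglongrightarrow> 0"
      by (rule Lim_null_comparison[OF _ c0]) (use p in auto)
    then show ?thesis by (simp add: LIM_zero_iff)
  qed
  have Vlim: "(\<lambda>q. v q x) \<longlonglongrightarrow> V x" for x
  proof -
    have "(\<lambda>q. \<eta> * (1/2) ^ q / (1 - 1/2)) \<longlonglongrightarrow> 0" by (rule geometric_tendsto_0) auto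
    then have "(\<lambda>q. v q x - V x) \<longlonglongrightarrow> 0"
      by (rule Lim_null_comparison[rotated]) (use V in auto)
    then show ?thesis by (simp add: LIM_zero_iff)
  qed
  have der: "(V has_derivative (\<lambda>h. p True x * fst h + p False x * snd h)) (at x)" for x
    by (rule limit_of_gradients[OF trig_poly_differentiable[OF v(1)] Vlim p c0])
  have near: "\<bar>v0 x - V x\<bar> \<le> 2 * \<eta>" for x using V[of 0 x] v(2) by simp
  have K1: "wiener (cball 0 \<rho>0) (\<rho>0 * K) (pd i v0)" for i by (rule wiener_pd_cball[OF K(2,1)])
  \<comment> \<open>The Hoelder bound of the starting gradient plus the geometric sum of the bounds
    of all increments; it does not depend on q.\<close>
  define C where "C = 2 * (\<rho>0 * K) * \<rho>0 powr \<theta> + 2 * E / (1 - \<rho>2)"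
  have hq: "\<bar>pd i (v q) x - pd i (v q) y\<bar> \<le> C * dist x y powr \<theta>" for i q x y
  proof -
    have "\<bar>pd i (v q) x - pd i (v q) y\<bar> \<le> (2 * (\<rho>0 * K) * \<rho>0 powr \<theta> + (\<Sum>j<q. 2 * E * \<rho>2 ^ j)) * dist x y powr \<theta>"
    proof (induction q)
      case 0
      then show ?case using wiener_holder[OF K1 K(1), of \<theta> i x y] \<theta> by (simp add: v(2))
    next
      case (Suc q)
      then show ?case using stepH[of i q x y] by (simp add: distrib_right) 
    qed
    also have "\<dots> \<le> C * dist x y powr \<theta>"
      unfolding C_def using sum_power_le[OF \<rho>2, of "2 * E" q] E(1) by (intro mult_right_mono add_left_mono) auto
    finally show ?thesis .
  qed
  have hold: "\<bar>p i x - p i y\<bar> \<le> C * dist x y powr \<theta>" for i x y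
  proof (rule LIMSEQ_le_const2)
    show "(\<lambda>q. \<bar>pd i (v q) x - pd i (v q) y\<bar>) \<longlonglongrightarrow> \<bar>p i x - p i y\<bar>" by (intro tendsto_intros plim)
  qed (use hq in auto)
  have cont: "continuous_on UNIV (p i)" for i
  proof (rule uniform_limit_theorem)
    show "uniform_limit UNIV (\<lambda>q. pd i (v q)) (p i) sequentially"
    proof (rule uniform_limitI)
      fix e :: real assume "0 < e"
      then have "\<forall>\<^sub>F q in sequentially. dist (E * \<rho>1 ^ q / (1 - \<rho>1)) 0 < e" using c0 by (intro tendstoD)
      then show "\<forall>\<^sub>F q in sequentially. \<forall>x\<in>UNIV. dist (pd i (v q) x) (p i x) < e"
      proof eventually_elim
        case (elim q)
        then have "E * \<rho>1 ^ q / (1 - \<rho>1) < e" unfolding dist_real_def by linarith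
        then show ?case unfolding dist_real_def using p order_le_less_trans by blast
      qed
    qed
    show "\<forall>\<^sub>F q in sequentially. continuous_on UNIV (pd i (v q))"
      using v(1) by (intro always_eventually allI trig_poly_continuous_on trig_poly_pd)
  qed simp
  define M where "M = \<rho>0 * K + 2 * (E / (1 - \<rho>1))"
  have M: "\<bar>pd i (v q) x\<bar> \<le> M" for i q x
  proof -
    have "E * \<rho>1 ^ q / (1 - \<rho>1) \<le> E * 1 / (1 - \<rho>1)"
      using \<rho>1 E(1) by (intro divide_right_mono mult_left_mono power_le_one) auto
    then have "\<bar>pd i (v q) x - p i x\<bar> \<le> E / (1 - \<rho>1)" using p[of i q x] by simp
    moreover have "\<bar>pd i v0 x - p i x\<bar> \<le> E / (1 - \<rho>1)" using p[of i 0 x] v(2) by simp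
    moreover have "\<bar>pd i v0 x\<bar> \<le> \<rho>0 * K" by (rule wiener_bound[OF K1])
    ultimately show ?thesis unfolding M_def by linarith
  qed
  have \<mu>lim: "filterlim \<mu> at_top sequentially"
  proof (rule filterlim_at_top_mono[OF filterlim_real_sequentially])
    have "real q \<le> \<mu> q" for q
    proof (induction q)
      case (Suc q)
      then show ?case using \<mu>(1)[of q] \<mu>(2)[of q] by simp
    qed (use \<mu>(1)[of 0] in simp)
    then show "\<forall>\<^sub>F q in sequentially. real q \<le> \<mu> q" by simp
  qed
  have weak: "integral (square L) (weak_form p \<phi>) = T"
    if \<phi>: "c1 \<phi>" "\<And>i. c1 (pd i \<phi>)" "\<And>x. x \<notin> square l \<Longrightarrow> \<phi> x = 0" "0 \<le> L" "l < L"
      and T: "((\<lambda>N. integral (square L) (\<lambda>x. g N x * lap \<phi> x)) \<longlongrightarrow> T) at_top" for \<phi> l L T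
  proof -
    define J where "J = integral (square L) (\<lambda>x. \<bar>pd True (pd True \<phi>) x\<bar>) + integral (square L) (\<lambda>x. \<bar>pd False (pd False \<phi>) x\<bar>)"
    let ?h = "\<lambda>q. integral (square L) (\<lambda>x. hess (v q) x * \<phi> x)"
    let ?g = "\<lambda>q. integral (square L) (\<lambda>x. g (\<mu> q) x * lap \<phi> x)"
    have hg: "norm (?h q - ?g q) \<le> e q * J" for q
    proof -
      obtain i P R where PR: "wiener UNIV (e q) P" "wiener UNIV (e q) R"
        "\<And>x. hess (v q) x - lap (g (\<mu> q)) x = pd (\<not> i) (pd (\<not> i) P) x + pd i (pd i R) x"
        using def[of q] by auto
      have "trig_poly (g (\<mu> q))" using lp \<mu>(1)[of q] unfolding lowpass_def by (auto intro: wiener_trig_poly)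
      then show ?thesis unfolding J_def real_norm_def by (rule integral_hess_defect[OF v(1) _ PR \<phi>])
    qed
    have "(\<lambda>q. ?h q - ?g q) \<longlonglongrightarrow> 0"
      by (rule Lim_null_comparison[OF always_eventually[OF allI[OF hg]] tendsto_mult_left_zero[OF e]])
    moreover have "?g \<longlonglongrightarrow> T" by (rule filterlim_compose[OF T \<mu>lim])
    ultimately have "(\<lambda>q. (?h q - ?g q) + ?g q) \<longlonglongrightarrow> 0 + T" by (rule tendsto_add)
    then have "?h \<longlonglongrightarrow> T" by simp
    moreover note weak_hessian_limit[OF v(1) \<phi> M plim]
    ultimately show ?thesis by (rule LIMSEQ_unique[rotated])
  qed
  show ?thesis
  proof (intro exI[of _ V] exI[of _ p] exI[of _ C] conjI allI impI)
    fix \<phi> :: "real \<times> real \<Rightarrow> real" and l L T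
    assume \<phi>: "c1 \<phi>" "\<forall>i. c1 (pd i \<phi>)" "\<forall>x. x \<notin> square l \<longrightarrow> \<phi> x = 0" "0 \<le> L" "l < L"
      "((\<lambda>N. integral (square L) (\<lambda>x. g N x * lap \<phi> x)) \<longlongrightarrow> T) at_top"
    show "integral (square L) (weak_form p \<phi>) = T"
      by (rule weak[OF \<phi>(1) \<phi>(2)[rule_format] \<phi>(3)[rule_format] \<phi>(4-6)])
  qed (rule der near cont hold)+
qed

theorem theorem1p1:
  fixes \<Omega> :: "(real \<times> real) set" and f :: "real \<times> real \<Rightarrow> real" and p :: real
  assumes "open \<Omega>" and "bounded \<Omega>" and "simply_connected \<Omega>" and "smooth_boundary \<Omega>"
    and "p \<ge> 3/2" and "Lp_on p \<Omega> f"
  shows "\<forall>\<theta>. 0 < \<theta> \<and> \<theta> < 1/3 \<longrightarrow>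
           (\<forall>vu. continuous_on (closure \<Omega>) vu \<longrightarrow> (\<forall>\<epsilon>>0. \<exists>v.
              C1_holder \<theta> \<Omega> v \<and> very_weak_hessian_sol \<Omega> f v \<and>
              (\<forall>x\<in>closure \<Omega>. \<bar>vu x - v x\<bar> < \<epsilon>)))"
proof (intro allI impI)
  fix \<theta> :: real and vu :: "real \<times> real \<Rightarrow> real" and \<epsilon> :: real
  assume \<theta>: "0 < \<theta> \<and> \<theta> < 1/3" and vu: "continuous_on (closure \<Omega>) vu" and \<epsilon>: "0 < \<epsilon>"
  obtain L g G where L: "0 < L" "\<Omega> \<subseteq> square (L / 4)" and lp: "lowpass g G"
    and lim: "\<And>\<phi>. test_fun \<Omega> \<phi> \<Longrightarrow>
     ((\<lambda>N. integral (square L) (\<lambda>x. g N x * lap \<phi> x)) \<longlongrightarrow> (LINT x:\<Omega>|lebesgue. f x * \<phi> x)) at_top"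
    using lowpass_of_density[OF assms(6,1,2,5)] by auto
  have "compact (closure \<Omega>)" using assms(2) by simp
  \<comment> \<open>Budget for the uniform distance: \<epsilon>/2 for the trigonometric
    approximation and 2 (\<epsilon>/8) for the iteration, in total less than \<epsilon>.\<close>
  from trig_poly_dense[OF this vu, of "\<epsilon> / 2"] \<epsilon> obtain v0 where v0: "trig_poly v0" "\<And>x. x \<in> closure \<Omega> \<Longrightarrow> \<bar>vu x - v0 x\<bar> < \<epsilon> / 2"
    by auto
  obtain V P C where der: "\<forall>x. (V has_derivative (\<lambda>h. P True x * fst h + P False x * snd h)) (at x)"
    and near: "\<forall>x. \<bar>v0 x - V x\<bar> \<le> 2 * (\<epsilon> / 8)" and cont: "\<forall>i. continuous_on UNIV (P i)"
    and hold: "\<forall>i x y. \<bar>P i x - P i y\<bar> \<le> C * dist x y powr \<theta>"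
    and weak: "\<forall>\<phi> l L T. c1 \<phi> \<longrightarrow> (\<forall>i. c1 (pd i \<phi>)) \<longrightarrow> (\<forall>x. x \<notin> square l \<longrightarrow> \<phi> x = 0) \<longrightarrow> 0 \<le> L \<longrightarrow> l < L \<longrightarrow>
      ((\<lambda>N. integral (square L) (\<lambda>x. g N x * lap \<phi> x)) \<longlongrightarrow> T) at_top \<longrightarrow>
      integral (square L) (weak_form P \<phi>) = T"
  proof -
    have "0 < \<epsilon> / 8" using \<epsilon> by simp
    from holder_solution[OF conjunct1[OF \<theta>] conjunct2[OF \<theta>] lp v0(1) this] show thesis
      by (elim exE conjE) (rule that)
  qed
  note der = der[rule_format] and near = near[rule_format] and cont = cont[rule_format]
    and hold = hold[rule_format] and weak = weak[rule_format]
  have pd: "pd1 V = P True" "pd2 V = P False"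
    using has_derivative_imp_pd[OF der] by (auto simp: pd_def fun_eq_iff)
  have diff: "V differentiable (at x)" for x using der unfolding differentiable_def by blast
  have "C1_holder \<theta> \<Omega> V"
    unfolding C1_holder_def holder_on_def pd using diff hold
    by (blast intro: continuous_at_imp_continuous_on differentiable_imp_continuous_within)
  moreover have "very_weak_hessian_sol \<Omega> f V"
    unfolding very_weak_hessian_sol_def
  proof (intro allI impI)
    fix \<phi> assume \<phi>: "test_fun \<Omega> \<phi>"
    have sm: "smooth \<phi>" using \<phi> by (simp add: test_fun_def)
    have c: "c1 \<phi>" "\<And>i. c1 (pd i \<phi>)" using sm by (auto intro: smooth_c1 smooth_pd)
    have c2: "continuous_on UNIV (pd i (pd j \<phi>))" for i j by (rule continuous_pd2[OF c(2)])
    let ?h = "weak_form P \<phi>"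
    have "(LINT x:\<Omega>|lebesgue. pd1 V x * pd2 V x * pd1 (pd2 \<phi>) x
          - (1/2) * (pd1 V x)\<^sup>2 * pd2 (pd2 \<phi>) x - (1/2) * (pd2 V x)\<^sup>2 * pd1 (pd1 \<phi>) x) = integral (square L) ?h"
    proof (rule set_lebesgue_integral_eq_integral_square)
      show "\<Omega> \<subseteq> square L" using L(2) square_mono[of "L / 4" L] L(1) by auto
      show "?h absolutely_integrable_on square L"
        by (intro absolutely_integrable_square continuous_intros cont c2)
    qed (simp_all add: test_fun_pd2_zero[OF \<phi>] pd, simp add: pd_def)
    also have "\<dots> = (LINT x:\<Omega>|lebesgue. f x * \<phi> x)"
    proof (rule weak[OF c(1) _ _ _ _ lim[OF \<phi>]])
      show "\<phi> x = 0" if "x \<notin> square (L / 4)" for x using that L(2) test_fun_zero[OF \<phi>] by blast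
    qed (use c L(1) in auto)
    finally show "(LINT x:\<Omega>|lebesgue. pd1 V x * pd2 V x * pd1 (pd2 \<phi>) x
          - (1/2) * (pd1 V x)\<^sup>2 * pd2 (pd2 \<phi>) x - (1/2) * (pd2 V x)\<^sup>2 * pd1 (pd1 \<phi>) x) = (LINT x:\<Omega>|lebesgue. f x * \<phi> x)" .
  qed
  moreover have "\<forall>x\<in>closure \<Omega>. \<bar>vu x - V x\<bar> < \<epsilon>"
  proof
    fix x assume "x \<in> closure \<Omega>"
    then show "\<bar>vu x - V x\<bar> < \<epsilon>" using v0(2)[of x] near[of x] \<epsilon> by linarith
  qed
  ultimately show "\<exists>v. C1_holder \<theta> \<Omega> v \<and> very_weak_hessian_sol \<Omega> f v \<and> (\<forall>x\<in>closure \<Omega>. \<bar>vu x - v x\<bar> < \<epsilon>)"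
    by blast
qed

end
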